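(* Let $p\ge5$ be a prime and let $G$ be a group of order $p^5$ in the isoclinism family $\Phi_3$. (1) Suppose $G$ is not isomorphic to any of $\Phi_3(311)b_r$ ($r=1,\nu$), $\Phi_3(221)a$, $\Phi_3(2111)e$. Let $\chi\in\mathrm{nl}(G)$ with $\chi=\psi^G$ for some $\psi\in\mathrm{Irr}(C_G(G')|G')$. Then $(C_G(G'),\psi)$ is a required pair for $\Omega(\chi)$. (2) Suppose $G\in\{\Phi_3(221)a,\Phi_3(2111)e\}$. Then lifting of characters $\bar\chi\mapsto\chi$ gives a bijection from the (disjoint) union, over the subgroups $K<Z(G)$ with $K\cong C_p$, of the sets $\mathrm{nl}(G/K\,|\,Z(G)/K)$ onto $\mathrm{nl}(G|Z(G))$. Consequently, required pairs for these groups are obtained from quotients: if $\chi\in\mathrm{nl}(G|Z(G))$ is the lift of $\bar\chi\in\mathrm{nl}(G/K\,|\,Z(G)/K)$ and $(H/K,\bar\psi)$ is a required pair for $\Omega(\bar\chi)$, then $(H,\psi)$, with $\psi$ the lift of $\bar\psi$ to $H$, is a required pair for $\Omega(\chi)$. (3) Suppose $G=\Phi_3(311)b_r$ with $r\in\{1,\nu\}$, so that $C_G(G')=\langle\alpha_1,\alpha_2\rangle\cong C_{p^3}\times C_p$. Let $\chi\in\mathrm{nl}(G)$. (a) If $\chi=\psi^G$ for some $\psi\in\mathrm{Irr}(C_G(G')|G')$ such that $\psi(\alpha_1)=\zeta_{p^3}$ is a primitive $p^3$-th root of unity, then $(C_G(G'),\psi)$ is a required pair for $\Omega(\chi)$.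 (b) Let $K=\langle\alpha_3\rangle=\langle\alpha_1^{p^2}\rangle<Z(G)$. Lifting of characters gives a bijection from $\mathrm{nl}(G/K)$ onto $\{\chi\in\mathrm{nl}(G):\mathbb{Q}(\chi)\ne\mathbb{Q}(\zeta_{p^3})\}$. Consequently, if $\chi\in\mathrm{nl}(G)$ with $\mathbb{Q}(\chi)\ne\mathbb{Q}(\zeta_{p^3})$ is the lift of $\bar\chi\in\mathrm{nl}(G/K)$ and $(H/K,\bar\psi)$ is a required pair for $\Omega(\bar\chi)$, then $(H,\psi)$, with $\psi$ the lift of $\bar\psi$ to $H$, is a required pair for $\Omega(\chi)$.
   Context: For a finite group $G$: $\mathrm{Irr}(G)$ is the set of irreducible complex characters, $\mathrm{lin}(G)$ (resp. $\mathrm{nl}(G)$) the subset of linear (resp. non-linear) ones; for $N\trianglelefteq G$, $\mathrm{Irr}(G|N)$ (resp. $\mathrm{nl}(G|N)$) is the set of $\chi$ in $\mathrm{Irr}(G)$ (resp. $\mathrm{nl}(G)$) with $N\nsubseteq\ker\chi$; $\mathbb{Q}(\chi)$ is the field generated over $\mathbb{Q}$ by the values of $\chi$; $\psi^G$ denotes induction. $\Omega(\chi)=m_{\mathbb{Q}}(\chi)\sum_{\sigma\in\mathrm{Gal}(\mathbb{Q}(\chi)/\mathbb{Q})}\chi^\sigma$, with $m_{\mathbb{Q}}(\chi)$ the Schur index. Required pair: for a finite $p$-group $G$ ($p$ odd) and $\chi\in\mathrm{Irr}(G)$, a required pair for (an irreducible rational matrix representation of $G$ affording) $\Omega(\chi)$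 is a pair $(H,\psi)$ with $H\le G$, $\psi\in\mathrm{lin}(H)$, $\psi^G=\chi$ and $\mathbb{Q}(\psi)=\mathbb{Q}(\chi)$. Two groups $G,H$ are isoclinic if there are isomorphisms $G/Z(G)\to H/Z(H)$ and $G'\to H'$ compatible with the commutator maps. $\Phi_3$ (R. James) is the isoclinism family of the order-$p^4$ group $\Phi_3(1^4)=\langle\alpha,\alpha_1,\alpha_2,\alpha_3:[\alpha_1,\alpha]=\alpha_2,[\alpha_2,\alpha]=\alpha_3,\ \alpha^p=\alpha_1^p=\alpha_2^p=\alpha_3^p=1\rangle$ (here $p\ge5$). The special groups of order $p^5$ in it are $\Phi_3(311)b_r=\langle\alpha,\alpha_1,\alpha_2,\alpha_3:[\alpha_1,\alpha]=\alpha_2,[\alpha_2,\alpha]^r=\alpha_1^{p^2}=\alpha_3,\ \alpha^p=\alpha_2^p=\alpha_3^p=1\rangle$ for $r=1,\nu$, where $\nu$ is the smallest positive integer that is a quadratic non-residue mod $p$; $\Phi_3(221)a=\langle\alpha,\alpha_1,\alpha_2,\alpha_3:[\alpha_1,\alpha]=\alpha_2,[\alpha_2,\alpha]=\alpha^p=\alpha_3,\ \alpha_1^{p^2}=\alpha_2^p=\alpha_3^p=1\rangle$; $\Phi_3(2111)e=\langle\alpha,\alpha_1,\alpha_2,\alpha_3:[\alpha_1,\alpha]=\alpha_2,[\alpha_2,\alpha]=\alpha_3,\ \alpha^p=\alpha_1^{p^2}=\alpha_2^p=\alpha_3^p=1\rangle$. Presentations are understood among finite $p$-groups and define groups of the stated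 order; $[x,y]=x^{-1}y^{-1}xy$; relations $[x,y]=1$ between generators whose commutator is not listed are omitted. $C_G(G')$ is the centralizer of $G'$ in $G$ (an abelian subgroup of index $p$). *)

theory Defs
  imports
    "HOL-Algebra.Algebra"
    "HOL-Number_Theory.Number_Theory"
    "Jordan_Normal_Form.VS_Connect"
begin

hide_const (open) Polynomial.order Divisibility.prime

section \<open>Groups\<close>

definition p_group :: "nat \<Rightarrow> ('a, 'b) monoid_scheme \<Rightarrow> bool" where
  "p_group p G \<longleftrightarrow> group G \<and> (\<exists>k. order G = p ^ k)"

definition commutator :: "('a, 'b) monoid_scheme \<Rightarrow> 'a \<Rightarrow> 'a \<Rightarrow> 'a" where
  "commutator G x y = inv\<^bsub>G\<^esub> x \<otimes>\<^bsub>G\<^esub> inv\<^bsub>G\<^esub> y \<otimes>\<^bsub>G\<^esub> x \<otimes>\<^bsub>G\<^esub> y"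

definition centralizer :: "('a, 'b) monoid_scheme \<Rightarrow> 'a set \<Rightarrow> 'a set" where
  "centralizer G S = {g \<in> carrier G. \<forall>s\<in>S. g \<otimes>\<^bsub>G\<^esub> s = s \<otimes>\<^bsub>G\<^esub> g}"

abbreviation center :: "('a, 'b) monoid_scheme \<Rightarrow> 'a set" where
  "center G \<equiv> centralizer G (carrier G)"

abbreviation derived_subgroup :: "('a, 'b) monoid_scheme \<Rightarrow> 'a set" where
  "derived_subgroup G \<equiv> derived G (carrier G)"

abbreviation subgroup_monoid :: "('a, 'b) monoid_scheme \<Rightarrow> 'a set \<Rightarrow> ('a, 'b) monoid_scheme" where
  "subgroup_monoid G H \<equiv> G\<lparr>carrier := H\<rparr>"

text \<open>The subset \<open>A/K\<close> of \<open>G/K\<close>.\<close>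

definition quotient_set :: "('a, 'b) monoid_scheme \<Rightarrow> 'a set \<Rightarrow> 'a set \<Rightarrow> 'a set set" where
  "quotient_set G K A = (\<lambda>a. K #>\<^bsub>G\<^esub> a) ` A"

text \<open>The elements of \<open>\<phi> (Z(G) x)\<close> are the representatives in \<open>H\<close> of that coset of \<open>Z(H)\<close>;
  the commutator does not depend on the choice of representatives.\<close>

definition isoclinic :: "('a, 'b) monoid_scheme \<Rightarrow> ('c, 'd) monoid_scheme \<Rightarrow> bool" where
  "isoclinic G H \<longleftrightarrow> group G \<and> group H \<and>
     (\<exists>\<phi> \<in> iso (G Mod center G) (H Mod center H).
      \<exists>\<theta> \<in> iso (subgroup_monoid G (derived_subgroup G)) (subgroup_monoid H (derived_subgroup H)).
        \<forall>x \<in> carrier G. \<forall>y \<in> carrier G.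
        \<forall>x' \<in> \<phi> (center G #>\<^bsub>G\<^esub> x). \<forall>y' \<in> \<phi> (center G #>\<^bsub>G\<^esub> y).
          \<theta> (commutator G x y) = commutator H x' y')"


section \<open>Presentations among finite \<open>p\<close>-groups\<close>

datatype 'v group_term =
    Gen 'v
  | Unit
  | Comm "'v group_term" "'v group_term"
  | Pow "'v group_term" nat

primrec term_value :: "('a, 'b) monoid_scheme \<Rightarrow> ('v \<Rightarrow> 'a) \<Rightarrow> 'v group_term \<Rightarrow> 'a" where
  "term_value G x (Gen v) = x v"
| "term_value G x Unit = \<one>\<^bsub>G\<^esub>"
| "term_value G x (Comm s t) = commutator G (term_value G x s) (term_value G x t)"
| "term_value G x (Pow s n) = term_value G x s [^]\<^bsub>G\<^esub> n"

definition satisfies_rels ::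
  "('a, 'b) monoid_scheme \<Rightarrow> ('v \<Rightarrow> 'a) \<Rightarrow> ('v group_term \<times> 'v group_term) set \<Rightarrow> bool" where
  "satisfies_rels G x R \<longleftrightarrow>
     range x \<subseteq> carrier G \<and> (\<forall>(s, t) \<in> R. term_value G x s = term_value G x t)"

text \<open>The universal property of a presentation, relative to finite \<open>p\<close>-groups. The test groups
  have carriers in \<^typ>\<open>nat\<close>, which is no restriction because they are finite. The property
  determines the pair \<open>(G, x)\<close> up to isomorphism.\<close>

definition p_presentation ::
  "nat \<Rightarrow> ('v group_term \<times> 'v group_term) set \<Rightarrow> ('a, 'b) monoid_scheme \<Rightarrow> ('v \<Rightarrow> 'a) \<Rightarrow> bool" where
  "p_presentation p R G x \<longleftrightarrow>
     p_group p G \<and> satisfies_rels G x R \<and> generate G (range x) = carrier G \<and>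
     (\<forall>(H :: nat monoid) y. p_group p H \<and> satisfies_rels H y R \<longrightarrow>
        (\<exists>h \<in> hom G H. \<forall>v. h (x v) = y v))"

text \<open>\<open>G\<close> is isomorphic to the group presented by \<open>R\<close>.\<close>

definition p_presented_by ::
  "nat \<Rightarrow> ('v group_term \<times> 'v group_term) set \<Rightarrow> ('a, 'b) monoid_scheme \<Rightarrow> bool" where
  "p_presented_by p R G \<longleftrightarrow> (\<exists>x. p_presentation p R G x)"

datatype gen = Alpha | Alpha1 | Alpha2 | Alpha3

type_synonym relations = "(gen group_term \<times> gen group_term) set"

text \<open>The relations common to all presentations below: \<open>[\<alpha>\<^sub>1, \<alpha>] = \<alpha>\<^sub>2\<close>, and the generators other
  than \<open>\<alpha>\<^sub>1, \<alpha>\<close> and \<open>\<alpha>\<^sub>2, \<alpha>\<close> commute.\<close>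

definition Phi3_common :: relations where
  "Phi3_common =
    {(Comm (Gen Alpha1) (Gen Alpha), Gen Alpha2),
     (Comm (Gen Alpha3) (Gen Alpha), Unit),
     (Comm (Gen Alpha1) (Gen Alpha2), Unit),
     (Comm (Gen Alpha1) (Gen Alpha3), Unit),
     (Comm (Gen Alpha2) (Gen Alpha3), Unit)}"

definition Phi3_1111 :: "nat \<Rightarrow> relations" where
  "Phi3_1111 p = Phi3_common \<union>
    {(Comm (Gen Alpha2) (Gen Alpha), Gen Alpha3),
     (Pow (Gen Alpha) p, Unit),
     (Pow (Gen Alpha1) p, Unit),
     (Pow (Gen Alpha2) p, Unit),
     (Pow (Gen Alpha3) p, Unit)}"

definition Phi3_311b :: "nat \<Rightarrow> nat \<Rightarrow> relations" where
  "Phi3_311b p r = Phi3_common \<union>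
    {(Pow (Comm (Gen Alpha2) (Gen Alpha)) r, Gen Alpha3),
     (Pow (Gen Alpha1) (p\<^sup>2), Gen Alpha3),
     (Pow (Gen Alpha) p, Unit),
     (Pow (Gen Alpha2) p, Unit),
     (Pow (Gen Alpha3) p, Unit)}"

definition Phi3_221a :: "nat \<Rightarrow> relations" where
  "Phi3_221a p = Phi3_common \<union>
    {(Comm (Gen Alpha2) (Gen Alpha), Gen Alpha3),
     (Pow (Gen Alpha) p, Gen Alpha3),
     (Pow (Gen Alpha1) (p\<^sup>2), Unit),
     (Pow (Gen Alpha2) p, Unit),
     (Pow (Gen Alpha3) p, Unit)}"

definition Phi3_2111e :: "nat \<Rightarrow> relations" where
  "Phi3_2111e p = Phi3_common \<union>
    {(Comm (Gen Alpha2) (Gen Alpha), Gen Alpha3),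
     (Pow (Gen Alpha) p, Unit),
     (Pow (Gen Alpha1) (p\<^sup>2), Unit),
     (Pow (Gen Alpha2) p, Unit),
     (Pow (Gen Alpha3) p, Unit)}"

definition least_nonresidue :: "nat \<Rightarrow> nat" where
  "least_nonresidue p = (LEAST n. n > 0 \<and> \<not> QuadRes (int p) (int n))"

definition in_Phi3 :: "nat \<Rightarrow> ('a, 'b) monoid_scheme \<Rightarrow> bool" where
  "in_Phi3 p G \<longleftrightarrow>
     (\<exists>H :: nat monoid. order H = p ^ 4 \<and> p_presented_by p (Phi3_1111 p) H \<and> isoclinic G H)"


section \<open>Complex characters\<close>

text \<open>The unit group of \<^term>\<open>ring_mat TYPE(complex) n ()\<close> is \<open>GL\<^sub>n(\<complex>)\<close>.\<close>

definition representation :: "('a, 'b) monoid_scheme \<Rightarrow> nat \<Rightarrow> ('a \<Rightarrow> complex mat) \<Rightarrow> bool" where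
  "representation G n \<rho> \<longleftrightarrow> \<rho> \<in> hom G (units_of (ring_mat TYPE(complex) n ()))"

definition irreducible_representation ::
  "('a, 'b) monoid_scheme \<Rightarrow> nat \<Rightarrow> ('a \<Rightarrow> complex mat) \<Rightarrow> bool" where
  "irreducible_representation G n \<rho> \<longleftrightarrow> representation G n \<rho> \<and> n > 0 \<and>
     (\<forall>W. VectorSpace.subspace class_ring W (module_vec TYPE(complex) n) \<and>
          (\<forall>g \<in> carrier G. \<forall>w \<in> W. \<rho> g *\<^sub>v w \<in> W) \<longrightarrow>
          W = {0\<^sub>v n} \<or> W = carrier_vec n)"

text \<open>Characters are functions on the carrier, extended by \<^const>\<open>undefined\<close> outside it, so that
  equality of functions is equality of characters.\<close>

definition character_of ::
  "('a, 'b) monoid_scheme \<Rightarrow> nat \<Rightarrow> ('a \<Rightarrow> complex mat) \<Rightarrow> 'a \<Rightarrow> complex" where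
  "character_of G n \<rho> = (\<lambda>g\<in>carrier G. \<Sum>i<n. \<rho> g $$ (i, i))"

definition Irr :: "('a, 'b) monoid_scheme \<Rightarrow> ('a \<Rightarrow> complex) set" where
  "Irr G = {character_of G n \<rho> | n \<rho>. irreducible_representation G n \<rho>}"

definition lin :: "('a, 'b) monoid_scheme \<Rightarrow> ('a \<Rightarrow> complex) set" where
  "lin G = {\<chi> \<in> Irr G. \<chi> \<one>\<^bsub>G\<^esub> = 1}"

definition nl :: "('a, 'b) monoid_scheme \<Rightarrow> ('a \<Rightarrow> complex) set" where
  "nl G = {\<chi> \<in> Irr G. \<chi> \<one>\<^bsub>G\<^esub> \<noteq> 1}"

definition ker_char :: "('a, 'b) monoid_scheme \<Rightarrow> ('a \<Rightarrow> complex) \<Rightarrow> 'a set" where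
  "ker_char G \<chi> = {g \<in> carrier G. \<chi> g = \<chi> \<one>\<^bsub>G\<^esub>}"

definition Irr_over :: "('a, 'b) monoid_scheme \<Rightarrow> 'a set \<Rightarrow> ('a \<Rightarrow> complex) set" where
  "Irr_over G N = {\<chi> \<in> Irr G. \<not> N \<subseteq> ker_char G \<chi>}"

definition nl_over :: "('a, 'b) monoid_scheme \<Rightarrow> 'a set \<Rightarrow> ('a \<Rightarrow> complex) set" where
  "nl_over G N = {\<chi> \<in> nl G. \<not> N \<subseteq> ker_char G \<chi>}"

text \<open>A subfield of \<open>\<complex>\<close> contains \<open>\<rat>\<close>, so the subfield generated by \<open>S\<close> is \<open>\<rat>(S)\<close>.\<close>

definition rat_adjoin :: "complex set \<Rightarrow> complex set" where
  "rat_adjoin S = generate_field (class_ring :: complex ring) S"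

definition char_field :: "('a, 'b) monoid_scheme \<Rightarrow> ('a \<Rightarrow> complex) \<Rightarrow> complex set" where
  "char_field G \<chi> = rat_adjoin (\<chi> ` carrier G)"

definition induced_char ::
  "('a, 'b) monoid_scheme \<Rightarrow> 'a set \<Rightarrow> ('a \<Rightarrow> complex) \<Rightarrow> 'a \<Rightarrow> complex" where
  "induced_char G H \<psi> = (\<lambda>g\<in>carrier G.
     (\<Sum>x\<in>carrier G.
        if inv\<^bsub>G\<^esub> x \<otimes>\<^bsub>G\<^esub> g \<otimes>\<^bsub>G\<^esub> x \<in> H then \<psi> (inv\<^bsub>G\<^esub> x \<otimes>\<^bsub>G\<^esub> g \<otimes>\<^bsub>G\<^esub> x) else 0)
     / of_nat (card H))"

definition lift_char ::
  "('a, 'b) monoid_scheme \<Rightarrow> 'a set \<Rightarrow> ('a set \<Rightarrow> complex) \<Rightarrow> 'a \<Rightarrow> complex" where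
  "lift_char G K \<chi> = (\<lambda>g\<in>carrier G. \<chi> (K #>\<^bsub>G\<^esub> g))"

text \<open>A required pair for \<open>\<Omega>(\<chi>) = m\<^sub>\<rat>(\<chi>) \<Sum>\<^sub>\<sigma> \<chi>\<^sup>\<sigma>\<close>; the condition refers to \<open>\<chi>\<close> only.\<close>

definition required_pair ::
  "('a, 'b) monoid_scheme \<Rightarrow> ('a \<Rightarrow> complex) \<Rightarrow> 'a set \<Rightarrow> ('a \<Rightarrow> complex) \<Rightarrow> bool" where
  "required_pair G \<chi> H \<psi> \<longleftrightarrow>
     subgroup H G \<and> \<psi> \<in> lin (subgroup_monoid G H) \<and> induced_char G H \<psi> = \<chi> \<and>
     char_field (subgroup_monoid G H) \<psi> = char_field G \<chi>"

definition primitive_root_of_unity :: "nat \<Rightarrow> complex \<Rightarrow> bool" where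
  "primitive_root_of_unity n z \<longleftrightarrow> n > 0 \<and> z ^ n = 1 \<and> (\<forall>m. 0 < m \<and> m < n \<longrightarrow> z ^ m \<noteq> 1)"

definition zeta :: "nat \<Rightarrow> complex" where
  "zeta n = cis (2 * pi / real n)"

end

(* Write A = C_G(G'), an abelian normal subgroup of index p, G' = <c, d> with c = [b, a] and d = [c, a]
   central, and let psi be a linear character of A that is nontrivial on G' and induces chi. The
   conjugates of psi differ on G', so sums of chi over cosets of subgroups of G' recover psi once enough
   roots of unity lie in Q(chi): if psi(d) is nontrivial then Q(psi) = Q(chi). If psi(d) = 1 then Q(chi)
   contains the p-th roots of unity, and Q(psi) can only be larger if psi takes values of higher order;
   this requires b^p outside <d>. In that case adjusting a by a power of b and rescaling a and b produces
   generators that satisfy one of the four special presentations. For these, the characters with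
   d in the kernel are inflated from quotients by central subgroups of order p. For 311b the field
   separates the two kinds of characters because zeta_{p^3} is not in Q(zeta_{p^2}) (Eisenstein). *)
theory Submission
  imports Defs "Jordan_Normal_Form.Char_Poly"
begin

hide_const (open) Polynomial.order Divisibility.prime Divisibility.irreducible

subsection \<open>Subfields of the complex numbers\<close>

text \<open>In place of Clifford theory there is one computation. An irreducible representation of
  degree n has a common eigenvector for A, whose eigenvalues form a linear character psi. Comparing
  traces gives chi = kappa * Ind(psi) with kappa = n |A| / |G|. A nonzero rational factor affects
  neither fields of values nor kernels, so this form suffices. Presentations are handled by
  counting. Collecting words to a^i b^j c^k d^l shows that the relations force order at most p^3 m,
  where m is the exponent in the relation for alpha_1. A group attaining this bound has unique
  normal forms and satisfies the universal property. In the special groups the same bound with m = p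
  shows that b^p is outside <d>. The structure of G is recorded by commutator relations and by
  powers modulo the centre, because this is what an isoclinism transfers; the orders of a and b
  remain open. The adjustment of a is under control because p >= 5 makes p divide C(p,2) and C(p,3),
  so that (a b^t)^p = a^p b^(pt).\<close>

definition csubfield :: "complex set \<Rightarrow> bool" where
  "csubfield F \<longleftrightarrow> 1 \<in> F \<and> (\<forall>x\<in>F. - x \<in> F \<and> inverse x \<in> F \<and> (\<forall>y\<in>F. x + y \<in> F \<and> x * y \<in> F))"

lemma csubfieldD:
  assumes "csubfield F"
  shows "1 \<in> F" "x \<in> F \<Longrightarrow> - x \<in> F" "x \<in> F \<Longrightarrow> inverse x \<in> F"
    "x \<in> F \<Longrightarrow> y \<in> F \<Longrightarrow> x + y \<in> F" "x \<in> F \<Longrightarrow> y \<in> F \<Longrightarrow> x * y \<in> F"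
  using assms by (auto simp: csubfield_def)

lemma csubfield_zero: "csubfield F \<Longrightarrow> 0 \<in> F"
  using csubfieldD(1,2,4)[of F] by (metis add.right_inverse)

lemma csubfield_divide: "csubfield F \<Longrightarrow> x \<in> F \<Longrightarrow> y \<in> F \<Longrightarrow> x / y \<in> F"
  by (simp add: csubfieldD divide_inverse)

lemma csubfield_power: "csubfield F \<Longrightarrow> x \<in> F \<Longrightarrow> x ^ n \<in> F"
  by (induction n) (auto simp: csubfieldD)

lemma csubfield_of_nat: "csubfield F \<Longrightarrow> of_nat n \<in> F"
  by (induction n) (auto simp: csubfieldD csubfield_zero)

lemma csubfield_sum:
  assumes "csubfield F" "\<And>x. x \<in> S \<Longrightarrow> f x \<in> F"
  shows "sum f S \<in> F"
  using assms by (induction S rule: infinite_finite_induct) (auto simp: csubfieldD csubfield_zero)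

lemma class_ring_inv:
  assumes "h \<noteq> (0::complex)" shows "m_inv class_ring h = inverse h"
  using assms by (simp add: class_ring_simps)

lemma csubfield_rat_adjoin: "csubfield (rat_adjoin S)"
proof -
  let ?F = "rat_adjoin S"
  have zero: "(0::complex) \<in> ?F"
    using field.zero_in_generate[OF class_field, of S] by (simp add: rat_adjoin_def)
  have "inverse x \<in> ?F" if "x \<in> ?F" for x
  \<comment> \<open>\<open>csubfield\<close> asks for closure under the total
    \<open>inverse\<close>, with \<open>inverse 0 = 0\<close>, while
    \<open>generate_field.m_inv\<close> inverts nonzero elements only; hence the separate
    case.\<close>
  proof (cases "x = 0")
    case False
    then show ?thesis
      using generate_field.m_inv[of x "class_ring :: complex ring" S] that
      by (simp add: rat_adjoin_def class_ring_inv)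
  qed (use zero in simp)
  moreover have "- x \<in> ?F" if "x \<in> ?F" for x
    using generate_field.a_inv[of x "class_ring :: complex ring" S] that
    by (simp add: rat_adjoin_def class_ring_simps)
  ultimately show ?thesis
    using generate_field.one[of "class_ring :: complex ring" S]
      generate_field.eng_add[of _ "class_ring :: complex ring" S]
      generate_field.eng_mult[of _ "class_ring :: complex ring" S]
    by (auto simp: csubfield_def rat_adjoin_def)
qed

lemma rat_adjoin_superset: "S \<subseteq> rat_adjoin S"
  by (auto simp: rat_adjoin_def intro: generate_field.incl)

lemma rat_adjoin_least:
  assumes "csubfield F" "S \<subseteq> F"
  shows "rat_adjoin S \<subseteq> F"
proof
  fix x assume "x \<in> rat_adjoin S"
  then show "x \<in> F" unfolding rat_adjoin_def
    by (induction rule: generate_field.induct)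
      (use assms in \<open>auto simp: csubfieldD class_ring_inv class_ring_simps\<close>)
qed

section \<open>Roots of unity of prime power order\<close>

lemma power_gcd_eq_one:
  fixes z :: complex
  assumes "z ^ m = 1" "z ^ n = 1" "m \<noteq> 0"
  shows "z ^ gcd m n = 1"
proof -
  obtain x y where "m * x = n * y + gcd m n" using bezout_nat[OF assms(3)] by blast
  then have "z ^ (m * x) = z ^ (n * y) * z ^ gcd m n" by (metis power_add)
  then show ?thesis using assms by (simp add: power_mult)
qed

text \<open>The two conditions on z say that its order is exactly p^(e+1), since every proper
  divisor of p^(e+1) divides p^e. This pair is the working form of primitivity in what
  follows.\<close>

lemma power_prime_power_eq_one:
  fixes z :: complex
  assumes p: "prime p" and "z ^ (p ^ Suc e) = 1" "z ^ (p ^ e) \<noteq> 1" and m: "z ^ m = 1"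
  shows "p ^ Suc e dvd m"
proof (cases "m = 0")
  case False
  let ?g = "gcd m (p ^ Suc e)"
  obtain i where i: "i \<le> Suc e" "?g = p ^ i"
    using divides_primepow_nat[OF p, of ?g "Suc e"] by auto
  have g: "z ^ (p ^ i) = 1" using power_gcd_eq_one[OF m assms(2) False] i by simp
  have "i = Suc e"
  proof (rule ccontr)
    assume "i \<noteq> Suc e"
    then obtain k where "e = i + k" using i(1) by (metis le_SucE le_Suc_ex)
    then have "z ^ (p ^ e) = (z ^ (p ^ i)) ^ (p ^ k)" by (simp add: power_add power_mult)
    then show False using g assms(3) by simp
  qed
  then show ?thesis using i(2) by (metis gcd_dvd1)
qed simp

text \<open>Counting: the powers z^i with i < p^(e+1) are distinct, and there are exactly that many
  complex roots of unity of this exponent. A subfield that contains one root of full order therefore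
  contains them all.\<close>

lemma root_of_unity_power:
  fixes z w :: complex
  assumes p: "prime p" and z: "z ^ (p ^ Suc e) = 1" "z ^ (p ^ e) \<noteq> 1" and w: "w ^ (p ^ Suc e) = 1"
  shows "\<exists>i. w = z ^ i"
proof -
  let ?n = "p ^ Suc e"
  have n: "?n > 0" using p by (simp add: prime_gt_0_nat)
  have z0: "z \<noteq> 0" using z(1) n by (metis power_0_left zero_neq_one less_not_refl)
  have inj: "inj_on (\<lambda>i. z ^ i) {..<?n}"
  proof (rule linorder_inj_onI)
    fix i j assume "i < j" "i \<in> {..<?n}" "j \<in> {..<?n}"
    show "z ^ i \<noteq> z ^ j"
    proof
      assume "z ^ i = z ^ j"
      then have "z ^ (j - i) = 1" using \<open>i < j\<close> z0
        by (metis diff_self_eq_0 less_imp_le power_diff right_inverse_eq power_not_zero)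
      then have "?n dvd j - i" by (rule power_prime_power_eq_one[OF p z])
      then show False using \<open>i < j\<close> \<open>j \<in> _\<close> by (auto dest!: dvd_imp_le)
    qed
  qed auto
  have "(\<lambda>i. z ^ i) ` {..<?n} = {x. x ^ ?n = 1}"
  proof (rule card_subset_eq)
    show "finite {x::complex. x ^ ?n = 1}" using n by (intro finite_roots_unity) simp
    show "(\<lambda>i. z ^ i) ` {..<?n} \<subseteq> {x. x ^ ?n = 1}"
    proof clarify
      fix i show "(z ^ i) ^ ?n = 1" using z(1) by (metis mult.commute power_mult power_one)
    qed
    show "card ((\<lambda>i. z ^ i) ` {..<?n}) = card {x::complex. x ^ ?n = 1}"
      using card_image[OF inj] card_roots_unity_eq[OF n] by simp
  qed
  then show ?thesis using w by blast
qed

subsection \<open>Prime power cyclotomic fields\<close>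

text \<open>Take the least i for which p does not divide the i-th coefficient of g. Modulo p the
  i-th coefficient of f is then g_i h_0, which is nonzero, and degree h > 0 keeps i below the degree
  of f.\<close>

lemma eisenstein_aux:
  fixes f g h :: "int poly" and p :: int
  assumes p: "prime p" and f: "f = g * h" and dvd: "\<And>i. i < degree f \<Longrightarrow> p dvd coeff f i"
    and lead: "lead_coeff f = 1" and deg: "degree h > 0" and g0: "p dvd coeff g 0" and h0: "\<not> p dvd coeff h 0"
  shows False
proof -
  have nz: "g \<noteq> 0" "h \<noteq> 0" using lead f by auto
  have "lead_coeff g * lead_coeff h = 1" using lead f by (simp add: lead_coeff_mult)
  then have lg: "\<not> p dvd lead_coeff g"
    using p by (metis dvd_mult2 not_prime_unit)
  define i where "i = (LEAST i. \<not> p dvd coeff g i)"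
  have i: "\<not> p dvd coeff g i" unfolding i_def using lg by (rule LeastI)
  have min: "p dvd coeff g j" if "j < i" for j using not_less_Least that unfolding i_def by blast
  have "i \<le> degree g" unfolding i_def using lg by (rule Least_le)
  then have "i < degree f" using f nz deg by (simp add: degree_mult_eq)
  then have "p dvd coeff f i" by (rule dvd)
  also have "coeff f i = (\<Sum>j<i. coeff g j * coeff h (i - j)) + coeff g i * coeff h 0"
    by (simp add: f coeff_mult lessThan_Suc_atMost[symmetric])
  finally have "p dvd coeff g i * coeff h 0"
    by (subst (asm) dvd_add_right_iff) (auto intro!: dvd_sum dvd_mult2 min)
  then show False using i h0 p by (simp add: prime_dvd_mult_iff)
qed

lemma eisenstein:
  fixes f :: "int poly" and p :: int
  assumes p: "prime p" and lead: "lead_coeff f = 1" and deg: "degree f > 0"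
    and dvd: "\<And>i. i < degree f \<Longrightarrow> p dvd coeff f i" and sq: "\<not> p\<^sup>2 dvd coeff f 0"
  shows "irreducible f"
proof (rule Factorial_Ring.irreducibleI)
  show "f \<noteq> 0" using lead by auto
  show "\<not> f dvd 1" using deg by (auto simp: poly_dvd_1)
next
  fix g h assume f: "f = g * h"
  \<comment> \<open>A constant factor of a monic polynomial divides the leading coefficient 1, so
    only factorisations into positive degrees remain to be excluded.\<close>
  have unit: "u dvd 1" if u: "u * v = f" "degree u = 0" for u v :: "int poly"
  proof -
    obtain c where "u = [:c:]" using u(2) by (meson degree_eq_zeroE)
    then show ?thesis using u(1) lead
      by (metis dvd_triv_left is_unit_const_poly_iff lead_coeff_mult lead_coeff_pCons(2))
  qed
  show "g dvd 1 \<or> h dvd 1"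
  proof (rule ccontr)
    assume "\<not> ?thesis"
    then have d: "degree g > 0" "degree h > 0"
      using unit[of g h] unit[of h g] f by (auto simp: mult.commute)
    have "p dvd coeff g 0 * coeff h 0" using dvd[of 0] deg f by (simp add: coeff_mult)
    moreover have "\<not> (p dvd coeff g 0 \<and> p dvd coeff h 0)"
      using sq f by (auto simp: coeff_mult power2_eq_square mult_dvd_mono)
    \<comment> \<open>As p^2 does not divide f(0), exactly one of the two constant coefficients is a
      multiple of p. This is the asymmetric situation of \<open>eisenstein_aux\<close>.\<close>
    ultimately consider "p dvd coeff g 0" "\<not> p dvd coeff h 0" | "p dvd coeff h 0" "\<not> p dvd coeff g 0"
      using p by (auto simp: prime_dvd_mult_iff)
    then show False
      by cases (use eisenstein_aux[OF p f dvd lead d(2)] eisenstein_aux[OF p _ dvd lead d(1), of h] f in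
          \<open>auto simp: mult.commute\<close>)
  qed
qed

text \<open>Iterated Frobenius: taking p-th powers preserves congruences modulo p, and the inner
  binomial coefficients of (y+1)^p are multiples of p. Divisibility by a constant polynomial
  expresses the congruence inside Z[x].\<close>

lemma binomial_power_cong:
  fixes p :: nat
  assumes p: "prime p"
  shows "[:int p:] dvd [:1, 1:] ^ (p ^ k) - (monom 1 (p ^ k) + 1)"
proof (induction k)
  case 0
  have "[:1, 1:] = monom 1 1 + (1 :: int poly)" by (simp add: monom_altdef one_pCons)
  then show ?case by simp
next
  case (Suc k)
  let ?P = "[:int p:]" and ?y = "monom (1::int) (p ^ k)"
  have "?P dvd ([:1, 1:] ^ (p ^ k)) ^ p - (?y + 1) ^ p"
    using Suc.IH by (metis dvd_mult2 power_diff_sumr2)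
  moreover have "?P dvd (?y + 1) ^ p - (?y ^ p + 1)"
  proof -
    have "{..p} = insert 0 (insert p {0<..<p})" using p by (auto simp: prime_gt_0_nat)
    then have "(?y + 1) ^ p = 1 + (?y ^ p + (\<Sum>i\<in>{0<..<p}. of_nat (p choose i) * ?y ^ i))"
      using prime_gt_0_nat[OF p] by (simp add: binomial_ring)
    moreover have "?P dvd of_nat (p choose i) * ?y ^ i" if "i \<in> {0<..<p}" for i
    proof -
      have "p dvd p choose i" using that p by (intro dvd_choose_prime) auto
      then have "int p dvd int (p choose i)" by simp
      then have "?P dvd of_nat (p choose i)"
        by (metis const_poly_dvd_const_poly_iff of_int_of_nat_eq of_int_poly of_nat_poly)
      then show ?thesis by (rule dvd_mult2)
    qed
    ultimately show ?thesis by (auto intro!: dvd_sum)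
  qed
  ultimately have "?P dvd ([:1, 1:] ^ (p ^ k)) ^ p - (?y ^ p + 1)"
    by (metis (no_types, lifting) diff_add_cancel dvd_add add_diff_eq)
  moreover have "?y ^ p = monom 1 (p ^ Suc k)" by (simp add: monom_power mult.commute)
  ultimately show ?case by (simp add: power_mult[symmetric] mult.commute)
qed

(* The cyclotomic polynomial of order p^(e+1), shifted by 1. *)
definition shifted_cyclotomic :: "nat \<Rightarrow> nat \<Rightarrow> int poly" where
  "shifted_cyclotomic p e = (\<Sum>i<p. ([:1, 1:] ^ (p ^ e)) ^ i)"

lemma shifted_cyclotomic_mult:
  "([:1, 1:] ^ (p ^ e) - 1) * shifted_cyclotomic p e = [:1, 1:] ^ (p ^ Suc e) - 1"
  unfolding shifted_cyclotomic_def
  by (simp only: power_diff_1_eq[symmetric]) (simp add: power_mult[symmetric] mult.commute)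

lemma shifted_cyclotomic_root:
  fixes z :: complex
  assumes "z ^ (p ^ Suc e) = 1" "z ^ (p ^ e) \<noteq> 1"
  shows "poly (map_poly of_int (shifted_cyclotomic p e)) (z - 1) = 0"
proof -
  have "poly (map_poly of_int (([:1, 1:] ^ (p ^ e) - 1) * shifted_cyclotomic p e)) (z - 1) = z ^ (p ^ Suc e) - 1"
    unfolding shifted_cyclotomic_mult by (simp add: hom_distribs)
  then show ?thesis using assms by (simp add: hom_distribs)
qed

text \<open>Eisenstein at p. Put y = (1+x)^N with N = p^e. Modulo p the identity (y - 1) f = y^p - 1
  becomes x^N f = x^(pN), so p divides all coefficients of f below the leading one. The constant
  coefficient is p, because each of the p summands is 1 at x = 0.\<close>

lemma irreducible_shifted_cyclotomic:
  assumes p: "prime p"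
  shows "irreducible (shifted_cyclotomic p e)"
proof -
  let ?f = "shifted_cyclotomic p e" and ?x = "[:1, 1:] :: int poly" and ?P = "[:int p:]"
  define N where "N = p ^ e"
  have p0: "p > 1" "N > 0" using prime_gt_1_nat[OF p] by (auto simp: N_def)
  have mon: "lead_coeff (?x ^ n) = 1" "degree (?x ^ n) = n" for n
  proof -
    show "lead_coeff (?x ^ n) = 1" by (simp only: lead_coeff_power) simp
    show "degree (?x ^ n) = n" by (simp add: degree_power_eq)
  qed
  have mon1: "lead_coeff (?x ^ n - 1) = 1" "degree (?x ^ n - 1) = n" if "n > 0" for n
  proof -
    show "degree (?x ^ n - 1) = n" using mon(2)[of n] that
      by (metis degree_1 degree_add_eq_left degree_minus diff_conv_add_uminus)
    then show "lead_coeff (?x ^ n - 1) = 1" using mon[of n] that by simp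
  qed
  have eq: "(?x ^ N - 1) * ?f = ?x ^ (p * N) - 1"
    using shifted_cyclotomic_mult[of p e] by (simp add: N_def)
  have pN: "p * N > 0" using p0 by simp
  have "degree (?x ^ N - 1) + degree ?f = p * N"
    using mon1(2)[OF pN] eq by (metis degree_mult_eq degree_0 less_not_refl mult_eq_0_iff pN)
  then have deg: "degree ?f = p * N - N" using mon1(2)[OF p0(2)] by simp
  have lead: "lead_coeff ?f = 1"
    using mon1(1)[OF pN] mon1(1)[OF p0(2)] eq by (metis lead_coeff_mult mult_1)
  have "?P dvd (?x ^ (p * N) - (monom 1 (p * N) + 1)) - (?x ^ N - (monom 1 N + 1)) * ?f"
    using binomial_power_cong[OF p, of e] binomial_power_cong[OF p, of "Suc e"]
    by (simp add: N_def dvd_diff)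
  also have "\<dots> = monom 1 N * ?f - monom 1 (p * N)"
    using eq by (simp add: algebra_simps)
  finally have dv: "?P dvd monom 1 N * ?f - monom 1 (p * N)" .
  have co: "int p dvd coeff ?f i" if "i < degree ?f" for i
  proof -
    have "int p dvd coeff (monom 1 N * ?f - monom 1 (p * N)) (N + i)"
      using dv by (simp add: const_poly_dvd_iff)
    then show ?thesis using that deg by (auto simp: coeff_monom_mult split: if_splits)
  qed
  have c0: "coeff ?f 0 = int p"
    unfolding poly_0_coeff_0[symmetric] shifted_cyclotomic_def by (simp add: poly_sum)
  show ?thesis
  proof (rule eisenstein[of "int p"])
    show "degree ?f > 0" using deg p0 by simp
    show "\<not> (int p)\<^sup>2 dvd coeff ?f 0" unfolding c0 using p0
      by (auto simp: power2_eq_square dest: zdvd_imp_le)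
  qed (use p lead co in auto)
qed

(* Take an element of minimal degree of the ideal generated by f and q. *)
lemma irreducible_int_poly_cases:
  fixes f q :: "int poly"
  assumes irr: "irreducible f" and deg: "degree f > 0"
  shows "(\<exists>u v m. m \<noteq> 0 \<and> u * q + v * f = [:m:]) \<or> (\<exists>a. a \<noteq> 0 \<and> f dvd Polynomial.smult a q)"
proof -
  define I where "I = {g. \<exists>u v. g = u * q + v * f}"
  have f0: "f \<noteq> 0" using irr by auto
  have fI: "f \<in> I" "q \<in> I" unfolding I_def
    by (auto intro: exI[of _ 0] exI[of _ 1])
  have "\<exists>g. g \<in> I \<and> g \<noteq> 0" using fI f0 by blast
  then obtain g where g: "g \<in> I" "g \<noteq> 0" and min: "\<And>h. h \<in> I \<Longrightarrow> h \<noteq> 0 \<Longrightarrow> degree g \<le> degree h"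
    using ex_has_least_nat[of "\<lambda>g. g \<in> I \<and> g \<noteq> 0" _ degree] by blast
  have dv: "\<exists>a. a \<noteq> 0 \<and> g dvd Polynomial.smult a h" if h: "h \<in> I" for h
  proof -
    \<comment> \<open>Integer coefficients call for pseudo-division, which is the origin of the
      scalar a. The remainder stays in the ideal, so minimality of the degree makes it zero.\<close>
    let ?r = "pseudo_mod h g"
    obtain a s where a: "a \<noteq> 0" "Polynomial.smult a h = g * s + ?r"
      using pseudo_mod(1)[OF g(2)] by blast
    obtain u v u' v' where uv: "g = u * q + v * f" "h = u' * q + v' * f"
      using g h by (auto simp: I_def)
    have "?r = (Polynomial.smult a u' - u * s) * q + (Polynomial.smult a v' - v * s) * f"
      using a(2) uv by (simp add: algebra_simps smult_add_right eq_diff_eq)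
    then have "?r \<in> I" unfolding I_def by blast
    then have "?r = 0" using min[of ?r] pseudo_mod(2)[OF g(2)] by (meson leD)
    then show ?thesis using a by auto
  qed
  obtain a s where a: "a \<noteq> 0" "Polynomial.smult a f = g * s" using dv[OF fI(1)] by (auto simp: dvd_def)
  \<comment> \<open>From a f = g s: if f divides g, the second alternative follows; if f divides s,
    then g is a constant, and this is the m of the first alternative.\<close>
  have "prime_elem f" using irr by (rule irreducible_imp_prime_elem)
  then have "f dvd g \<or> f dvd s"
    using a by (metis dvd_refl dvd_smult prime_elem_dvd_mult_iff)
  then show ?thesis
  proof
    assume "f dvd g"
    then show ?thesis using dv[OF fI(2)] by (meson dvd_trans)
  next
    assume "f dvd s"
    then obtain t where "s = f * t" by blast
    then have "f * [:a:] = f * (g * t)" using a(2) by (simp add: algebra_simps)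
    then have "[:a:] = g * t" using f0 by (metis mult_cancel_left)
    then have "degree g + degree t = 0" using a(1)
      by (metis degree_mult_eq degree_pCons_0 mult_eq_0_iff pCons_eq_0_iff)
    then have "degree g = 0" by simp
    then obtain m where m: "g = [:m:]" by (rule degree_eq_zeroE)
    then have "m \<noteq> 0" using g(2) by auto
    then show ?thesis using g(1) m unfolding I_def by fastforce
  qed
qed

(* F is the fixed field of the automorphism w \<mapsto> w^(1+p^e) of \<rat>(z). *)
lemma prime_power_root_not_in_subfield:
  fixes z :: complex
  assumes p: "prime p" and z: "z ^ (p ^ Suc e) = 1" "z ^ (p ^ e) \<noteq> 1" and e: "e > 0"
  shows "\<exists>F. csubfield F \<and> z ^ p \<in> F \<and> z \<notin> F"
proof -
  let ?f = "shifted_cyclotomic p e"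
  let ?ev = "\<lambda>q::int poly. poly (map_poly complex_of_int q)"
  \<comment> \<open>The conjugate of z under that automorphism. It satisfies the same two conditions
    as z, because z'^p = z^p and e > 0 makes p^e a multiple of p.\<close>
  define z' where "z' = z ^ (1 + p ^ e)"
  have zp: "z' ^ p = z ^ p" using z(1)
    by (simp add: z'_def power_mult_distrib power_mult[symmetric] mult.commute)
  obtain k where k: "p ^ e = p * k" using e by (cases e) auto
  have z': "z' ^ (p ^ e) = z ^ (p ^ e)" by (simp add: k power_mult zp)
  have z'1: "z' ^ (p ^ Suc e) = 1" using z(1) zp by (simp add: power_mult)
  define w w' where "w = z - 1" and "w' = z' - 1"
  have root: "?ev ?f w = 0" "?ev ?f w' = 0"
    unfolding w_def w'_def using shifted_cyclotomic_root z z' z'1 by auto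
  have irr: "irreducible ?f" by (rule irreducible_shifted_cyclotomic[OF p])
  have degf: "degree ?f > 0"
  proof (rule ccontr)
    assume "\<not> ?thesis"
    then obtain c where c: "?f = [:c:]" using degree_eq_zeroE by blast
    then have "c = 0" using root by ((simp add: poly_altdef; fail) | (simp add: map_poly_def; fail) | (simp add: hom_distribs; fail) | (simp add: of_int_hom.map_poly_pCons_hom; fail)|(auto simp: map_poly_def))
    then show False using irr c by auto
  qed
  \<comment> \<open>Each integer polynomial either vanishes at both conjugates or is inverted at
    both by one polynomial u, up to a nonzero integer. This replaces the extension of the
    automorphism to the whole field.\<close>
  have dich: "(\<exists>u M. M \<noteq> 0 \<and> ?ev u w * ?ev q w = of_int M \<and> ?ev u w' * ?ev q w' = of_int M)
    \<or> (?ev q w = 0 \<and> ?ev q w' = 0)" for q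
    using irreducible_int_poly_cases[OF irr degf, of q]
  proof (elim disjE exE conjE)
    fix u v m assume m: "m \<noteq> 0" "u * q + v * ?f = [:m:]"
    have "?ev (u * q + v * ?f) x = ?ev [:m:] x" for x using m by simp
    then have "?ev u x * ?ev q x + ?ev v x * ?ev ?f x = of_int m" for x by (simp add: hom_distribs)
    then show ?thesis using root m(1) by (metis add.right_neutral mult_zero_right)
  next
    fix a assume a: "a \<noteq> 0" "?f dvd Polynomial.smult a q"
    then obtain s where s: "Polynomial.smult a q = ?f * s" by blast
    have "?ev (Polynomial.smult a q) x = ?ev (?f * s) x" for x using s by simp
    then have "of_int a * ?ev q x = ?ev ?f x * ?ev s x" for x by (simp add: hom_distribs)
    then show ?thesis using root a(1) by (metis mult_eq_0_iff of_int_eq_0_iff)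
  qed
  \<comment> \<open>Elements with an expression q(w)/m that takes the same value at w'. Integer
    denominators are enough, since \<open>dich\<close> supplies inverses in this form.\<close>
  define F where "F = {x. \<exists>q m. m \<noteq> 0 \<and> x * of_int m = ?ev q w \<and> x * of_int m = ?ev q w'}"
  have FI: "x \<in> F" if "m \<noteq> 0" "x * of_int m = ?ev q w" "x * of_int m = ?ev q w'" for x m q
    using that unfolding F_def by blast
  have "csubfield F" unfolding csubfield_def
  proof (intro conjI ballI)
    show "1 \<in> F" by (rule FI[of 1 _ 1]) auto
  next
    fix x assume "x \<in> F"
    then obtain q m where q: "m \<noteq> 0" "x * of_int m = ?ev q w" "x * of_int m = ?ev q w'"
      unfolding F_def by blast
    show "- x \<in> F"
      by (rule FI[of m _ "- q"]) (use q in \<open>auto simp: hom_distribs\<close>)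
    show "inverse x \<in> F"
    proof (cases "x = 0")
      case True
      then show ?thesis using \<open>x \<in> F\<close> by simp
    next
      case False
      then have "?ev q w \<noteq> 0" using q by auto
      then obtain u M where u: "M \<noteq> 0" "?ev u w * ?ev q w = of_int M" "?ev u w' * ?ev q w' = of_int M"
        using dich[of q] by blast
      have "inverse x * of_int M = ?ev u y * of_int m"
        if "?ev u y * ?ev q y = of_int M" "x * of_int m = ?ev q y" for y
      proof -
        have "inverse x * of_int M = inverse x * (?ev u y * (x * of_int m))" using that by metis
        then show ?thesis using False by simp
      qed
      from this[OF u(2) q(2)] this[OF u(3) q(3)] show ?thesis
        by (intro FI[OF u(1), of _ "Polynomial.smult m u"]) (simp_all add: hom_distribs mult.commute)
    qed
    fix y assume "y \<in> F"
    then obtain r n where r: "n \<noteq> 0" "y * of_int n = ?ev r w" "y * of_int n = ?ev r w'"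
      unfolding F_def by blast
    have add: "(x + y) * of_int (m * n) = of_int n * (x * of_int m) + of_int m * (y * of_int n)"
      by (simp add: algebra_simps)
    show "x + y \<in> F"
      by (rule FI[of "m * n" _ "Polynomial.smult n q + Polynomial.smult m r"], simp add: q r)
        (subst add, simp only: q(2) r(2), simp add: hom_distribs, subst add, simp only: q(3) r(3), simp add: hom_distribs)
    have mult: "(x * y) * of_int (m * n) = (x * of_int m) * (y * of_int n)" by simp
    show "x * y \<in> F"
      by (rule FI[of "m * n" _ "q * r"], simp add: q r)
        (subst mult, simp only: q(2) r(2), simp add: hom_distribs, subst mult, simp only: q(3) r(3), simp add: hom_distribs)
  qed
  moreover have "z ^ p \<in> F"
    by (rule FI[of 1 _ "[:1, 1:] ^ p"]) (simp_all add: hom_distribs w_def w'_def zp)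
  moreover have "z \<notin> F"
  proof
    assume "z \<in> F"
    then obtain q m where q: "m \<noteq> 0" "z * of_int m = ?ev q w" "z * of_int m = ?ev q w'"
      unfolding F_def by blast
    \<comment> \<open>If z = q(w)/m, then q - m(1+x) vanishes at w and hence at w'. This yields z' =
      z, that is z^(p^e) = 1.\<close>
    have "?ev (q - Polynomial.smult m [:1, 1:]) w = 0"
      using q(2) by (simp add: hom_distribs w_def algebra_simps)
    then have "?ev (q - Polynomial.smult m [:1, 1:]) w' = 0"
      using dich[of "q - Polynomial.smult m [:1, 1:]"] by auto
    then have "z' * of_int m = z * of_int m"
      using q(3) by (auto simp: hom_distribs w'_def algebra_simps)
    then have "z * z ^ (p ^ e) = z" using q(1) by (simp add: z'_def)
    moreover have "z \<noteq> 0" using z(1) p by (metis not_prime_0 power_0_left power_eq_0_iff zero_neq_one)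
    ultimately show False using z(2) by simp
  qed
  ultimately show ?thesis by blast
qed

subsection \<open>Representations and characters\<close>

lemma representationD:
  assumes "group G" "representation G n \<rho>"
  shows "g \<in> carrier G \<Longrightarrow> \<rho> g \<in> carrier_mat n n"
    "g \<in> carrier G \<Longrightarrow> h \<in> carrier G \<Longrightarrow> \<rho> (g \<otimes>\<^bsub>G\<^esub> h) = \<rho> g * \<rho> h"
    "\<rho> \<one>\<^bsub>G\<^esub> = 1\<^sub>m n"
proof -
  let ?R = "ring_mat TYPE(complex) n ()"
  interpret R: monoid ?R using ring.is_monoid[OF ring_mat] .
  have hom: "\<rho> \<in> hom G (units_of ?R)" using assms(2) by (simp add: representation_def)
  show "g \<in> carrier G \<Longrightarrow> \<rho> g \<in> carrier_mat n n"
    using hom_in_carrier[OF hom] by (auto simp: units_of_carrier Units_def ring_mat_simps)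
  show "g \<in> carrier G \<Longrightarrow> h \<in> carrier G \<Longrightarrow> \<rho> (g \<otimes>\<^bsub>G\<^esub> h) = \<rho> g * \<rho> h"
    using hom_mult[OF hom] by (simp add: units_of_mult ring_mat_simps)
  show "\<rho> \<one>\<^bsub>G\<^esub> = 1\<^sub>m n"
    using hom_one[OF hom assms(1) R.units_group] by (simp add: units_of_one ring_mat_simps)
qed

lemma representationI:
  assumes "group G" "\<And>g. g \<in> carrier G \<Longrightarrow> \<rho> g \<in> carrier_mat n n"
    "\<And>g h. g \<in> carrier G \<Longrightarrow> h \<in> carrier G \<Longrightarrow> \<rho> (g \<otimes>\<^bsub>G\<^esub> h) = \<rho> g * \<rho> h"
    "\<rho> \<one>\<^bsub>G\<^esub> = 1\<^sub>m n"
  shows "representation G n \<rho>"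
  unfolding representation_def
proof (rule homI)
  interpret group G by fact
  fix g assume g: "g \<in> carrier G"
  have "\<rho> g * \<rho> (inv\<^bsub>G\<^esub> g) = 1\<^sub>m n" "\<rho> (inv\<^bsub>G\<^esub> g) * \<rho> g = 1\<^sub>m n"
    using g assms(3)[of g "inv\<^bsub>G\<^esub> g"] assms(3)[of "inv\<^bsub>G\<^esub> g" g] assms(4) by auto
  then show "\<rho> g \<in> carrier (units_of (ring_mat TYPE(complex) n ()))"
    using assms(2)[OF g] assms(2)[of "inv\<^bsub>G\<^esub> g"] g
    by (auto simp: units_of_carrier Units_def ring_mat_simps intro!: bexI[of _ "\<rho> (inv\<^bsub>G\<^esub> g)"])
qed (use assms(3) in \<open>simp add: units_of_mult ring_mat_simps\<close>)

lemma subspace_vec_iff: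
  "VectorSpace.subspace class_ring W (module_vec TYPE(complex) n) \<longleftrightarrow>
    W \<subseteq> carrier_vec n \<and> 0\<^sub>v n \<in> W \<and> (\<forall>v\<in>W. \<forall>w\<in>W. v + w \<in> W) \<and> (\<forall>c. \<forall>v\<in>W. c \<cdot>\<^sub>v v \<in> W)"
  unfolding VectorSpace.subspace_def submodule_def
  using vec_vs[of n] vec_module[of n, where 'a = complex]
  by (auto simp: module_vec_simps)

lemma irreducible_representationD:
  assumes "irreducible_representation G n \<rho>"
  shows "representation G n \<rho>" "n > 0"
    "\<lbrakk>W \<subseteq> carrier_vec n; 0\<^sub>v n \<in> W; \<And>v w. v \<in> W \<Longrightarrow> w \<in> W \<Longrightarrow> v + w \<in> W;
      \<And>c v. v \<in> W \<Longrightarrow> c \<cdot>\<^sub>v v \<in> W; \<And>g w. g \<in> carrier G \<Longrightarrow> w \<in> W \<Longrightarrow> \<rho> g *\<^sub>v w \<in> W\<rbrakk>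
      \<Longrightarrow> W = {0\<^sub>v n} \<or> W = carrier_vec n"
proof -
  show "representation G n \<rho>" "n > 0"
    using assms by (simp_all add: irreducible_representation_def)
  assume "W \<subseteq> carrier_vec n" "0\<^sub>v n \<in> W" "\<And>v w. v \<in> W \<Longrightarrow> w \<in> W \<Longrightarrow> v + w \<in> W"
    "\<And>c v. v \<in> W \<Longrightarrow> c \<cdot>\<^sub>v v \<in> W" "\<And>g w. g \<in> carrier G \<Longrightarrow> w \<in> W \<Longrightarrow> \<rho> g *\<^sub>v w \<in> W"
  then have "VectorSpace.subspace class_ring W (module_vec TYPE(complex) n) \<and>
      (\<forall>g \<in> carrier G. \<forall>w \<in> W. \<rho> g *\<^sub>v w \<in> W)"
    by (simp add: subspace_vec_iff)
  then show "W = {0\<^sub>v n} \<or> W = carrier_vec n"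
    using assms by (simp add: irreducible_representation_def)
qed

lemma exists_eigenvector:
  fixes M :: "complex mat"
  assumes M: "M \<in> carrier_mat n n" and n: "n > 0"
  shows "\<exists>c v. v \<in> carrier_vec n \<and> v \<noteq> 0\<^sub>v n \<and> M *\<^sub>v v = c \<cdot>\<^sub>v v"
proof -
  have "degree (char_poly M) = n" using degree_monic_char_poly[OF M] by simp
  then have "\<not> constant (poly (char_poly M))" using n by (simp add: constant_degree)
  then obtain c where "poly (char_poly M) c = 0" using fundamental_theorem_of_algebra by blast
  then have "eigenvalue M c" using eigenvalue_root_char_poly[OF M] by simp
  then show ?thesis using M unfolding eigenvalue_def eigenvector_def by auto
qed

text \<open>An eigenspace of M is nonzero and invariant under every rho g, so it is the whole
  space.\<close>

lemma schur:
  assumes G: "group G" and irr: "irreducible_representation G n \<rho>" and M: "M \<in> carrier_mat n n"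
    and comm: "\<And>g. g \<in> carrier G \<Longrightarrow> M * \<rho> g = \<rho> g * M"
  shows "\<exists>c. M = c \<cdot>\<^sub>m 1\<^sub>m n"
proof -
  note D = irreducible_representationD[OF irr]
  note R = representationD[OF G D(1)]
  obtain c v where v: "v \<in> carrier_vec n" "v \<noteq> 0\<^sub>v n" "M *\<^sub>v v = c \<cdot>\<^sub>v v"
    using exists_eigenvector[OF M D(2)] by blast
  let ?W = "{v \<in> carrier_vec n. M *\<^sub>v v = c \<cdot>\<^sub>v v}"
  have "?W = {0\<^sub>v n} \<or> ?W = carrier_vec n"
  proof (rule D(3))
    fix g w assume g: "g \<in> carrier G" and w: "w \<in> ?W"
    have "M *\<^sub>v (\<rho> g *\<^sub>v w) = (M * \<rho> g) *\<^sub>v w"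
      using M R(1)[OF g] w by (intro assoc_mult_mat_vec[symmetric]) auto
    also have "\<dots> = \<rho> g *\<^sub>v (M *\<^sub>v w)"
      unfolding comm[OF g] using M R(1)[OF g] w by (intro assoc_mult_mat_vec) auto
    also have "\<dots> = c \<cdot>\<^sub>v (\<rho> g *\<^sub>v w)" using w R(1)[OF g] by (simp add: mult_mat_vec)
    finally show "\<rho> g *\<^sub>v w \<in> ?W" using R(1)[OF g] w by auto
  next
    fix v w assume "v \<in> ?W" "w \<in> ?W"
    then show "v + w \<in> ?W" using M by (simp add: mult_add_distrib_mat_vec smult_add_distrib_vec[of _ n])
  next
    fix a v assume v: "v \<in> ?W"
    then have "M *\<^sub>v (a \<cdot>\<^sub>v v) = a \<cdot>\<^sub>v (c \<cdot>\<^sub>v v)" using M by (simp add: mult_mat_vec)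
    also have "\<dots> = c \<cdot>\<^sub>v (a \<cdot>\<^sub>v v)" by (simp add: smult_smult_assoc mult.commute)
    finally show "a \<cdot>\<^sub>v v \<in> ?W" using v by simp
  qed (use M in auto)
  then have W: "?W = carrier_vec n" using v by blast
  have "M = c \<cdot>\<^sub>m 1\<^sub>m n"
  proof (rule eq_matI)
    fix i j assume ij: "i < dim_row (c \<cdot>\<^sub>m 1\<^sub>m n)" "j < dim_col (c \<cdot>\<^sub>m 1\<^sub>m n)"
    have "unit_vec n j \<in> ?W" by (subst W) simp
    then have "M *\<^sub>v unit_vec n j = c \<cdot>\<^sub>v unit_vec n j" by simp
    then have "(M *\<^sub>v unit_vec n j) $ i = (c \<cdot>\<^sub>v unit_vec n j) $ i" by simp
    then show "M $$ (i, j) = (c \<cdot>\<^sub>m 1\<^sub>m n) $$ (i, j)" using ij M by auto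
  qed (use M in auto)
  then show ?thesis by blast
qed

lemma IrrE:
  assumes "\<chi> \<in> Irr G"
  obtains n \<rho> where "irreducible_representation G n \<rho>" "\<chi> = character_of G n \<rho>"
  using assms by (auto simp: Irr_def)

lemma IrrI: "irreducible_representation G n \<rho> \<Longrightarrow> character_of G n \<rho> \<in> Irr G"
  by (auto simp: Irr_def)

lemma Irr_extensional: "\<chi> \<in> Irr G \<Longrightarrow> \<chi> \<in> extensional (carrier G)"
  by (auto simp: Irr_def character_of_def)

lemma character_one:
  assumes "group G" "representation G n \<rho>"
  shows "character_of G n \<rho> \<one>\<^bsub>G\<^esub> = of_nat n"
  using representationD(3)[OF assms] group.is_monoid[OF assms(1)] by (simp add: character_of_def monoid.one_closed)

text \<open>Unlike membership in \<open>lin\<close>, this leaves the values outside the carrier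
  free, so that the eigenvalue function of a common eigenvector qualifies as it stands;
  \<open>lin_iff\<close> adds extensionality.\<close>

definition linear_character :: "('a, 'b) monoid_scheme \<Rightarrow> ('a \<Rightarrow> complex) \<Rightarrow> bool" where
  "linear_character G \<psi> \<longleftrightarrow> \<psi> \<one>\<^bsub>G\<^esub> = 1 \<and>
     (\<forall>g\<in>carrier G. \<forall>h\<in>carrier G. \<psi> (g \<otimes>\<^bsub>G\<^esub> h) = \<psi> g * \<psi> h)"

lemma linear_characterD:
  assumes "linear_character G \<psi>"
  shows "\<psi> \<one>\<^bsub>G\<^esub> = 1" "g \<in> carrier G \<Longrightarrow> h \<in> carrier G \<Longrightarrow> \<psi> (g \<otimes>\<^bsub>G\<^esub> h) = \<psi> g * \<psi> h"
  using assms by (auto simp: linear_character_def)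

lemma degree_one_character:
  assumes G: "group G" and rep: "representation G 1 \<rho>"
  shows "linear_character G (character_of G 1 \<rho>)"
  unfolding linear_character_def
proof (intro conjI ballI)
  show "character_of G 1 \<rho> \<one>\<^bsub>G\<^esub> = 1" using character_one[OF G rep] by simp
  interpret group G by fact
  note R = representationD[OF G rep]
  fix g h assume gh: "g \<in> carrier G" "h \<in> carrier G"
  then show "character_of G 1 \<rho> (g \<otimes>\<^bsub>G\<^esub> h) = character_of G 1 \<rho> g * character_of G 1 \<rho> h"
    using R(1)[of g] R(1)[of h] by (simp add: character_of_def R(2) scalar_prod_def times_mat_def)
qed

lemma lin_iff:
  assumes G: "group G"
  shows "\<chi> \<in> lin G \<longleftrightarrow> \<chi> \<in> extensional (carrier G) \<and> linear_character G \<chi>"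
proof
  assume "\<chi> \<in> lin G"
  then have \<chi>: "\<chi> \<in> Irr G" "\<chi> \<one>\<^bsub>G\<^esub> = 1" by (auto simp: lin_def)
  then obtain n \<rho> where \<rho>: "irreducible_representation G n \<rho>" "\<chi> = character_of G n \<rho>" by (auto elim: IrrE)
  then have "of_nat n = (1::complex)"
    using \<chi>(2) character_one[OF G irreducible_representationD(1)] by metis
  then have "n = 1" by simp
  then show "\<chi> \<in> extensional (carrier G) \<and> linear_character G \<chi>"
    using \<rho> degree_one_character[OF G] Irr_extensional[OF \<chi>(1)] irreducible_representationD(1) by blast
next
  assume \<chi>: "\<chi> \<in> extensional (carrier G) \<and> linear_character G \<chi>"
  interpret group G by fact
  define \<rho> where "\<rho> g = mat 1 1 (\<lambda>_. \<chi> g)" for g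
  have "representation G 1 \<rho>"
    using \<chi> by (intro representationI[OF G])
      (auto simp: \<rho>_def linear_character_def scalar_prod_def intro!: eq_matI)
  moreover have "W = {0\<^sub>v 1} \<or> W = carrier_vec 1"
    if W: "W \<subseteq> carrier_vec 1" "0\<^sub>v 1 \<in> W" "\<forall>c. \<forall>v\<in>W. c \<cdot>\<^sub>v v \<in> W" for W :: "complex vec set"
  proof (rule disjCI)
    assume "W \<noteq> carrier_vec 1"
    then obtain u where u: "u \<in> carrier_vec 1" "u \<notin> W" using W(1) by blast
    have "v = 0\<^sub>v 1" if v: "v \<in> W" for v
    proof (rule ccontr)
      assume "v \<noteq> 0\<^sub>v 1"
      then have v0: "v $ 0 \<noteq> 0" using v W(1) by (metis carrier_vecD eq_vecI index_zero_vec(1) index_zero_vec(2) less_one subsetD)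
      have "u = (u $ 0 / v $ 0) \<cdot>\<^sub>v v" using v0 u(1) v W(1) by (intro eq_vecI) auto
      then show False using W(3) v u(2) by metis
    qed
    then show "W = {0\<^sub>v 1}" using W(2) by blast
  qed
  ultimately have "irreducible_representation G 1 \<rho>"
    unfolding irreducible_representation_def subspace_vec_iff by blast
  moreover have "\<chi> = character_of G 1 \<rho>"
    using \<chi> by (auto simp: character_of_def \<rho>_def extensional_def)
  ultimately show "\<chi> \<in> lin G" using IrrI \<chi> by (fastforce simp: lin_def linear_character_def)
qed

text \<open>By Schur's lemma every rho g is scalar, so the hyperplane v_0 = 0 is invariant and must
  be zero. The hypothesis concerns the matrices because \<open>eigenvector_nontrivial\<close>
  applies it to a nonabelian group.\<close>

lemma irreducible_commuting_degree:
  assumes G: "group G" and irr: "irreducible_representation G n \<rho>"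
    and comm: "\<And>g h. g \<in> carrier G \<Longrightarrow> h \<in> carrier G \<Longrightarrow> \<rho> g * \<rho> h = \<rho> h * \<rho> g"
  shows "n = 1"
proof (rule ccontr)
  note D = irreducible_representationD[OF irr]
  note R = representationD[OF G D(1)]
  let ?W = "{v \<in> carrier_vec n. v $ 0 = (0::complex)}"
  have scalar: "\<exists>c. \<rho> g = c \<cdot>\<^sub>m 1\<^sub>m n" if g: "g \<in> carrier G" for g
    by (rule schur[OF G irr R(1)[OF g] comm[OF g]])
  have "?W = {0\<^sub>v n} \<or> ?W = carrier_vec n"
  proof (rule D(3))
    fix g w assume g: "g \<in> carrier G" and w: "w \<in> ?W"
    obtain c where "\<rho> g = c \<cdot>\<^sub>m 1\<^sub>m n" using scalar[OF g] by blast
    then have "\<rho> g *\<^sub>v w = c \<cdot>\<^sub>v w" using w by (auto intro!: eq_vecI)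
    then show "\<rho> g *\<^sub>v w \<in> ?W" using w D(2) by auto
  qed (use D(2) in auto)
  moreover have "unit_vec n 0 \<notin> ?W" using D(2) by simp
  ultimately have W: "?W = {0\<^sub>v n}" by (metis unit_vec_carrier)
  assume "n \<noteq> 1"
  then have n: "1 < n" using D(2) by simp
  then have "unit_vec n 1 \<in> ?W" by simp
  then have "unit_vec n 1 $ 1 = (0\<^sub>v n $ 1 :: complex)" using W by (metis singletonD)
  then show False using n by simp
qed

lemma Irr_commutative:
  assumes G: "group G" and comm: "\<And>g h. g \<in> carrier G \<Longrightarrow> h \<in> carrier G \<Longrightarrow> g \<otimes>\<^bsub>G\<^esub> h = h \<otimes>\<^bsub>G\<^esub> g"
    and \<chi>: "\<chi> \<in> Irr G"
  shows "\<chi> \<in> lin G"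
proof -
  obtain n \<rho> where \<rho>: "irreducible_representation G n \<rho>" "\<chi> = character_of G n \<rho>" using \<chi> by (rule IrrE)
  note D = irreducible_representationD[OF \<rho>(1)]
  note R = representationD[OF G D(1)]
  have "n = 1" by (rule irreducible_commuting_degree[OF G \<rho>(1)]) (metis R(2) comm)
  then show ?thesis using \<chi> \<rho>(2) character_one[OF G D(1)] by (simp add: lin_def)
qed

text \<open>The equivalence serves in both directions: to inflate a representation of Q, and to let
  a representation of G descend when it factors through the projection.\<close>

lemma irreducible_representation_pullback:
  assumes G: "group G" and Q: "group Q" and \<pi>: "\<pi> \<in> hom G Q" and onto: "\<pi> ` carrier G = carrier Q"
    and eq: "\<And>g. g \<in> carrier G \<Longrightarrow> \<rho> g = \<rho>' (\<pi> g)"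
  shows "irreducible_representation G n \<rho> \<longleftrightarrow> irreducible_representation Q n \<rho>'"
proof -
  interpret G: group G by fact
  interpret Q: group Q by fact
  have \<pi>1: "\<pi> \<one>\<^bsub>G\<^esub> = \<one>\<^bsub>Q\<^esub>" using \<pi> G Q by (rule hom_one)
  have "representation G n \<rho> \<longleftrightarrow> representation Q n \<rho>'"
  proof
    assume r: "representation G n \<rho>"
    note R = representationD[OF G r]
    show "representation Q n \<rho>'"
    proof (rule representationI[OF Q])
      fix x y assume "x \<in> carrier Q" "y \<in> carrier Q"
      then obtain g h where gh: "g \<in> carrier G" "h \<in> carrier G" "x = \<pi> g" "y = \<pi> h" using onto by blast
      have "\<rho>' (\<pi> (g \<otimes>\<^bsub>G\<^esub> h)) = \<rho>' (\<pi> g) * \<rho>' (\<pi> h)"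
        using R(2)[OF gh(1,2)] gh by (simp flip: eq)
      then show "\<rho>' (x \<otimes>\<^bsub>Q\<^esub> y) = \<rho>' x * \<rho>' y" using gh hom_mult[OF \<pi> gh(1,2)] by simp
    next
      fix x assume "x \<in> carrier Q"
      then obtain g where "g \<in> carrier G" "x = \<pi> g" using onto by blast
      then show "\<rho>' x \<in> carrier_mat n n" using R(1)[of g] eq[of g] by simp
    next
      show "\<rho>' \<one>\<^bsub>Q\<^esub> = 1\<^sub>m n" using R(3) eq[OF G.one_closed] \<pi>1 by simp
    qed
  next
    assume r: "representation Q n \<rho>'"
    note R = representationD[OF Q r]
    show "representation G n \<rho>"
      by (rule representationI[OF G]) (use R eq \<pi>1 hom_in_carrier[OF \<pi>] hom_mult[OF \<pi>] in auto)
  qed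
  moreover have "(\<forall>g\<in>carrier G. \<forall>w\<in>W. \<rho> g *\<^sub>v w \<in> W) \<longleftrightarrow> (\<forall>g\<in>carrier Q. \<forall>w\<in>W. \<rho>' g *\<^sub>v w \<in> W)" for W
    using eq onto by (metis (no_types, lifting) image_iff)
  ultimately show ?thesis unfolding irreducible_representation_def by simp
qed

lemma character_of_pullback:
  assumes "\<pi> \<in> hom G Q" and "\<And>g. g \<in> carrier G \<Longrightarrow> \<rho> g = \<rho>' (\<pi> g)"
  shows "character_of G n \<rho> = (\<lambda>g\<in>carrier G. character_of Q n \<rho>' (\<pi> g))"
  using assms hom_in_carrier[OF assms(1)] by (auto simp: character_of_def restrict_def)

lemma Irr_pullback:
  assumes G: "group G" and Q: "group Q" and \<pi>: "\<pi> \<in> hom G Q" and onto: "\<pi> ` carrier G = carrier Q"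
    and \<chi>: "\<chi> \<in> Irr Q"
  shows "(\<lambda>g\<in>carrier G. \<chi> (\<pi> g)) \<in> Irr G"
proof -
  obtain n \<rho> where \<rho>: "irreducible_representation Q n \<rho>" "\<chi> = character_of Q n \<rho>" using \<chi> by (rule IrrE)
  have "irreducible_representation G n (\<rho> \<circ> \<pi>)"
    using irreducible_representation_pullback[OF G Q \<pi> onto, of "\<rho> \<circ> \<pi>" \<rho>] \<rho>(1) by simp
  then show ?thesis using character_of_pullback[OF \<pi>, of "\<rho> \<circ> \<pi>" \<rho> n] \<rho>(2) IrrI by fastforce
qed

lemma centralizer_iff: "g \<in> centralizer G S \<longleftrightarrow> g \<in> carrier G \<and> (\<forall>s\<in>S. g \<otimes>\<^bsub>G\<^esub> s = s \<otimes>\<^bsub>G\<^esub> g)"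
  by (simp add: centralizer_def)

lemma central_scalar:
  assumes G: "group G" and irr: "irreducible_representation G n \<rho>" and z: "z \<in> center G"
  shows "\<exists>c. \<rho> z = c \<cdot>\<^sub>m 1\<^sub>m n"
proof -
  note D = irreducible_representationD[OF irr]
  note R = representationD[OF G D(1)]
  show ?thesis
    by (rule schur[OF G irr]) (use z R in \<open>auto simp: centralizer_iff simp flip: R(2)\<close>)
qed

text \<open>A central z acts as a scalar c, so its character value is cn, which equals n exactly
  when c = 1. This turns \<open>ker_char\<close>, defined by values, into the kernel of the
  representation.\<close>

lemma central_in_ker_iff:
  assumes G: "group G" and irr: "irreducible_representation G n \<rho>" and z: "z \<in> center G"
  shows "z \<in> ker_char G (character_of G n \<rho>) \<longleftrightarrow> \<rho> z = 1\<^sub>m n"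
proof -
  note D = irreducible_representationD[OF irr]
  obtain c where c: "\<rho> z = c \<cdot>\<^sub>m 1\<^sub>m n" using central_scalar[OF assms] by blast
  have "character_of G n \<rho> z = c * of_nat n"
    using z c by (simp add: character_of_def centralizer_iff)
  then have "z \<in> ker_char G (character_of G n \<rho>) \<longleftrightarrow> c = 1"
    using D(2) z character_one[OF G D(1)] by (auto simp: ker_char_def centralizer_iff)
  also have "\<dots> \<longleftrightarrow> \<rho> z = 1\<^sub>m n"
  proof
    assume "\<rho> z = 1\<^sub>m n"
    then have "(c \<cdot>\<^sub>m 1\<^sub>m n) $$ (0, 0) = 1\<^sub>m n $$ (0, 0)" using c by simp
    then show "c = 1" using D(2) by simp
  qed (use c in \<open>auto intro!: eq_matI\<close>)
  finally show ?thesis .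
qed

subsection \<open>Inflation from quotient groups\<close>

lemma lift_char_Irr:
  fixes G (structure)
  assumes "K \<lhd> G" "\<chi> \<in> Irr (G Mod K)"
  shows "lift_char G K \<chi> \<in> Irr G"
proof -
  interpret normal K G by fact
  show ?thesis unfolding lift_char_def
    by (rule Irr_pullback[OF group_axioms factorgroup_is_group r_coset_hom_Mod _ assms(2)])
      (simp add: carrier_FactGroup)
qed

lemma lift_char_ker:
  fixes G (structure)
  assumes "K \<lhd> G"
  shows "K \<subseteq> ker_char G (lift_char G K \<chi>)"
proof -
  interpret normal K G by fact
  show ?thesis using subset by (auto simp: ker_char_def lift_char_def rcos_const)
qed

lemma lift_char_one:
  fixes G (structure)
  assumes "K \<lhd> G"
  shows "lift_char G K \<chi> \<one>\<^bsub>G\<^esub> = \<chi> \<one>\<^bsub>G Mod K\<^esub>"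
proof -
  interpret normal K G by fact
  show ?thesis using subset by (simp add: lift_char_def)
qed

lemma inj_on_lift_char: "inj_on (lift_char G K) (Irr (G Mod K))"
proof (rule inj_onI)
  fix \<chi> \<chi>' assume \<chi>: "\<chi> \<in> Irr (G Mod K)" "\<chi>' \<in> Irr (G Mod K)" and eq: "lift_char G K \<chi> = lift_char G K \<chi>'"
  show "\<chi> = \<chi>'"
  proof (rule extensionalityI[OF Irr_extensional[OF \<chi>(1)] Irr_extensional[OF \<chi>(2)]])
    fix S assume "S \<in> carrier (G Mod K)"
    then obtain g where g: "g \<in> carrier G" "S = K #>\<^bsub>G\<^esub> g" by (auto simp: carrier_FactGroup)
    then show "\<chi> S = \<chi>' S" using fun_cong[OF eq, of g] by (simp add: lift_char_def)
  qed
qed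

text \<open>Centrality of K makes \<open>central_in_ker_iff\<close> available: K acts trivially, so
  the representation descends to cosets.\<close>

lemma lift_char_surj:
  fixes G (structure)
  assumes K: "K \<lhd> G" "K \<subseteq> center G" and \<chi>: "\<chi> \<in> Irr G" "K \<subseteq> ker_char G \<chi>"
  shows "\<exists>\<chi>'\<in>Irr (G Mod K). \<chi> = lift_char G K \<chi>'"
proof -
  interpret normal K G by fact
  obtain n \<rho> where \<rho>: "irreducible_representation G n \<rho>" "\<chi> = character_of G n \<rho>" using \<chi>(1) by (rule IrrE)
  note R = representationD[OF group_axioms irreducible_representationD(1)[OF \<rho>(1)]]
  \<comment> \<open>The choice of the representative is harmless, because elements of K act as the
    identity; \<open>eq\<close> verifies this.\<close>
  define \<rho>' where "\<rho>' S = \<rho> (SOME g. g \<in> S)" for S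
  have eq: "\<rho> g = \<rho>' (K #> g)" if g: "g \<in> carrier G" for g
  proof -
    let ?h = "SOME h. h \<in> K #> g"
    have "?h \<in> K #> g" by (rule someI[of _ g]) (use g rcos_self[OF g] subgroup_axioms in auto)
    then obtain k where k: "k \<in> K" "?h = k \<otimes> g" by (auto simp: r_coset_def)
    have "\<rho> k = 1\<^sub>m n" using central_in_ker_iff[OF group_axioms \<rho>(1)] K(2) \<chi>(2) k(1) \<rho>(2) by blast
    then show ?thesis using k g R(1)[OF g] R(2)[of k g] by (simp add: \<rho>'_def)
  qed
  have "irreducible_representation (G Mod K) n \<rho>'"
    using irreducible_representation_pullback[OF group_axioms factorgroup_is_group r_coset_hom_Mod, of \<rho> \<rho>' n] \<rho>(1) eq
    by (simp add: carrier_FactGroup)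
  moreover have "\<chi> = lift_char G K (character_of (G Mod K) n \<rho>')"
    using character_of_pullback[OF r_coset_hom_Mod, of \<rho> \<rho>' n] eq \<rho>(2) by (simp add: lift_char_def)
  ultimately show ?thesis using IrrI by blast
qed

lemma bij_betw_lift_char:
  assumes K: "K \<lhd> G" "K \<subseteq> center G"
  shows "bij_betw (lift_char G K) (nl (G Mod K)) {\<chi> \<in> nl G. K \<subseteq> ker_char G \<chi>}"
  unfolding bij_betw_def
proof
  show "inj_on (lift_char G K) (nl (G Mod K))"
    using inj_on_lift_char by (rule inj_on_subset) (auto simp: nl_def)
  show "lift_char G K ` nl (G Mod K) = {\<chi> \<in> nl G. K \<subseteq> ker_char G \<chi>}"
  proof (intro subset_antisym subsetI)
    fix \<chi> assume "\<chi> \<in> {\<chi> \<in> nl G. K \<subseteq> ker_char G \<chi>}"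
    then have \<chi>: "\<chi> \<in> Irr G" "\<chi> \<one>\<^bsub>G\<^esub> \<noteq> 1" "K \<subseteq> ker_char G \<chi>" by (auto simp: nl_def)
    obtain \<chi>' where \<chi>': "\<chi>' \<in> Irr (G Mod K)" "\<chi> = lift_char G K \<chi>'"
      using lift_char_surj[OF K \<chi>(1,3)] by blast
    then show "\<chi> \<in> lift_char G K ` nl (G Mod K)"
      using \<chi>(2) lift_char_one[OF K(1)] by (auto simp: nl_def)
  qed (use lift_char_Irr[OF K(1)] lift_char_one[OF K(1)] lift_char_ker[OF K(1)] in \<open>auto simp: nl_def\<close>)
qed

lemma sum_over_cosets:
  fixes G (structure) and f :: "'a set \<Rightarrow> complex"
  assumes K: "K \<lhd> G" and fin: "finite (carrier G)" and H: "subgroup H G" "K \<subseteq> H"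
  shows "(\<Sum>x\<in>H. f (K #>\<^bsub>G\<^esub> x)) = of_nat (card K) * (\<Sum>S\<in>quotient_set G K H. f S)"
proof -
  interpret normal K G by fact
  interpret H: subgroup H G by fact
  have finH: "finite H" using fin H.subset finite_subset by blast
  have cos: "{x \<in> H. K #> x = K #> h} = K #> h" if h: "h \<in> H" for h
  proof (intro subset_antisym subsetI)
    fix x assume x: "x \<in> {x \<in> H. K #> x = K #> h}"
    then have "x \<in> K #> x" using rcos_self[of x] subgroup_axioms H.subset by auto
    then show "x \<in> K #> h" using x by simp
  next
    fix x assume x: "x \<in> K #> h"
    then have "x \<in> H" using H h by (auto simp: r_coset_def)
    moreover have "K #> h = K #> x" using repr_independence[OF x _ subgroup_axioms] h H.subset by auto
    ultimately show "x \<in> {x \<in> H. K #> x = K #> h}" by simp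
  qed
  have "(\<Sum>x\<in>H. f (K #> x)) = (\<Sum>S\<in>quotient_set G K H. \<Sum>x\<in>{x \<in> H. K #> x = S}. f (K #> x))"
    by (rule sum.group[symmetric]) (use finH in \<open>auto simp: quotient_set_def\<close>)
  also have "\<dots> = (\<Sum>S\<in>quotient_set G K H. of_nat (card K) * f S)"
  proof (rule sum.cong[OF refl])
    fix S assume "S \<in> quotient_set G K H"
    then obtain h where h: "h \<in> H" "S = K #> h" by (auto simp: quotient_set_def)
    have "card (K #> h) = card K"
      using card_rcosets_equal[OF rcosetsI[of K h]] subset h(1) H.subset by auto
    moreover have "f (K #> x) = f (K #> h)" if "x \<in> K #> h" for x
    proof -
      have "K #> x = K #> h" using that cos[OF h(1)] by blast
      then show ?thesis by simp
    qed
    ultimately show "(\<Sum>x\<in>{x \<in> H. K #> x = S}. f (K #> x)) = of_nat (card K) * f S"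
      unfolding h(2) cos[OF h(1)]
      by simp
  qed
  finally show ?thesis by (simp add: sum_distrib_left)
qed

lemma coset_in_quotient_set_iff:
  fixes G (structure)
  assumes "K \<lhd> G" "subgroup H G" "K \<subseteq> H" "x \<in> carrier G"
  shows "K #>\<^bsub>G\<^esub> x \<in> quotient_set G K H \<longleftrightarrow> x \<in> H"
proof
  interpret normal K G by fact
  interpret H: subgroup H G by fact
  assume "K #>\<^bsub>G\<^esub> x \<in> quotient_set G K H"
  then obtain h where h: "h \<in> H" "K #> x = K #> h" by (auto simp: quotient_set_def)
  have "x \<in> K #> h" using rcos_self[OF assms(4) subgroup_axioms] h by simp
  then show "x \<in> H" using assms(3) h by (auto simp: r_coset_def)
qed (simp add: quotient_set_def)

text \<open>Induction commutes with inflation: the sum over G and the order of H both acquire the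
  factor |K|, which cancels. A character and its lift take the same set of values, so the fields do
  not change.\<close>

lemma required_pair_lift:
  fixes G (structure)
  assumes K: "K \<lhd> G" and fin: "finite (carrier G)" and H: "subgroup H G" "K \<subseteq> H"
    and req: "required_pair (G Mod K) \<chi> (quotient_set G K H) \<psi>"
  shows "required_pair G (lift_char G K \<chi>) H (lift_char (subgroup_monoid G H) K \<psi>)"
proof -
  interpret normal K G by fact
  interpret H: subgroup H G by fact
  let ?Q = "G Mod K" and ?L = "quotient_set G K H"
  let ?\<psi> = "lift_char (subgroup_monoid G H) K \<psi>"
  interpret Q: group ?Q by (rule factorgroup_is_group)
  have cK: "card K \<noteq> 0"
    using finite_subset[OF subset fin] subgroup.one_closed[OF subgroup_axioms] by (metis card_0_eq empty_iff)
  have L: "subgroup ?L ?Q" and \<psi>: "\<psi> \<in> lin (subgroup_monoid ?Q ?L)"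
    and ind: "induced_char ?Q ?L \<psi> = \<chi>"
    and fld: "char_field (subgroup_monoid ?Q ?L) \<psi> = char_field ?Q \<chi>"
    using req by (auto simp: required_pair_def)
  have lc: "linear_character (subgroup_monoid ?Q ?L) \<psi>"
    using \<psi> lin_iff[OF Q.subgroup_imp_group[OF L]] by blast
  have val: "?\<psi> h = \<psi> (K #> h)" if "h \<in> H" for h using that by (simp add: lift_char_def)
  have "linear_character (subgroup_monoid G H) ?\<psi>"
    unfolding linear_character_def
  proof (intro conjI ballI)
    show "?\<psi> \<one>\<^bsub>subgroup_monoid G H\<^esub> = 1"
      using linear_characterD(1)[OF lc] val[OF H.one_closed] subset by simp
    fix g h assume "g \<in> carrier (subgroup_monoid G H)" "h \<in> carrier (subgroup_monoid G H)"
    then have gh: "g \<in> H" "h \<in> H" by auto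
    have "\<psi> (K #> (g \<otimes> h)) = \<psi> ((K #> g) <#> (K #> h))" using gh H.subset by (simp add: rcos_sum subsetD)
    also have "\<dots> = \<psi> (K #> g) * \<psi> (K #> h)"
      using linear_characterD(2)[OF lc, of "K #> g" "K #> h"] gh by (simp add: quotient_set_def)
    finally show "?\<psi> (g \<otimes>\<^bsub>subgroup_monoid G H\<^esub> h) = ?\<psi> g * ?\<psi> h" using gh val by simp
  qed
  then have 1: "?\<psi> \<in> lin (subgroup_monoid G H)"
    using lin_iff[OF subgroup_imp_group[OF H(1)]] by (simp add: lift_char_def)
  have 2: "induced_char G H ?\<psi> = lift_char G K \<chi>"
  proof
    fix g
    show "induced_char G H ?\<psi> g = lift_char G K \<chi> g"
    proof (cases "g \<in> carrier G")
      case True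
      define f where "f S = (if inv\<^bsub>?Q\<^esub> S \<otimes>\<^bsub>?Q\<^esub> (K #> g) \<otimes>\<^bsub>?Q\<^esub> S \<in> ?L
        then \<psi> (inv\<^bsub>?Q\<^esub> S \<otimes>\<^bsub>?Q\<^esub> (K #> g) \<otimes>\<^bsub>?Q\<^esub> S) else 0)" for S
      have cos: "inv\<^bsub>?Q\<^esub> (K #> x) \<otimes>\<^bsub>?Q\<^esub> (K #> g) \<otimes>\<^bsub>?Q\<^esub> (K #> x) = K #> (inv x \<otimes> g \<otimes> x)"
        if "x \<in> carrier G" for x
        using that True by (simp add: inv_FactGroup carrier_FactGroup rcos_inv rcos_sum)
      have "(if inv x \<otimes> g \<otimes> x \<in> H then ?\<psi> (inv x \<otimes> g \<otimes> x) else 0) = f (K #> x)"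
        if x: "x \<in> carrier G" for x
        unfolding f_def cos[OF x] using coset_in_quotient_set_iff[OF K H] x True val by simp
      then have "induced_char G H ?\<psi> g = (\<Sum>x\<in>carrier G. f (K #> x)) / of_nat (card H)"
        using True by (simp add: induced_char_def)
      also have "(\<Sum>x\<in>carrier G. f (K #> x)) = of_nat (card K) * (\<Sum>S\<in>carrier ?Q. f S)"
        using sum_over_cosets[OF K fin subgroup_self subset] by (simp add: quotient_set_def carrier_FactGroup)
      also have "of_nat (card H) = of_nat (card K) * (of_nat (card ?L) :: complex)"
        using sum_over_cosets[OF K fin H, of "\<lambda>_. 1"] by simp
      also have "of_nat (card K) * (\<Sum>S\<in>carrier ?Q. f S) / (of_nat (card K) * of_nat (card ?L))
          = (\<Sum>S\<in>carrier ?Q. f S) / of_nat (card ?L)"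
        using cK by simp
      also have "\<dots> = \<chi> (K #> g)"
        using True by (simp add: ind[symmetric] induced_char_def f_def carrier_FactGroup)
      finally show ?thesis using True by (simp add: lift_char_def[of G])
    qed (simp add: induced_char_def lift_char_def)
  qed
  have "?\<psi> ` H = \<psi> ` ?L" using val by (auto simp: quotient_set_def image_image)
  moreover have "lift_char G K \<chi> ` carrier G = \<chi> ` carrier ?Q"
    by (auto simp: lift_char_def carrier_FactGroup image_image)
  ultimately have "char_field (subgroup_monoid G H) ?\<psi> = char_field G (lift_char G K \<chi>)"
    using fld by (simp add: char_field_def)
  then show ?thesis using 1 2 H(1) by (simp add: required_pair_def)
qed

subsection \<open>Fields of values of induced characters\<close>

lemma value_mem_char_field: "g \<in> carrier G \<Longrightarrow> \<chi> g \<in> char_field G \<chi>"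
  using rat_adjoin_superset[of "\<chi> ` carrier G"] by (auto simp: char_field_def)

lemma linear_character_subgroup:
  fixes G (structure)
  assumes G: "group G" and A: "subgroup A G" and \<psi>: "linear_character (subgroup_monoid G A) \<psi>"
  shows "\<psi> \<one>\<^bsub>G\<^esub> = 1" "a \<in> A \<Longrightarrow> b \<in> A \<Longrightarrow> \<psi> (a \<otimes>\<^bsub>G\<^esub> b) = \<psi> a * \<psi> b"
    "a \<in> A \<Longrightarrow> \<psi> a * \<psi> (inv\<^bsub>G\<^esub> a) = 1" "a \<in> A \<Longrightarrow> \<psi> a \<noteq> 0" "a \<in> A \<Longrightarrow> \<psi> (a [^]\<^bsub>G\<^esub> n) = \<psi> a ^ n"
proof -
  interpret group G by fact
  interpret A: subgroup A G by fact
  show 1: "\<psi> \<one>\<^bsub>G\<^esub> = 1" using \<psi> by (simp add: linear_character_def)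
  show mult: "\<psi> (a \<otimes>\<^bsub>G\<^esub> b) = \<psi> a * \<psi> b" if "a \<in> A" "b \<in> A" for a b
    using \<psi> that by (simp add: linear_character_def)
  show inv: "\<psi> a * \<psi> (inv\<^bsub>G\<^esub> a) = 1" if "a \<in> A"
    using that 1 mult[of a "inv a"] by simp
  then show "\<psi> a \<noteq> 0" if "a \<in> A" using that by auto
  show "\<psi> (a [^]\<^bsub>G\<^esub> n) = \<psi> a ^ n" if a: "a \<in> A"
  proof (induction n)
    case (Suc n)
    have "a [^] n \<in> A" using a by (induction n) auto
    then show ?case using Suc a by (simp add: mult)
  qed (simp add: 1)
qed

lemma induced_char_normal:
  fixes G (structure)
  assumes A: "A \<lhd> G" and g: "g \<in> carrier G"
  shows "g \<in> A \<Longrightarrow> induced_char G A \<psi> g = (\<Sum>x\<in>carrier G. \<psi> (inv\<^bsub>G\<^esub> x \<otimes>\<^bsub>G\<^esub> g \<otimes>\<^bsub>G\<^esub> x)) / of_nat (card A)"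
    and "g \<notin> A \<Longrightarrow> induced_char G A \<psi> g = 0"
proof -
  interpret normal A G by fact
  have conj: "inv x \<otimes> g \<otimes> x \<in> A \<longleftrightarrow> g \<in> A" if x: "x \<in> carrier G" for x
  proof
    assume "inv x \<otimes> g \<otimes> x \<in> A"
    then have "x \<otimes> (inv x \<otimes> g \<otimes> x) \<otimes> inv x \<in> A" using inv_op_closed2[OF x] by blast
    then show "g \<in> A" using x g by (simp add: m_assoc inv_solve_left) (simp flip: m_assoc)
  qed (use inv_op_closed1[OF x] in blast)
  show "g \<in> A \<Longrightarrow> induced_char G A \<psi> g = (\<Sum>x\<in>carrier G. \<psi> (inv x \<otimes> g \<otimes> x)) / of_nat (card A)"
    and "g \<notin> A \<Longrightarrow> induced_char G A \<psi> g = 0"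
    using g conj by (auto simp: induced_char_def)
qed

text \<open>Conjugation preserves A, so the induced character takes values that are rational
  combinations of values of psi. The factor c admits characters known only up to a rational
  multiple, as they come from \<open>character_of_eigenvector\<close>.\<close>

lemma char_field_induced_le:
  fixes G (structure)
  assumes A: "A \<lhd> G" and F: "csubfield F" "\<And>a. a \<in> A \<Longrightarrow> \<psi> a \<in> F"
    and c: "c \<in> F" and \<chi>: "\<And>g. g \<in> carrier G \<Longrightarrow> \<chi> g = c * induced_char G A \<psi> g"
  shows "char_field G \<chi> \<subseteq> F"
  unfolding char_field_def
proof (rule rat_adjoin_least[OF F(1)], rule image_subsetI)
  interpret normal A G by fact
  fix g assume g: "g \<in> carrier G"
  have "induced_char G A \<psi> g \<in> F"
    using induced_char_normal[OF A g, of \<psi>] inv_op_closed1 g F csubfield_zero[OF F(1)]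
    by (cases "g \<in> A") (auto intro!: csubfield_divide csubfield_sum csubfield_of_nat)
  then show "\<chi> g \<in> F" using c \<chi>[OF g] by (simp add: csubfieldD[OF F(1)])
qed

text \<open>Where psi is constant on a conjugacy class, the induced character is a nonzero rational
  multiple of psi, and one can divide. Rationality of c is expressed by its membership in every
  subfield.\<close>

lemma invariant_value_in_char_field:
  fixes G (structure)
  assumes A: "A \<lhd> G" and fin: "finite (carrier G)" and c: "c \<noteq> 0" "\<And>F. csubfield F \<Longrightarrow> c \<in> F"
    and \<chi>: "\<And>g. g \<in> carrier G \<Longrightarrow> \<chi> g = c * induced_char G A \<psi> g"
    and u: "u \<in> A" "\<And>x. x \<in> carrier G \<Longrightarrow> \<psi> (inv\<^bsub>G\<^esub> x \<otimes>\<^bsub>G\<^esub> u \<otimes>\<^bsub>G\<^esub> x) = \<psi> u"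
  shows "\<psi> u \<in> char_field G \<chi>"
proof -
  interpret normal A G by fact
  let ?F = "char_field G \<chi>"
  have F: "csubfield ?F" by (simp add: char_field_def csubfield_rat_adjoin)
  have uG: "u \<in> carrier G" using u(1) subset by blast
  let ?k = "c * of_nat (card (carrier G)) / of_nat (card A)"
  have "\<chi> u = ?k * \<psi> u"
    using \<chi>[OF uG] induced_char_normal(1)[OF A uG u(1), of \<psi>] u(2) by simp
  moreover have "card A \<noteq> 0" "card (carrier G) \<noteq> 0"
    using fin finite_subset[OF subset fin] subgroup.one_closed[OF subgroup_axioms] subset by (metis card_0_eq empty_iff subsetD)+
  then have "?k \<noteq> 0" using c by simp
  ultimately have "\<psi> u = \<chi> u / ?k" by simp
  moreover have "?k \<in> ?F" by (intro csubfield_divide[OF F] csubfieldD(5)[OF F] csubfield_of_nat[OF F] c F)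
  moreover have "\<chi> u \<in> ?F" using uG by (rule value_mem_char_field)
  ultimately show ?thesis by (metis csubfield_divide[OF F])
qed

(* Summing \<chi>(ab) \<psi>(b)^-1 over b in B isolates the conjugate \<psi> of \<chi>|A, by orthogonality on B. *)
lemma value_in_char_field:
  fixes G (structure)
  assumes A: "A \<lhd> G" and fin: "finite (carrier G)" and c: "c \<noteq> 0" "\<And>F. csubfield F \<Longrightarrow> c \<in> F"
    and \<chi>: "\<And>g. g \<in> carrier G \<Longrightarrow> \<chi> g = c * induced_char G A \<psi> g"
    and \<psi>: "linear_character (subgroup_monoid G A) \<psi>"
    and B: "subgroup B G" "B \<subseteq> A" "\<And>b. b \<in> B \<Longrightarrow> \<psi> b \<in> char_field G \<chi>"
    and sep: "\<And>x. x \<in> carrier G \<Longrightarrow> x \<notin> A \<Longrightarrow> \<exists>b\<in>B. \<psi> (inv\<^bsub>G\<^esub> x \<otimes>\<^bsub>G\<^esub> b \<otimes>\<^bsub>G\<^esub> x) \<noteq> \<psi> b"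
    and comm: "\<And>a b. a \<in> A \<Longrightarrow> b \<in> A \<Longrightarrow> a \<otimes>\<^bsub>G\<^esub> b = b \<otimes>\<^bsub>G\<^esub> a"
    and a: "a \<in> A"
  shows "\<psi> a \<in> char_field G \<chi>"
proof -
  interpret normal A G by fact
  interpret B: subgroup B G by fact
  let ?F = "char_field G \<chi>"
  have F: "csubfield ?F" by (simp add: char_field_def csubfield_rat_adjoin)
  note L = linear_character_subgroup[OF group_axioms subgroup_axioms \<psi>]
  have fins: "finite A" "finite B" using fin subset B.subset finite_subset by blast+
  have AG: "x \<in> carrier G" if "x \<in> A" for x using that subset by blast
  have BA: "x \<in> A" if "x \<in> B" for x using that B(2) by blast
  let ?cj = "\<lambda>x b. inv x \<otimes> b \<otimes> x"
  have cjA: "?cj x b \<in> A" if "x \<in> carrier G" "b \<in> A" for x b using inv_op_closed1 that by blast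
  have cjm: "?cj x (b \<otimes> b') = ?cj x b \<otimes> ?cj x b'" if "x \<in> carrier G" "b \<in> A" "b' \<in> A" for x b b'
    using that AG by (simp add: m_assoc inv_solve_left) (simp flip: m_assoc)
  \<comment> \<open>Up to normalisation, the inner product over B of psi with its conjugate by x: it
    is |B| for x in A, and 0 otherwise, because a conjugate by an element outside A differs from psi
    on B.\<close>
  define S where "S x = (\<Sum>b\<in>B. \<psi> (?cj x b) * \<psi> (inv b))" for x
  have S_in: "S x = of_nat (card B)" if x: "x \<in> A" for x
  proof -
    have "?cj x b = b" if "b \<in> B" for b
      using comm[OF BA[OF that] x] x AG BA[OF that] by (simp add: m_assoc) (simp flip: m_assoc)
    then show ?thesis unfolding S_def using L(3) BA by simp
  qed
  have S_out: "S x = 0" if x: "x \<in> carrier G" "x \<notin> A" for x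
  proof -
    obtain b where b: "b \<in> B" "\<psi> (?cj x b) \<noteq> \<psi> b" using sep[OF x] by blast
    \<comment> \<open>Translating the summation index by b leaves the sum unchanged but multiplies
      it by a factor different from 1.\<close>
    have "\<psi> (?cj x b) * \<psi> (inv b) * S x
        = (\<Sum>d\<in>B. \<psi> (?cj x (b \<otimes> d)) * \<psi> (inv (b \<otimes> d)))"
      unfolding S_def sum_distrib_left
    proof (rule sum.cong[OF refl])
      fix d assume d: "d \<in> B"
      have "inv (b \<otimes> d) = inv b \<otimes> inv d"
        using b(1) d AG BA comm by (metis inv_mult_group B.m_inv_closed)
      then show "\<psi> (?cj x b) * \<psi> (inv b) * (\<psi> (?cj x d) * \<psi> (inv d)) = \<psi> (?cj x (b \<otimes> d)) * \<psi> (inv (b \<otimes> d))"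
        using cjm[OF x(1)] cjA[OF x(1)] L(2) b(1) d BA by simp
    qed
    also have "\<dots> = S x" unfolding S_def
    proof (rule sum.reindex_bij_witness[of _ "\<lambda>d. inv b \<otimes> d" "\<lambda>d. b \<otimes> d"])
      fix d assume d: "d \<in> B"
      show "inv b \<otimes> (b \<otimes> d) = d" "b \<otimes> (inv b \<otimes> d) = d"
        using b(1) d AG BA by (simp_all flip: m_assoc)
    qed (use b(1) in auto)
    finally have "\<psi> (?cj x b) * \<psi> (inv b) = 1 \<or> S x = 0" by auto
    moreover have "\<psi> (?cj x b) * \<psi> (inv b) \<noteq> 1"
      using b L(3)[of b] L(4)[of "inv b"] BA by (metis B.m_inv_closed mult_right_cancel)
    ultimately show ?thesis by blast
  qed
  have "(\<Sum>b\<in>B. \<chi> (a \<otimes> b) * \<psi> (inv b)) =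
      (\<Sum>b\<in>B. c / of_nat (card A) * (\<Sum>x\<in>carrier G. \<psi> (?cj x a) * (\<psi> (?cj x b) * \<psi> (inv b))))"
  proof (rule sum.cong[OF refl])
    fix b assume b: "b \<in> B"
    have "\<chi> (a \<otimes> b) = c * ((\<Sum>x\<in>carrier G. \<psi> (?cj x (a \<otimes> b))) / of_nat (card A))"
      using \<chi>[of "a \<otimes> b"] induced_char_normal(1)[OF A, of "a \<otimes> b" \<psi>] a AG BA[OF b] by simp
    also have "(\<Sum>x\<in>carrier G. \<psi> (?cj x (a \<otimes> b))) = (\<Sum>x\<in>carrier G. \<psi> (?cj x a) * \<psi> (?cj x b))"
      using cjm L(2) cjA a BA[OF b] by simp
    finally show "\<chi> (a \<otimes> b) * \<psi> (inv b) = c / of_nat (card A) * (\<Sum>x\<in>carrier G. \<psi> (?cj x a) * (\<psi> (?cj x b) * \<psi> (inv b)))"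
      by (simp add: sum_distrib_left sum_distrib_right sum_divide_distrib mult.assoc)
  qed
  also have "\<dots> = c / of_nat (card A) * (\<Sum>x\<in>carrier G. \<psi> (?cj x a) * S x)"
    unfolding S_def sum_distrib_left by (rule sum.swap)
  also have "(\<Sum>x\<in>carrier G. \<psi> (?cj x a) * S x) = (\<Sum>x\<in>A. \<psi> (?cj x a) * S x)"
    using S_out fin subset by (intro sum.mono_neutral_right) auto
  also have "\<dots> = (\<Sum>x\<in>A. \<psi> a * of_nat (card B))"
  proof (rule sum.cong[OF refl])
    fix x assume x: "x \<in> A"
    have "?cj x a = a" using comm[OF a x] x a AG by (simp add: m_assoc) (simp flip: m_assoc)
    then show "\<psi> (?cj x a) * S x = \<psi> a * of_nat (card B)" using S_in[OF x] by simp
  qed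
  finally have eq: "(\<Sum>b\<in>B. \<chi> (a \<otimes> b) * \<psi> (inv b)) = c * of_nat (card B) * \<psi> a"
    using fins(1) a by auto
  have "card B \<noteq> 0" using fins(2) B.one_closed by (metis card_0_eq empty_iff)
  then have "c * of_nat (card B) \<noteq> 0" using c(1) by simp
  then have "\<psi> a = (\<Sum>b\<in>B. \<chi> (a \<otimes> b) * \<psi> (inv b)) / (c * of_nat (card B))" using eq by simp
  moreover have "(\<Sum>b\<in>B. \<chi> (a \<otimes> b) * \<psi> (inv b)) \<in> ?F"
  proof (intro csubfield_sum[OF F] csubfieldD(5)[OF F])
    fix b assume b: "b \<in> B"
    show "\<chi> (a \<otimes> b) \<in> ?F" using a b AG BA by (simp add: value_mem_char_field)
    show "\<psi> (inv b) \<in> ?F" using b B(3) by simp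
  qed
  moreover have "c * of_nat (card B) \<in> ?F" by (intro csubfieldD(5)[OF F] c F csubfield_of_nat)
  ultimately show ?thesis by (metis csubfield_divide[OF F])
qed

section \<open>Entrywise sums and traces of square matrices\<close>

definition mat_sum :: "nat \<Rightarrow> ('x \<Rightarrow> complex mat) \<Rightarrow> 'x set \<Rightarrow> complex mat" where
  "mat_sum n f S = mat n n (\<lambda>ij. \<Sum>x\<in>S. f x $$ ij)"

definition mat_trace :: "nat \<Rightarrow> complex mat \<Rightarrow> complex" where
  "mat_trace n M = (\<Sum>i<n. M $$ (i, i))"

lemma smult_smult_mat: "a \<cdot>\<^sub>m (b \<cdot>\<^sub>m M) = (a * b :: complex) \<cdot>\<^sub>m M"
  by (rule eq_matI) auto

lemma one_smult_mat: "1 \<cdot>\<^sub>m M = (M :: complex mat)"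
  by (rule eq_matI) auto

lemma smult_mat_mult_vec:
  "M \<in> carrier_mat n n \<Longrightarrow> v \<in> carrier_vec n \<Longrightarrow> (k \<cdot>\<^sub>m M) *\<^sub>v v = (k :: complex) \<cdot>\<^sub>v (M *\<^sub>v v)"
  by (rule eq_vecI) auto

lemma mat_sum_carrier [simp]: "mat_sum n f S \<in> carrier_mat n n"
  by (simp add: mat_sum_def)

lemma mat_sum_cong: "(\<And>x. x \<in> S \<Longrightarrow> f x = g x) \<Longrightarrow> mat_sum n f S = mat_sum n g S"
  by (simp add: mat_sum_def)

lemma mat_mult_index:
  assumes "M \<in> carrier_mat n n" "N \<in> carrier_mat n n" "i < n" "j < n"
  shows "(M * N) $$ (i, j) = (\<Sum>k<n. M $$ (i, k) * N $$ (k, j))"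
  using assms by (simp add: scalar_prod_def lessThan_atLeast0)

lemma mult_mat_sum:
  assumes "M \<in> carrier_mat n n" "\<And>x. x \<in> S \<Longrightarrow> f x \<in> carrier_mat n n"
  shows "M * mat_sum n f S = mat_sum n (\<lambda>x. M * f x) S"
proof (rule eq_matI)
  fix i j assume "i < dim_row (mat_sum n (\<lambda>x. M * f x) S)" "j < dim_col (mat_sum n (\<lambda>x. M * f x) S)"
  then have ij: "i < n" "j < n" by (auto simp: mat_sum_def)
  have "(M * mat_sum n f S) $$ (i, j) = (\<Sum>k<n. \<Sum>x\<in>S. M $$ (i, k) * f x $$ (k, j))"
    using mat_mult_index[OF assms(1) _ ij, of "mat_sum n f S"] ij by (simp add: mat_sum_def sum_distrib_left)
  also have "\<dots> = (\<Sum>x\<in>S. (M * f x) $$ (i, j))"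
    by (subst sum.swap) (rule sum.cong[OF refl], simp only: mat_mult_index[OF assms(1) assms(2) ij])
  finally show "(M * mat_sum n f S) $$ (i, j) = mat_sum n (\<lambda>x. M * f x) S $$ (i, j)"
    using ij by (simp add: mat_sum_def)
qed (use assms in \<open>auto simp: mat_sum_def\<close>)

lemma mat_sum_mult:
  assumes "M \<in> carrier_mat n n" "\<And>x. x \<in> S \<Longrightarrow> f x \<in> carrier_mat n n"
  shows "mat_sum n f S * M = mat_sum n (\<lambda>x. f x * M) S"
proof (rule eq_matI)
  fix i j assume "i < dim_row (mat_sum n (\<lambda>x. f x * M) S)" "j < dim_col (mat_sum n (\<lambda>x. f x * M) S)"
  then have ij: "i < n" "j < n" by (auto simp: mat_sum_def)
  have "(mat_sum n f S * M) $$ (i, j) = (\<Sum>k<n. \<Sum>x\<in>S. f x $$ (i, k) * M $$ (k, j))"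
    using mat_mult_index[OF _ assms(1) ij, of "mat_sum n f S"] ij by (simp add: mat_sum_def sum_distrib_right)
  also have "\<dots> = (\<Sum>x\<in>S. (f x * M) $$ (i, j))"
    by (subst sum.swap) (rule sum.cong[OF refl], simp only: mat_mult_index[OF assms(2) assms(1) ij])
  finally show "(mat_sum n f S * M) $$ (i, j) = mat_sum n (\<lambda>x. f x * M) S $$ (i, j)"
    using ij by (simp add: mat_sum_def)
qed (use assms in \<open>auto simp: mat_sum_def\<close>)

lemma smult_mat_sum:
  assumes "\<And>x. x \<in> S \<Longrightarrow> f x \<in> carrier_mat n n"
  shows "c \<cdot>\<^sub>m mat_sum n f S = mat_sum n (\<lambda>x. c \<cdot>\<^sub>m f x) S"
proof (rule eq_matI)
  fix i j assume "i < dim_row (mat_sum n (\<lambda>x. c \<cdot>\<^sub>m f x) S)" "j < dim_col (mat_sum n (\<lambda>x. c \<cdot>\<^sub>m f x) S)"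
  then have ij: "i < n" "j < n" by (auto simp: mat_sum_def)
  have "(\<Sum>x\<in>S. c * f x $$ (i, j)) = (\<Sum>x\<in>S. (c \<cdot>\<^sub>m f x) $$ (i, j))"
  proof (rule sum.cong[OF refl])
    fix x assume "x \<in> S"
    then show "c * f x $$ (i, j) = (c \<cdot>\<^sub>m f x) $$ (i, j)" using carrier_matD[OF assms] ij by simp
  qed
  then show "(c \<cdot>\<^sub>m mat_sum n f S) $$ (i, j) = mat_sum n (\<lambda>x. c \<cdot>\<^sub>m f x) S $$ (i, j)"
    using ij by (simp add: mat_sum_def sum_distrib_left)
qed (auto simp: mat_sum_def)

lemma mat_sum_mult_vec:
  assumes "\<And>x. x \<in> S \<Longrightarrow> f x \<in> carrier_mat n n" "v \<in> carrier_vec n" "i < n"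
  shows "(mat_sum n f S *\<^sub>v v) $ i = (\<Sum>x\<in>S. (f x *\<^sub>v v) $ i)"
proof -
  have v: "(M *\<^sub>v v) $ i = (\<Sum>k<n. M $$ (i, k) * v $ k)" if "M \<in> carrier_mat n n" for M
    using that assms by (simp add: scalar_prod_def lessThan_atLeast0)
  have "(mat_sum n f S *\<^sub>v v) $ i = (\<Sum>k<n. \<Sum>x\<in>S. f x $$ (i, k) * v $ k)"
    using v[of "mat_sum n f S"] assms(3) by (simp add: mat_sum_def sum_distrib_right)
  also have "\<dots> = (\<Sum>x\<in>S. (f x *\<^sub>v v) $ i)"
    by (subst sum.swap) (rule sum.cong[OF refl], simp only: v[OF assms(1)])
  finally show ?thesis .
qed

lemma mat_sum_const:
  assumes "M \<in> carrier_mat n n"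
  shows "mat_sum n (\<lambda>_. M) S = of_nat (card S) \<cdot>\<^sub>m M"
  using assms by (intro eq_matI) (auto simp: mat_sum_def)

lemma mat_sum_reindex:
  assumes "\<And>x. x \<in> S \<Longrightarrow> j (i x) = x \<and> i x \<in> S" "\<And>x. x \<in> S \<Longrightarrow> i (j x) = x \<and> j x \<in> S"
  shows "mat_sum n (\<lambda>x. f (i x)) S = mat_sum n f S"
proof -
  have "(\<Sum>x\<in>S. f (i x) $$ ij) = (\<Sum>x\<in>S. f x $$ ij)" for ij
    by (rule sum.reindex_bij_witness[of _ j i]) (use assms in auto)
  then show ?thesis by (simp add: mat_sum_def)
qed

lemma mat_trace_sum: "mat_trace n (mat_sum n f S) = (\<Sum>x\<in>S. mat_trace n (f x))"
  unfolding mat_trace_def mat_sum_def by (simp add: sum.swap[of _ S])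

lemma mat_trace_smult: "M \<in> carrier_mat n n \<Longrightarrow> mat_trace n (c \<cdot>\<^sub>m M) = c * mat_trace n M"
  by (simp add: mat_trace_def sum_distrib_left)

lemma mat_trace_comm:
  assumes "M \<in> carrier_mat n n" "N \<in> carrier_mat n n"
  shows "mat_trace n (M * N) = mat_trace n (N * M)"
proof -
  have "mat_trace n (M * N) = (\<Sum>i<n. \<Sum>k<n. M $$ (i, k) * N $$ (k, i))"
    unfolding mat_trace_def by (rule sum.cong[OF refl], subst mat_mult_index[OF assms]) auto
  also have "\<dots> = (\<Sum>k<n. \<Sum>i<n. N $$ (k, i) * M $$ (i, k))"
    by (subst sum.swap) (simp add: mult.commute)
  also have "\<dots> = mat_trace n (N * M)"
    unfolding mat_trace_def by (rule sum.cong[OF refl], subst mat_mult_index[OF assms(2,1)]) auto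
  finally show ?thesis .
qed

lemma smult_vec_cancel:
  fixes v :: "complex vec"
  assumes "v \<in> carrier_vec n" "v \<noteq> 0\<^sub>v n" "a \<cdot>\<^sub>v v = b \<cdot>\<^sub>v v"
  shows "a = b"
proof -
  obtain i where i: "i < n" "v $ i \<noteq> 0" using assms(1,2) by (auto simp: vec_eq_iff)
  then show ?thesis using arg_cong[OF assms(3), of "\<lambda>w. w $ i"] assms(1) by auto
qed

section \<open>Characters determined by an eigenvector of a normal subgroup\<close>

lemma eigenvector_linear_character:
  fixes G (structure)
  assumes G: "group G" and A: "subgroup A G" and rep: "representation G n \<rho>"
    and v: "v \<in> carrier_vec n" "v \<noteq> 0\<^sub>v n" "\<And>a. a \<in> A \<Longrightarrow> \<rho> a *\<^sub>v v = \<psi> a \<cdot>\<^sub>v v"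
  shows "linear_character (subgroup_monoid G A) \<psi>"
  unfolding linear_character_def
proof (intro conjI ballI)
  interpret group G by fact
  interpret A: subgroup A G by fact
  note R = representationD[OF G rep]
  have "\<psi> \<one> \<cdot>\<^sub>v v = 1 \<cdot>\<^sub>v v" using v(3)[OF A.one_closed] v(1) by (simp add: R(3))
  then show "\<psi> \<one>\<^bsub>subgroup_monoid G A\<^esub> = 1" using smult_vec_cancel[OF v(1,2)] by simp
  fix a b assume "a \<in> carrier (subgroup_monoid G A)" "b \<in> carrier (subgroup_monoid G A)"
  then have ab: "a \<in> A" "b \<in> A" by auto
  then have abG: "a \<in> carrier G" "b \<in> carrier G" by auto
  have "\<psi> (a \<otimes> b) \<cdot>\<^sub>v v = \<rho> a *\<^sub>v (\<rho> b *\<^sub>v v)"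
    using v(3)[of "a \<otimes> b"] ab R(1)[OF abG(1)] R(1)[OF abG(2)] v(1) abG by (simp add: R(2))
  also have "\<dots> = (\<psi> a * \<psi> b) \<cdot>\<^sub>v v"
    using v ab R(1)[OF abG(1)] by (simp add: mult_mat_vec smult_smult_assoc mult.commute)
  finally show "\<psi> (a \<otimes>\<^bsub>subgroup_monoid G A\<^esub> b) = \<psi> a * \<psi> b" using smult_vec_cancel[OF v(1,2)] by simp
qed

(* E is a multiple of the projection of \<rho> to its \<psi>-isotypic part over A; by Schur's lemma the sum of
   the conjugates of E is scalar. *)
lemma character_of_eigenvector:
  fixes G (structure)
  assumes A: "A \<lhd> G" and fin: "finite (carrier G)" and irr: "irreducible_representation G n \<rho>"
    and v: "v \<in> carrier_vec n" "v \<noteq> 0\<^sub>v n" "\<And>a. a \<in> A \<Longrightarrow> \<rho> a *\<^sub>v v = \<psi> a \<cdot>\<^sub>v v"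
    and sep: "\<And>x. x \<in> carrier G \<Longrightarrow> x \<notin> A \<Longrightarrow> \<exists>a\<in>A. \<psi> (inv x \<otimes> a \<otimes> x) \<noteq> \<psi> a"
    and g: "g \<in> carrier G"
  shows "character_of G n \<rho> g = of_nat n * of_nat (card A) / of_nat (card (carrier G)) * induced_char G A \<psi> g"
proof -
  interpret normal A G by fact
  note D = irreducible_representationD[OF irr]
  note R = representationD[OF group_axioms D(1)]
  have lc: "linear_character (subgroup_monoid G A) \<psi>"
    using v by (intro eigenvector_linear_character[OF group_axioms subgroup_axioms D(1), of v]) auto
  note L = linear_character_subgroup[OF group_axioms subgroup_axioms lc]
  have finA: "finite A" using finite_subset[OF subset fin] .
  have AG[simp]: "x \<in> carrier G" if "x \<in> A" for x using that subset by blast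
  have R1[simp]: "\<rho> x \<in> carrier_mat n n" if "x \<in> carrier G" for x using R(1)[OF that] .
  note as = assoc_mult_mat[of _ n n _ n _ n]
  note sm = mult_smult_assoc_mat[of _ n n _ n] mult_smult_distrib[of _ n n _ n]
  have m[simp]: "M * N \<in> carrier_mat n n" if "M \<in> carrier_mat n n" "N \<in> carrier_mat n n" for M N :: "complex mat"
    using that by (rule mult_carrier_mat)
  define E where "E = mat_sum n (\<lambda>a. \<psi> (inv a) \<cdot>\<^sub>m \<rho> a) A"
  have E[simp]: "E \<in> carrier_mat n n" by (simp add: E_def)
  have inv_mult: "\<psi> (inv (x \<otimes> y)) = \<psi> (inv x) * \<psi> (inv y)" if "x \<in> A" "y \<in> A" for x y
    using that by (simp add: inv_mult_group L(2) mult.commute)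
  have LE: "\<rho> b * E = \<psi> b \<cdot>\<^sub>m E" if b: "b \<in> A" for b
  proof -
    have "\<rho> b * E = mat_sum n (\<lambda>a. \<rho> b * (\<psi> (inv a) \<cdot>\<^sub>m \<rho> a)) A"
      unfolding E_def using b by (intro mult_mat_sum) auto
    also have "\<dots> = mat_sum n (\<lambda>a. (\<lambda>a. \<psi> b \<cdot>\<^sub>m (\<psi> (inv a) \<cdot>\<^sub>m \<rho> a)) (b \<otimes> a)) A"
    proof (rule mat_sum_cong)
      fix a assume a: "a \<in> A"
      have "\<psi> b * \<psi> (inv (b \<otimes> a)) = \<psi> (inv a)" using inv_mult[OF b a] L(3)[OF b] by simp
      then show "\<rho> b * (\<psi> (inv a) \<cdot>\<^sub>m \<rho> a) = \<psi> b \<cdot>\<^sub>m (\<psi> (inv (b \<otimes> a)) \<cdot>\<^sub>m \<rho> (b \<otimes> a))"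
        using a b by (simp add: sm R(2) smult_smult_mat)
    qed
    also have "\<dots> = mat_sum n (\<lambda>a. \<psi> b \<cdot>\<^sub>m (\<psi> (inv a) \<cdot>\<^sub>m \<rho> a)) A"
      by (rule mat_sum_reindex[where j = "\<lambda>a. inv b \<otimes> a"]) (use b in \<open>auto simp flip: m_assoc\<close>)
    also have "\<dots> = \<psi> b \<cdot>\<^sub>m E" unfolding E_def by (rule smult_mat_sum[symmetric]) simp
    finally show ?thesis .
  qed
  have RE: "E * \<rho> b = \<psi> b \<cdot>\<^sub>m E" if b: "b \<in> A" for b
  proof -
    have "E * \<rho> b = mat_sum n (\<lambda>a. (\<psi> (inv a) \<cdot>\<^sub>m \<rho> a) * \<rho> b) A"
      unfolding E_def using b by (intro mat_sum_mult) auto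
    also have "\<dots> = mat_sum n (\<lambda>a. (\<lambda>a. \<psi> b \<cdot>\<^sub>m (\<psi> (inv a) \<cdot>\<^sub>m \<rho> a)) (a \<otimes> b)) A"
    proof (rule mat_sum_cong)
      fix a assume a: "a \<in> A"
      have "\<psi> b * \<psi> (inv (a \<otimes> b)) = \<psi> (inv a)" using inv_mult[OF a b] L(3)[OF b] by simp
      then show "(\<psi> (inv a) \<cdot>\<^sub>m \<rho> a) * \<rho> b = \<psi> b \<cdot>\<^sub>m (\<psi> (inv (a \<otimes> b)) \<cdot>\<^sub>m \<rho> (a \<otimes> b))"
        using a b by (simp add: sm R(2) smult_smult_mat)
    qed
    also have "\<dots> = mat_sum n (\<lambda>a. \<psi> b \<cdot>\<^sub>m (\<psi> (inv a) \<cdot>\<^sub>m \<rho> a)) A"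
      by (rule mat_sum_reindex[where j = "\<lambda>a. a \<otimes> inv b"]) (use b in \<open>auto simp: m_assoc\<close>)
    also have "\<dots> = \<psi> b \<cdot>\<^sub>m E" unfolding E_def by (rule smult_mat_sum[symmetric]) simp
    finally show ?thesis .
  qed
  have EE: "E * E = of_nat (card A) \<cdot>\<^sub>m E"
  proof -
    have "E * E = mat_sum n (\<lambda>a. (\<psi> (inv a) \<cdot>\<^sub>m \<rho> a) * E) A"
      by (subst (1) E_def, rule mat_sum_mult) auto
    also have "\<dots> = mat_sum n (\<lambda>a. E) A"
    proof (rule mat_sum_cong)
      fix a assume a: "a \<in> A"
      have "\<psi> (inv a) * \<psi> a = 1" using L(3)[OF a] by (simp add: mult.commute)
      then show "(\<psi> (inv a) \<cdot>\<^sub>m \<rho> a) * E = E" using a by (simp add: sm LE smult_smult_mat one_smult_mat)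
    qed
    also have "\<dots> = of_nat (card A) \<cdot>\<^sub>m E" by (simp add: mat_sum_const)
    finally show ?thesis .
  qed
  have cA: "card A \<noteq> 0" using finA subgroup.one_closed[OF subgroup_axioms] by (metis card_0_eq empty_iff)
  \<comment> \<open>E maps v to |A| v, since every summand fixes v.\<close>
  have E0: "E \<noteq> 0\<^sub>m n n"
  proof
    assume "E = 0\<^sub>m n n"
    then have 0: "E *\<^sub>v v = 0\<^sub>v n" using v(1) by (auto intro!: eq_vecI simp: scalar_prod_def)
    have "v $ i = 0" if i: "i < n" for i
    proof -
      have "(E *\<^sub>v v) $ i = (\<Sum>a\<in>A. ((\<psi> (inv a) \<cdot>\<^sub>m \<rho> a) *\<^sub>v v) $ i)"
        unfolding E_def by (rule mat_sum_mult_vec) (use v i in auto)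
      also have "\<dots> = (\<Sum>a\<in>A. v $ i)"
      proof (rule sum.cong[OF refl])
        fix a assume a: "a \<in> A"
        have "((\<psi> (inv a) \<cdot>\<^sub>m \<rho> a) *\<^sub>v v) = \<psi> (inv a) \<cdot>\<^sub>v (\<psi> a \<cdot>\<^sub>v v)"
          using a v by (simp flip: v(3)) (simp add: smult_mat_mult_vec[of _ n])
        also have "\<dots> = v" using L(3)[OF a] by (simp add: smult_smult_assoc mult.commute)
        finally show "((\<psi> (inv a) \<cdot>\<^sub>m \<rho> a) *\<^sub>v v) $ i = v $ i" by simp
      qed
      finally show ?thesis using 0 i cA by simp
    qed
    then show False using v(1,2) by (auto simp: vec_eq_iff)
  qed
  \<comment> \<open>For x outside A this conjugate of E belongs to a different linear character of
    A, by \<open>sep\<close>, and so E annihilates it; for x in A it is E itself.\<close>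
  define C where "C x = \<rho> x * E * \<rho> (inv x)" for x
  have C[simp]: "C x \<in> carrier_mat n n" if "x \<in> carrier G" for x using that by (simp add: C_def)
  have RC: "\<rho> y * C x = C (y \<otimes> x) * \<rho> y" if "x \<in> carrier G" "y \<in> carrier G" for x y
  proof -
    have "C (y \<otimes> x) * \<rho> y = \<rho> y * \<rho> x * E * (\<rho> (inv (y \<otimes> x)) * \<rho> y)"
      using that by (simp add: C_def as R(2))
    also have "\<rho> (inv (y \<otimes> x)) * \<rho> y = \<rho> (inv x)"
      using that by (simp add: inv_mult_group m_assoc flip: R(2))
    finally show ?thesis using that by (simp add: C_def as)
  qed
  have EC_out: "E * C x = 0\<^sub>m n n" if x: "x \<in> carrier G" "x \<notin> A" for x
  proof -
    obtain a where a: "a \<in> A" "\<psi> (inv x \<otimes> a \<otimes> x) \<noteq> \<psi> a" using sep[OF x] by blast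
    let ?b = "inv x \<otimes> a \<otimes> x"
    have b: "?b \<in> A" using inv_op_closed1[OF x(1) a(1)] .
    have "\<rho> a * C x = \<rho> (a \<otimes> x) * E * \<rho> (inv x)" using a(1) x by (simp add: C_def as R(2))
    also have "a \<otimes> x = x \<otimes> ?b" using a(1) x by (simp flip: m_assoc)
    also have "\<rho> (x \<otimes> ?b) * E * \<rho> (inv x) = \<rho> x * (\<rho> ?b * E) * \<rho> (inv x)"
      using x b by (simp only: R(2)[OF x(1) AG[OF b]]) (simp add: as)
    also have "\<dots> = \<psi> ?b \<cdot>\<^sub>m C x" unfolding LE[OF b] using x by (simp add: C_def sm)
    finally have "\<psi> a \<cdot>\<^sub>m (E * C x) = \<psi> ?b \<cdot>\<^sub>m (E * C x)"
      using a(1) x b RE[OF a(1)] by (metis (no_types, lifting) AG C E R1 as sm)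
    then have eq: "(\<psi> a \<cdot>\<^sub>m (E * C x)) $$ ij = (\<psi> ?b \<cdot>\<^sub>m (E * C x)) $$ ij" for ij by simp
    have car: "E * C x \<in> carrier_mat n n" using x by simp
    show ?thesis
    proof (rule eq_matI)
      fix i j assume "i < dim_row (0\<^sub>m n n :: complex mat)" "j < dim_col (0\<^sub>m n n :: complex mat)"
      then show "(E * C x) $$ (i, j) = 0\<^sub>m n n $$ (i, j)"
        using eq[of "(i, j)"] a(2) car by (simp add: carrier_matD[OF car] del: index_mult_mat)
    qed (use car in auto)
  qed
  have EC_in: "E * C x = of_nat (card A) \<cdot>\<^sub>m E" if x: "x \<in> A" for x
  proof -
    have "C x = (\<psi> x * \<psi> (inv x)) \<cdot>\<^sub>m E"
      using x by (simp add: C_def LE sm RE smult_smult_mat)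
    then show ?thesis using L(3)[OF x] EE by (simp add: one_smult_mat)
  qed
  define f where "f = mat_sum n C (carrier G)"
  have f[simp]: "f \<in> carrier_mat n n" by (simp add: f_def)
  have "f * \<rho> y = \<rho> y * f" if y: "y \<in> carrier G" for y
  proof -
    have "\<rho> y * f = mat_sum n (\<lambda>x. C (y \<otimes> x) * \<rho> y) (carrier G)"
      unfolding f_def using y by (subst mult_mat_sum) (auto simp: RC intro!: mat_sum_cong)
    also have "\<dots> = mat_sum n (\<lambda>x. C x * \<rho> y) (carrier G)"
      by (rule mat_sum_reindex[where f = "\<lambda>x. C x * \<rho> y" and j = "\<lambda>x. inv y \<otimes> x"])
        (use y in \<open>auto simp flip: m_assoc\<close>)
    also have "\<dots> = f * \<rho> y" unfolding f_def using y by (intro mat_sum_mult[symmetric]) auto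
    finally show ?thesis by simp
  qed
  then obtain c where c: "f = c \<cdot>\<^sub>m 1\<^sub>m n" using schur[OF group_axioms irr f] by blast
  \<comment> \<open>Only the terms with x in A survive, and each of them is |A| E. Since E is
    nonzero, the scalar c has to be |A|^2.\<close>
  have "E * f = mat_sum n (\<lambda>x. E * C x) (carrier G)"
    unfolding f_def by (rule mult_mat_sum) simp_all
  also have "\<dots> = mat_sum n (\<lambda>x. of_nat (card A) \<cdot>\<^sub>m E) A"
    unfolding mat_sum_def
  proof (intro cong_mat refl)
    fix i j assume ij: "i < n" "j < n"
    have "(\<Sum>x\<in>carrier G. (E * C x) $$ (i, j)) = (\<Sum>x\<in>A. (E * C x) $$ (i, j))"
      using subset fin EC_out ij by (intro sum.mono_neutral_right) auto
    then show "(\<Sum>x\<in>carrier G. (E * C x) $$ (i, j)) = (\<Sum>x\<in>A. (of_nat (card A) \<cdot>\<^sub>m E) $$ (i, j))"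
      using EC_in by simp
  qed
  also have "\<dots> = (of_nat (card A) * of_nat (card A)) \<cdot>\<^sub>m E" by (simp add: mat_sum_const smult_smult_mat)
  finally have "c \<cdot>\<^sub>m E = (of_nat (card A) * of_nat (card A)) \<cdot>\<^sub>m E" by (simp add: c sm right_mult_one_mat[OF E])
  then have eq: "(c \<cdot>\<^sub>m E) $$ ij = ((of_nat (card A) * of_nat (card A)) \<cdot>\<^sub>m E) $$ ij" for ij by simp
  obtain i j where "i < n" "j < n" "E $$ (i, j) \<noteq> 0"
    using E0 E by (metis (no_types, lifting) carrier_matD eq_matI index_zero_mat)
  then have cv: "c = of_nat (card A) * of_nat (card A)" using eq[of "(i, j)"] carrier_matD[OF E] by auto
  \<comment> \<open>The trace of rho y * f is computed twice, with f as a sum of conjugates and with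
    f as a scalar. This expresses c times the character by the traces of rho(x^-1 y x) E, which
    vanish unless x^-1 y x lies in A.\<close>
  have tr1: "mat_trace n (\<rho> y * f) = (\<Sum>x\<in>carrier G. mat_trace n (\<rho> (inv x \<otimes> y \<otimes> x) * E))"
    if y: "y \<in> carrier G" for y
  proof -
    have "mat_trace n (\<rho> y * f) = (\<Sum>x\<in>carrier G. mat_trace n (\<rho> y * C x))"
      unfolding f_def using y by (subst mult_mat_sum) (auto simp: mat_trace_sum)
    also have "\<dots> = (\<Sum>x\<in>carrier G. mat_trace n (\<rho> (inv x \<otimes> y \<otimes> x) * E))"
    proof (rule sum.cong[OF refl])
      fix x assume x: "x \<in> carrier G"
      have "mat_trace n (\<rho> y * C x) = mat_trace n ((\<rho> y * \<rho> x * E) * \<rho> (inv x))"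
        using x y by (simp add: C_def as)
      also have "\<dots> = mat_trace n (\<rho> (inv x) * (\<rho> y * \<rho> x * E))" using x y by (intro mat_trace_comm) auto
      finally show "mat_trace n (\<rho> y * C x) = mat_trace n (\<rho> (inv x \<otimes> y \<otimes> x) * E)"
        using x y by (simp add: R(2) as)
    qed
    finally show ?thesis .
  qed
  have tr2: "mat_trace n (\<rho> y * f) = c * mat_trace n (\<rho> y)" if y: "y \<in> carrier G" for y
    using y by (simp add: c sm mat_trace_smult right_mult_one_mat[OF R1])
  have tr_in: "mat_trace n (\<rho> y * E) = \<psi> y * mat_trace n E" if "y \<in> A" for y
    using that by (simp add: LE mat_trace_smult)
  have tr_out: "mat_trace n (\<rho> y * E) = 0" if y: "y \<in> carrier G" "y \<notin> A" for y
  proof -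
    have "\<rho> (inv y) * \<rho> y = 1\<^sub>m n" using y R(2)[of "inv y" y] R(3) by simp
    then have "\<rho> y * E = C y * \<rho> y" using y by (simp add: C_def as right_mult_one_mat[OF E])
    then have "E * (\<rho> y * E) = (E * C y) * \<rho> y" using y by (simp add: as)
    then have 0: "E * (\<rho> y * E) = 0\<^sub>m n n" using y by (simp add: EC_out left_mult_zero_mat[OF R1])
    have "of_nat (card A) * mat_trace n (\<rho> y * E) = mat_trace n (\<rho> y * (E * E))"
      using y by (simp add: EE sm mat_trace_smult)
    also have "\<dots> = mat_trace n ((\<rho> y * E) * E)" using y by (simp add: as)
    also have "\<dots> = mat_trace n (E * (\<rho> y * E))" using y by (intro mat_trace_comm) auto
    also have "\<dots> = 0" by (simp add: 0 mat_trace_def)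
    finally show ?thesis using cA by simp
  qed
  \<comment> \<open>Taking y = 1 determines the trace of E and produces the factor n |A| /
    |G|.\<close>
  have "c * of_nat n = of_nat (card (carrier G)) * mat_trace n E"
  proof -
    have "mat_trace n (1\<^sub>m n) = of_nat n" by (simp add: mat_trace_def)
    then have "c * of_nat n = (\<Sum>x\<in>carrier G. mat_trace n (\<rho> (inv x \<otimes> \<one> \<otimes> x) * E))"
      using tr1[OF one_closed] tr2[OF one_closed] R(3) by simp
    also have "\<dots> = of_nat (card (carrier G)) * mat_trace n E" by (simp add: R(3) left_mult_one_mat[OF E])
    finally show ?thesis .
  qed
  moreover have G0: "card (carrier G) \<noteq> 0" using fin one_closed by (metis card_0_eq empty_iff)
  ultimately have trE: "mat_trace n E = c * of_nat n / of_nat (card (carrier G))" by (simp add: field_simps)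
  have "c * character_of G n \<rho> g = (\<Sum>x\<in>carrier G. mat_trace n (\<rho> (inv x \<otimes> g \<otimes> x) * E))"
    using tr1[OF g] tr2[OF g] g by (simp add: character_of_def mat_trace_def)
  also have "\<dots> = (\<Sum>x\<in>carrier G. if inv x \<otimes> g \<otimes> x \<in> A then \<psi> (inv x \<otimes> g \<otimes> x) else 0) * mat_trace n E"
    unfolding sum_distrib_right by (rule sum.cong[OF refl]) (use g tr_in tr_out in auto)
  also have "\<dots> = of_nat (card A) * induced_char G A \<psi> g * mat_trace n E"
    using g cA by (simp add: induced_char_def)
  finally have "c * character_of G n \<rho> g
      = c * (of_nat n * of_nat (card A) / of_nat (card (carrier G)) * induced_char G A \<psi> g)"
    unfolding trE by simp
  moreover have "c \<noteq> 0" using cv cA by simp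
  ultimately show ?thesis by (metis mult_left_cancel)
qed

subsection \<open>Groups with the commutator structure of the family\<close>

context group begin

lemma nat_pow_commute:
  fixes i j :: nat
  assumes "x \<in> carrier G" "y \<in> carrier G" "x \<otimes> y = y \<otimes> x"
  shows "x [^] i \<otimes> y [^] j = y [^] j \<otimes> x [^] i"
  using assms by (metis group_commutes_pow nat_pow_closed)

lemma nat_pow_mod:
  fixes i n :: nat
  assumes "x \<in> carrier G"
  shows "x [^] i = x [^] (i mod n) \<otimes> (x [^] n) [^] (i div n)"
  using assms by (simp add: nat_pow_mult nat_pow_pow)

lemma nat_pow_eq_pow_mod:
  fixes i n :: nat
  assumes "x \<in> carrier G" "x [^] n = \<one>"
  shows "x [^] i = x [^] (i mod n)"
  using nat_pow_mod[OF assms(1), of i n] assms by simp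

lemma commutator_closed: "x \<in> carrier G \<Longrightarrow> y \<in> carrier G \<Longrightarrow> commutator G x y \<in> carrier G"
  by (simp add: commutator_def)

lemma mult_inv_cancel:
  assumes "x \<in> carrier G" "y \<in> carrier G"
  shows "x \<otimes> (inv x \<otimes> y) = y" "inv x \<otimes> (x \<otimes> y) = y"
  using assms by (simp_all flip: m_assoc)

lemma commutator_swap:
  "x \<in> carrier G \<Longrightarrow> y \<in> carrier G \<Longrightarrow> x \<otimes> y = y \<otimes> x \<otimes> commutator G x y"
  by (simp add: commutator_def m_assoc mult_inv_cancel)

lemma commutator_eqI:
  assumes "x \<in> carrier G" "y \<in> carrier G" "m \<in> carrier G" "x \<otimes> y = y \<otimes> x \<otimes> m"
  shows "commutator G x y = m"
proof -
  have "y \<otimes> x \<otimes> commutator G x y = y \<otimes> x \<otimes> m" using commutator_swap[OF assms(1,2)] assms(4) by simp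
  then show ?thesis using assms commutator_closed by (meson l_cancel m_closed)
qed

lemma commutator_eq_one_iff:
  "x \<in> carrier G \<Longrightarrow> y \<in> carrier G \<Longrightarrow> commutator G x y = \<one> \<longleftrightarrow> x \<otimes> y = y \<otimes> x"
  by (metis commutator_swap commutator_eqI m_closed one_closed r_one)

lemma finite_mult_closed_subgroup:
  assumes "finite (carrier G)" "H \<subseteq> carrier G" "\<one> \<in> H" "\<And>x y. x \<in> H \<Longrightarrow> y \<in> H \<Longrightarrow> x \<otimes> y \<in> H"
  shows "subgroup H G"
proof (rule subgroupI)
  fix x assume x: "x \<in> H"
  then have xG: "x \<in> carrier G" using assms(2) by blast
  have pow: "x [^] (n::nat) \<in> H" for n by (induction n) (use assms(3,4) x in auto)
  have "ord x > 0" using ord_ge_1[OF assms(1) xG] by simp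
  then have "x [^] (ord x - 1) \<otimes> x = \<one>"
    using pow_ord_eq_1[OF xG] by (metis Suc_diff_1 nat_pow_Suc)
  then have "inv x = x [^] (ord x - 1)" using xG by (simp add: inv_equality)
  then show "inv x \<in> H" using pow by simp
qed (use assms in auto)

lemma center_subgroup: "subgroup (center G) G"
proof (rule subgroupI)
  fix x assume x: "x \<in> center G"
  then have xG: "x \<in> carrier G" by (simp add: centralizer_def)
  have "inv x \<otimes> s = s \<otimes> inv x" if s: "s \<in> carrier G" for s
  proof -
    have "x \<otimes> s = s \<otimes> x" using x s by (simp add: centralizer_def)
    have "inv x \<otimes> s = inv x \<otimes> (s \<otimes> x) \<otimes> inv x" using xG s by (simp add: m_assoc)
    also have "\<dots> = s \<otimes> inv x" using xG s by (simp add: m_assoc mult_inv_cancel flip: \<open>x \<otimes> s = s \<otimes> x\<close>)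
    finally show ?thesis .
  qed
  then show "inv x \<in> center G" using xG by (simp add: centralizer_def)
next
  fix x y assume xy: "x \<in> center G" "y \<in> center G"
  then have G: "x \<in> carrier G" "y \<in> carrier G" by (simp_all add: centralizer_def)
  have "x \<otimes> y \<otimes> s = s \<otimes> (x \<otimes> y)" if s: "s \<in> carrier G" for s
  proof -
    have eq: "x \<otimes> s = s \<otimes> x" "y \<otimes> s = s \<otimes> y" using xy s by (simp_all add: centralizer_def)
    have "x \<otimes> y \<otimes> s = x \<otimes> s \<otimes> y" using G s eq(2) by (simp add: m_assoc)
    then show ?thesis using G s eq(1) by (simp add: m_assoc)
  qed
  then show "x \<otimes> y \<in> center G" using G by (simp add: centralizer_def)
qed (auto simp: centralizer_def)

lemma centerD: "z \<in> center G \<Longrightarrow> z \<in> carrier G" "z \<in> center G \<Longrightarrow> x \<in> carrier G \<Longrightarrow> z \<otimes> x = x \<otimes> z"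
  by (auto simp: centralizer_def)

lemma center_pow: "z \<in> center G \<Longrightarrow> z [^] (n::nat) \<in> center G"
  using subgroup.one_closed[OF center_subgroup] subgroup.m_closed[OF center_subgroup] by (induction n) auto

lemma nat_pow_prime_order:
  fixes i p :: nat
  assumes "prime p" "x \<in> carrier G" "x \<noteq> \<one>" "x [^] p = \<one>"
  shows "x [^] i = \<one> \<longleftrightarrow> p dvd i"
proof -
  have "ord x dvd p" using assms by (simp add: pow_eq_id[symmetric])
  moreover have "ord x \<noteq> 1" using ord_eq_1[OF assms(2)] assms(3) by simp
  ultimately have "ord x = p" using assms(1) by (metis prime_nat_iff)
  then show ?thesis using assms(2) by (simp add: pow_eq_id)
qed

lemma nat_pow_eq_iff:
  fixes i j p :: nat
  assumes "prime p" "x \<in> carrier G" "x \<noteq> \<one>" "x [^] p = \<one>"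
  shows "x [^] i = x [^] j \<longleftrightarrow> i mod p = j mod p"
proof -
  have *: "i mod p = j mod p" if ij: "i \<le> j" "x [^] i = x [^] j" for i j :: nat
  proof -
    obtain k where k: "j = i + k" using ij(1) le_Suc_ex by blast
    have "x [^] i \<otimes> x [^] k = x [^] j" using assms(2) by (simp add: nat_pow_mult k)
    then have "x [^] i \<otimes> x [^] k = x [^] i \<otimes> \<one>" using ij(2) assms(2) by simp
    then have "x [^] k = \<one>" using assms(2) l_cancel[of "x [^] i" "x [^] k" \<one>] by simp
    then have "p dvd k" using nat_pow_prime_order[OF assms] by simp
    then show ?thesis using k by (auto elim!: dvdE)
  qed
  show ?thesis
  proof
    assume eq: "x [^] i = x [^] j"
    show "i mod p = j mod p"
    proof (cases "i \<le> j")
      case False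
      then show ?thesis using *[OF _ eq[symmetric]] by linarith
    qed (rule *[OF _ eq])
  next
    assume "i mod p = j mod p"
    have "x [^] i = x [^] (i mod p)" by (rule nat_pow_eq_pow_mod[OF assms(2,4)])
    also have "\<dots> = x [^] (j mod p)" using \<open>i mod p = j mod p\<close> by (rule arg_cong)
    also have "\<dots> = x [^] j" by (rule nat_pow_eq_pow_mod[OF assms(2,4), symmetric])
    finally show "x [^] i = x [^] j" .
  qed
qed

end

text \<open>The relations are oriented as rules that move a to the left, with c = [b, a] and d =
  [c, a]. They do not mention orders of elements, so the collection formulas hold for presented
  groups and for G alike.\<close>

locale phi3_relations = group G for G (structure) +
  fixes a b c d
  assumes closed [simp]: "a \<in> carrier G" "b \<in> carrier G" "c \<in> carrier G" "d \<in> carrier G"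
    and ba: "b \<otimes> a = a \<otimes> b \<otimes> c" and ca: "c \<otimes> a = a \<otimes> c \<otimes> d" and cb: "c \<otimes> b = b \<otimes> c"
    and da: "d \<otimes> a = a \<otimes> d" and db: "d \<otimes> b = b \<otimes> d" and dc: "d \<otimes> c = c \<otimes> d"
begin

text \<open>Normal form in the abelian subgroup generated by b, c and d. A collected word is a power
  of a followed by such an element.\<close>

definition nf :: "nat \<Rightarrow> nat \<Rightarrow> nat \<Rightarrow> 'a" where
  "nf j k l = b [^] j \<otimes> (c [^] k \<otimes> d [^] l)"

lemma nf_closed [simp]: "nf j k l \<in> carrier G"
  by (simp add: nf_def)

lemma left_assoc:
  assumes "x \<otimes> y = z" "x \<in> carrier G" "y \<in> carrier G" "w \<in> carrier G"
  shows "x \<otimes> (y \<otimes> w) = z \<otimes> w"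
  using assms by (simp flip: m_assoc)

lemma swaps:
  fixes i j :: nat
  shows "c [^] i \<otimes> b [^] j = b [^] j \<otimes> c [^] i" "d [^] i \<otimes> b [^] j = b [^] j \<otimes> d [^] i"
    "d [^] i \<otimes> c [^] j = c [^] j \<otimes> d [^] i" "d [^] i \<otimes> a [^] j = a [^] j \<otimes> d [^] i"
  using nat_pow_commute cb db dc da by auto

lemma nf_mult: "nf j k l \<otimes> nf j' k' l' = nf (j + j') (k + k') (l + l')"
  unfolding nf_def
  by (simp add: m_assoc left_assoc[OF swaps(1)] left_assoc[OF swaps(2)] left_assoc[OF swaps(3)]
      left_assoc[OF nat_pow_mult] nat_pow_mult)

lemma nf_zero [simp]: "nf 0 0 0 = \<one>"
  by (simp add: nf_def)

lemma nf_powers: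
  shows "b [^] j = nf j 0 0" "c [^] k = nf 0 k 0" "d [^] l = nf 0 0 l"
  by (simp_all add: nf_def)

lemma nf_gens: "b = nf 1 0 0" "c = nf 0 1 0" "d = nf 0 0 1"
  by (simp_all add: nf_def)

lemma nf_pow: "nf j k l [^] (n::nat) = nf (n * j) (n * k) (n * l)"
  by (induction n) (simp_all add: nf_mult algebra_simps)

lemma nf_commute: "nf j k l \<otimes> nf j' k' l' = nf j' k' l' \<otimes> nf j k l"
  by (simp add: nf_mult add.commute)

text \<open>Conjugation by a acts on the exponent vector (j, k, l) as a unipotent Jordan block of
  size three.\<close>

lemma nf_a: "nf j k l \<otimes> a = a \<otimes> nf j (j + k) (k + l)"
proof -
  have d: "d [^] l \<otimes> a = a \<otimes> d [^] l" for l :: nat using swaps(4)[of l 1] by simp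
  have c: "c [^] k \<otimes> a = a \<otimes> (c [^] k \<otimes> d [^] k)" for k :: nat
  proof (induction k)
    case (Suc k)
    have "c [^] Suc k \<otimes> a = c [^] k \<otimes> (a \<otimes> c \<otimes> d)" using ca by (simp add: m_assoc)
    also have "\<dots> = c [^] k \<otimes> a \<otimes> (c \<otimes> d)" by (simp add: m_assoc)
    also have "\<dots> = a \<otimes> (nf 0 k k \<otimes> nf 0 1 1)" by (simp add: Suc nf_def m_assoc)
    also have "\<dots> = a \<otimes> (c [^] Suc k \<otimes> d [^] Suc k)" unfolding nf_mult by (simp add: nf_def)
    finally show ?case .
  qed simp
  have b: "b [^] j \<otimes> a = a \<otimes> (b [^] j \<otimes> c [^] j)" for j :: nat
  proof (induction j)
    case (Suc j)
    have "b [^] Suc j \<otimes> a = b [^] j \<otimes> (a \<otimes> b \<otimes> c)" using ba by (simp add: m_assoc)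
    also have "\<dots> = b [^] j \<otimes> a \<otimes> (b \<otimes> c)" by (simp add: m_assoc)
    also have "\<dots> = a \<otimes> (nf j j 0 \<otimes> nf 1 1 0)" by (simp add: Suc nf_def m_assoc)
    also have "\<dots> = a \<otimes> (b [^] Suc j \<otimes> c [^] Suc j)" unfolding nf_mult by (simp add: nf_def)
    finally show ?case .
  qed simp
  have "nf j k l \<otimes> a = b [^] j \<otimes> (c [^] k \<otimes> (a \<otimes> d [^] l))" by (simp add: nf_def m_assoc d)
  also have "\<dots> = b [^] j \<otimes> (a \<otimes> (c [^] k \<otimes> d [^] k) \<otimes> d [^] l)" by (simp add: c flip: m_assoc)
  also have "\<dots> = a \<otimes> (nf j j 0 \<otimes> (nf 0 k k \<otimes> nf 0 0 l))"
    by (simp add: m_assoc left_assoc[OF b] nf_def)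
  also have "\<dots> = a \<otimes> nf j (j + k) (k + l)" by (simp add: nf_mult)
  finally show ?thesis .
qed

text \<open>The i-th power of that Jordan block has the entries 1, i and C(i,2).\<close>

lemma nf_a_pow: "nf j k l \<otimes> a [^] i = a [^] i \<otimes> nf j (i * j + k) (j * (i choose 2) + i * k + l)"
proof (induction i)
  case (Suc i)
  have "nf j k l \<otimes> a [^] Suc i = a [^] i \<otimes> (nf j (i * j + k) (j * (i choose 2) + i * k + l) \<otimes> a)"
    using Suc by (simp flip: m_assoc)
  also have "\<dots> = a [^] Suc i \<otimes> nf j (Suc i * j + k) (j * (Suc i choose 2) + Suc i * k + l)"
    by (simp add: nf_a numeral_2_eq_2 algebra_simps flip: m_assoc)
  finally show ?case .
qed (simp add: numeral_2_eq_2)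

lemma a_nf_mult: "(a [^] i \<otimes> nf j k l) \<otimes> (a [^] i' \<otimes> nf j' k' l')
    = a [^] (i + i') \<otimes> nf (j + j') (i' * j + k + k') (j * (i' choose 2) + i' * k + l + l')"
proof -
  have "(a [^] i \<otimes> nf j k l) \<otimes> (a [^] i' \<otimes> nf j' k' l') = a [^] i \<otimes> (nf j k l \<otimes> a [^] i') \<otimes> nf j' k' l'"
    by (simp add: m_assoc)
  then show ?thesis by (simp add: nf_a_pow m_assoc nf_mult nat_pow_mult left_assoc[OF nat_pow_mult])
qed

text \<open>The corrections from moving each new factor a to the left add up along Pascal's triangle
  to C(n,2) and C(n,3). For n = p >= 5 both are multiples of p.\<close>

lemma ab_pow: "(a \<otimes> b [^] t) [^] n = a [^] n \<otimes> nf (n * t) (t * (n choose 2)) (t * (n choose 3))"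
proof (induction n)
  case (Suc n)
  have "(a \<otimes> b [^] t) [^] Suc n = (a [^] n \<otimes> nf (n * t) (t * (n choose 2)) (t * (n choose 3)))
      \<otimes> (a [^] (1::nat) \<otimes> nf t 0 0)"
    using Suc by (simp add: nf_powers)
  also have "\<dots> = a [^] Suc n \<otimes> nf (Suc n * t) (t * (Suc n choose 2)) (t * (Suc n choose 3))"
    unfolding a_nf_mult by (simp add: numeral_2_eq_2 numeral_3_eq_3 algebra_simps)
  finally show ?case .
qed (simp add: numeral_2_eq_2 numeral_3_eq_3)

text \<open>Products of collected words are collected, so in a finite group these words form a
  subgroup containing the generators. Reducing the exponents of a and b modulo p and m moves the
  excess into the exponent of d. The parameter m is p for the model of order p^4 and p^2 for the
  special groups.\<close>

lemma normal_form:
  fixes p m :: nat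
  assumes fin: "finite (carrier G)" and gen: "generate G S = carrier G"
    and S: "\<And>s. s \<in> S \<Longrightarrow> \<exists>(i::nat) j k l. s = a [^] i \<otimes> nf j k l"
    and rel: "a [^] p = d [^] (s::nat)" "b [^] m = d [^] (t::nat)" "c [^] p = \<one>" "d [^] p = \<one>"
    and pos: "p > 0" "m > 0"
  shows "carrier G = (\<lambda>(i, j, k, l). a [^] i \<otimes> nf j k l) ` ({..<p} \<times> {..<m} \<times> {..<p} \<times> {..<p})"
proof (intro subset_antisym subsetI)
  let ?U = "{a [^] (i::nat) \<otimes> nf j k l | i j k l. True}"
  have "subgroup ?U G"
  proof (rule finite_mult_closed_subgroup[OF fin])
    show "\<one> \<in> ?U" by (intro CollectI exI[of _ 0]) simp
    fix x y assume "x \<in> ?U" "y \<in> ?U"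
    then show "x \<otimes> y \<in> ?U" by (clarsimp simp: a_nf_mult) blast
  qed auto
  then have U: "carrier G \<subseteq> ?U" using generate_subgroup_incl[of S ?U] gen S by blast
  fix x assume "x \<in> carrier G"
  then have "x \<in> ?U" using U by (rule rev_subsetD)
  then obtain i j k l where x: "x = a [^] (i::nat) \<otimes> nf j k l" by (elim CollectE exE conjE)
  have 1: "a [^] i = a [^] (i mod p) \<otimes> nf 0 0 (s * (i div p))"
    using nat_pow_mod[OF closed(1), of i p] rel(1) by (simp add: nf_pow nf_powers mult.commute)
  have "b [^] j = nf (j mod m) 0 (t * (j div m))"
    using nat_pow_mod[OF closed(2), of j m] rel(2) by (simp add: nat_pow_pow nf_def)
  then have "nf j k l = nf (j mod m) k (t * (j div m) + l)"
    using nf_mult[of j 0 0 0 k l] nf_mult[of "j mod m" 0 "t * (j div m)" 0 k l] by (simp flip: nf_powers)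
  then have "x = a [^] (i mod p) \<otimes> nf (j mod m) k (s * (i div p) + (t * (j div m) + l))"
    unfolding x 1 by (simp add: m_assoc nf_mult)
  then have "x = a [^] (i mod p) \<otimes> nf (j mod m) (k mod p) ((s * (i div p) + (t * (j div m) + l)) mod p)"
    unfolding nf_def using nat_pow_eq_pow_mod[OF closed(3) rel(3), of k]
      nat_pow_eq_pow_mod[OF closed(4) rel(4), of "s * (i div p) + (t * (j div m) + l)"] by simp
  then show "x \<in> (\<lambda>(i, j, k, l). a [^] i \<otimes> nf j k l) ` ({..<p} \<times> {..<m} \<times> {..<p} \<times> {..<p})"
    using pos by (intro image_eqI[of _ _ "(i mod p, j mod m, k mod p, (s * (i div p) + (t * (j div m) + l)) mod p)"]) auto
qed auto

end

text \<open>This is what an isoclinism carries over: exact relations inside G', and everything else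
  modulo the centre. Hence a^p and b^p are only asked to be central, and \<open>span\<close>
  describes elements up to a central factor.\<close>

locale phi3 = phi3_relations G a b c d for G (structure) and a b c d +
  fixes p :: nat
  assumes prime: "prime p" and p5: "p \<ge> 5" and fin: "finite (carrier G)"
    and d_center: "d \<in> center G" and d_neq: "d \<noteq> \<one>" and c_pow: "c [^] p = \<one>"
    and a_pow: "a [^] p \<in> center G" and b_pow: "b [^] p \<in> center G"
    and span: "x \<in> carrier G \<Longrightarrow> \<exists>(i::nat) j k. \<exists>z\<in>center G. x = a [^] i \<otimes> (nf j k 0 \<otimes> z)"
begin

text \<open>Moving a past c^p = 1 leaves d^p behind.\<close>

lemma d_pow: "d [^] p = \<one>"
proof -
  have "nf 0 p 0 \<otimes> a = a \<otimes> nf 0 p p" using nf_a[of 0 p 0] by simp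
  then have "a \<otimes> d [^] p = a \<otimes> \<one>" using c_pow by (simp add: nf_def)
  then show ?thesis using l_cancel[of a "d [^] p" \<one>] by simp
qed

lemmas d_pow_one_iff = nat_pow_prime_order[OF prime closed(4) d_neq d_pow]
lemmas d_pow_eq_iff = nat_pow_eq_iff[OF prime closed(4) d_neq d_pow]

lemma c_neq: "c \<noteq> \<one>"
proof
  assume "c = \<one>"
  then have "a \<otimes> d = a \<otimes> \<one>" using ca by simp
  then show False using d_neq l_cancel[of a d \<one>] by simp
qed

lemmas c_pow_one_iff = nat_pow_prime_order[OF prime closed(3) c_neq c_pow]

lemma center_closed: "z \<in> center G \<Longrightarrow> z \<in> carrier G"
  by (rule centerD)

lemma center_mult: "z \<in> center G \<Longrightarrow> w \<in> center G \<Longrightarrow> z \<otimes> w \<in> center G"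
  using subgroup.m_closed[OF center_subgroup] .

lemma d_pow_center: "d [^] (l::nat) \<in> center G"
  using center_pow[OF d_center] .

lemma c_a_pow: fixes i :: nat shows "c \<otimes> a [^] i = a [^] i \<otimes> (c \<otimes> d [^] i)"
  using nf_a_pow[of 0 1 0 i] by (simp add: nf_def)

lemma c_pow_center_iff: "c [^] k \<in> center G \<longleftrightarrow> p dvd k"
proof
  assume "c [^] k \<in> center G"
  then have "c [^] k \<otimes> a = a \<otimes> c [^] k" by (rule centerD) simp
  moreover have "c [^] k \<otimes> a = a \<otimes> (c [^] k \<otimes> d [^] k)" using nf_a[of 0 k 0] by (simp add: nf_def)
  ultimately have "a \<otimes> (c [^] k \<otimes> d [^] k) = a \<otimes> (c [^] k \<otimes> \<one>)" by simp
  then have "d [^] k = \<one>" by (metis closed l_cancel m_closed nat_pow_closed one_closed)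
  then show "p dvd k" by (simp add: d_pow_one_iff)
next
  assume "p dvd k"
  then have "c [^] k = \<one>" by (simp add: c_pow_one_iff)
  then show "c [^] k \<in> center G" using subgroup.one_closed[OF center_subgroup] by simp
qed

text \<open>An explicit form of C_G(G'); see \<open>centralizer_derived_eq\<close>.\<close>

definition A :: "'a set" where
  "A = {nf j k 0 \<otimes> z | j k z. z \<in> center G}"

lemma AI: "z \<in> center G \<Longrightarrow> nf j k 0 \<otimes> z \<in> A"
  by (auto simp: A_def)

lemma AE:
  assumes "u \<in> A" obtains j k z where "z \<in> center G" "u = nf j k 0 \<otimes> z"
  using assms by (auto simp: A_def)

lemma A_closed: "u \<in> A \<Longrightarrow> u \<in> carrier G"
  by (auto elim!: AE dest: center_closed)

lemma nf_A: "nf j k l \<in> A"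
proof -
  have "nf j k l = nf j k 0 \<otimes> d [^] l" by (simp add: nf_def m_assoc)
  then show ?thesis using AI[OF d_pow_center] by simp
qed

lemma gens_A: "b \<in> A" "c \<in> A" "d \<in> A"
  using nf_A nf_gens by metis+

lemma center_A: "center G \<subseteq> A"
proof
  fix z assume z: "z \<in> center G"
  then show "z \<in> A" using AI[OF z, of 0 0] center_closed[OF z] by simp
qed

lemma nf_center_mult:
  assumes "z \<in> center G" "w \<in> center G"
  shows "(nf j k l \<otimes> z) \<otimes> (nf j' k' l' \<otimes> w) = nf (j + j') (k + k') (l + l') \<otimes> (z \<otimes> w)"
proof -
  have zw: "z \<in> carrier G" "w \<in> carrier G" using assms center_closed by auto
  have "(nf j k l \<otimes> z) \<otimes> (nf j' k' l' \<otimes> w) = nf j k l \<otimes> (z \<otimes> nf j' k' l') \<otimes> w" using zw by (simp add: m_assoc)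
  also have "\<dots> = (nf j k l \<otimes> nf j' k' l') \<otimes> (z \<otimes> w)" using zw centerD(2)[OF assms(1) nf_closed] by (simp add: m_assoc)
  finally show ?thesis by (simp add: nf_mult)
qed

lemma A_commute: "u \<in> A \<Longrightarrow> v \<in> A \<Longrightarrow> u \<otimes> v = v \<otimes> u"
  by (elim AE) (simp add: nf_center_mult add.commute centerD(2)[OF _ center_closed])

lemma A_subgroup: "subgroup A G"
proof (rule finite_mult_closed_subgroup[OF fin])
  show "\<one> \<in> A" using nf_A[of 0 0 0] by simp
  fix x y assume "x \<in> A" "y \<in> A"
  then show "x \<otimes> y \<in> A" by (elim AE) (simp add: nf_center_mult AI center_mult)
qed (auto dest: A_closed)

lemma a_pow_mem_A_iff: "a [^] i \<in> A \<longleftrightarrow> p dvd i"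
proof
  assume "a [^] i \<in> A"
  then have "c \<otimes> a [^] i = a [^] i \<otimes> c" using A_commute[OF gens_A(2)] by simp
  then have "a [^] i \<otimes> (c \<otimes> d [^] i) = a [^] i \<otimes> (c \<otimes> \<one>)" using c_a_pow by simp
  then have "d [^] i = \<one>" by (metis closed l_cancel m_closed nat_pow_closed one_closed)
  then show "p dvd i" by (simp add: d_pow_one_iff)
next
  assume "p dvd i"
  then obtain k where "i = p * k" by blast
  then have "a [^] i \<in> center G" using center_pow[OF a_pow] by (simp add: nat_pow_pow)
  then show "a [^] i \<in> A" using center_A by blast
qed

lemma spanE:
  assumes "x \<in> carrier G"
  obtains i :: nat and u where "u \<in> A" "x = a [^] i \<otimes> u"
proof -
  obtain i j k :: nat and z where x: "z \<in> center G" "x = a [^] i \<otimes> (nf j k 0 \<otimes> z)"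
    using span[OF assms] by metis
  show thesis by (rule that[OF AI[OF x(1)] x(2)])
qed

text \<open>As A is abelian, conjugation by an element of a^i A depends only on i, and it fixes
  central factors.\<close>

lemma conj_a_pow:
  assumes z: "z \<in> center G" and v: "v \<in> A"
  shows "inv (a [^] i \<otimes> v) \<otimes> (nf j k l \<otimes> z) \<otimes> (a [^] i \<otimes> v)
    = nf j (i * j + k) (j * (i choose 2) + i * k + l) \<otimes> z" (is "?L = ?w")
proof -
  have zv: "z \<in> carrier G" "v \<in> carrier G" using z v center_closed A_closed by auto
  have wA: "?w \<in> A" using nf_A center_A z subgroup.m_closed[OF A_subgroup] by blast
  have "(nf j k l \<otimes> z) \<otimes> (a [^] i \<otimes> v) = nf j k l \<otimes> (z \<otimes> a [^] i) \<otimes> v" using zv by (simp add: m_assoc)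
  also have "\<dots> = nf j k l \<otimes> a [^] i \<otimes> z \<otimes> v" using zv centerD(2)[OF z, of "a [^] i"] by (simp add: m_assoc)
  also have "\<dots> = a [^] i \<otimes> ?w \<otimes> v" using zv by (simp add: nf_a_pow m_assoc)
  also have "\<dots> = (a [^] i \<otimes> v) \<otimes> ?w" using A_commute[OF wA v] zv by (simp add: m_assoc)
  finally have "?L = inv (a [^] i \<otimes> v) \<otimes> ((a [^] i \<otimes> v) \<otimes> ?w)" using zv by (simp add: m_assoc)
  then show ?thesis using zv by (simp add: mult_inv_cancel)
qed

lemma conj_a:
  assumes z: "z \<in> center G"
  shows "inv a \<otimes> (nf j k l \<otimes> z) \<otimes> a = nf j (j + k) (k + l) \<otimes> z"
  using conj_a_pow[OF z subgroup.one_closed[OF A_subgroup], of 1 j k l] by (simp add: numeral_2_eq_2)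

lemma A_normal: "A \<lhd> G"
  unfolding normal_inv_iff
proof (intro conjI ballI A_subgroup)
  fix x u assume x: "x \<in> carrier G" and u: "u \<in> A"
  obtain i :: nat and v where v: "v \<in> A" "inv x = a [^] i \<otimes> v" using spanE[OF inv_closed[OF x]] by metis
  obtain j k z where z: "z \<in> center G" "u = nf j k 0 \<otimes> z" using u by (rule AE)
  have "x \<otimes> u \<otimes> inv x = nf j (i * j + k) (j * (i choose 2) + i * k + 0) \<otimes> z"
    using conj_a_pow[OF z(1) v(1), of i j k 0] x by (simp flip: v(2) z(2))
  then show "x \<otimes> u \<otimes> inv x \<in> A"
    using nf_A center_A z(1) subgroup.m_closed[OF A_subgroup] by auto
qed

lemma conj_c:
  assumes "x \<in> carrier G"
  shows "\<exists>i. inv x \<otimes> c \<otimes> x = c \<otimes> d [^] (i::nat) \<and> (x \<notin> A \<longrightarrow> \<not> p dvd i)"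
proof -
  obtain i :: nat and v where v: "v \<in> A" "x = a [^] i \<otimes> v" using spanE[OF assms] by metis
  have "inv x \<otimes> c \<otimes> x = c \<otimes> d [^] i"
    using conj_a_pow[OF subgroup.one_closed[OF center_subgroup] v(1), of i 0 1 0] by (simp add: v(2) nf_def)
  moreover have "x \<in> A" if "p dvd i"
    using that v a_pow_mem_A_iff subgroup.m_closed[OF A_subgroup] by simp
  ultimately show ?thesis by blast
qed

text \<open>An explicit form of G'; see \<open>derived_eq\<close>.\<close>

definition D :: "'a set" where
  "D = {nf 0 k l | k l. True}"

lemma D_subgroup: "subgroup D G"
proof (rule finite_mult_closed_subgroup[OF fin])
  show "\<one> \<in> D" unfolding D_def by (intro CollectI exI[of _ 0]) simp
  fix x y assume "x \<in> D" "y \<in> D"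
  then obtain k l k' l' where "x = nf 0 k l" "y = nf 0 k' l'" by (auto simp: D_def)
  then have "x \<otimes> y = nf 0 (k + k') (l + l')" by (simp add: nf_mult)
  then show "x \<otimes> y \<in> D" by (auto simp: D_def)
qed (auto simp: D_def)

lemma D_A: "D \<subseteq> A"
  by (auto simp: D_def nf_A)

lemma commutator_mem_D:
  assumes x: "x \<in> carrier G" and u: "u \<in> A"
  shows "\<exists>w\<in>D. u \<otimes> x = x \<otimes> (u \<otimes> w)"
proof -
  obtain i :: nat and v where v: "v \<in> A" "x = a [^] i \<otimes> v" using spanE[OF x] by metis
  obtain j k z where z: "z \<in> center G" "u = nf j k 0 \<otimes> z" using u by (rule AE)
  define w where "w = nf 0 (i * j) (j * (i choose 2) + i * k)"
  have w: "w \<in> D" by (auto simp: w_def D_def)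
  have zG: "z \<in> carrier G" "w \<in> carrier G" "u \<in> carrier G"
    using z(1) w D_A center_closed A_closed u by auto
  have "inv x \<otimes> u \<otimes> x = nf j k 0 \<otimes> w \<otimes> z"
    using conj_a_pow[OF z(1) v(1), of i j k 0] by (simp add: v(2) z(2) w_def nf_mult add.commute)
  also have "\<dots> = u \<otimes> w" using centerD(2)[OF z(1) zG(2)] zG by (simp add: z(2) m_assoc)
  finally have "x \<otimes> (inv x \<otimes> (u \<otimes> x)) = x \<otimes> (u \<otimes> w)" using x zG by (simp add: m_assoc)
  then show ?thesis using w x zG by (auto simp: mult_inv_cancel)
qed

lemma D_normal:
  assumes x: "x \<in> carrier G" and w: "w \<in> D"
  shows "x \<otimes> w \<otimes> inv x \<in> D"
proof -
  have wA: "w \<in> A" using w D_A by blast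
  obtain w' where w': "w' \<in> D" "w \<otimes> inv x = inv x \<otimes> (w \<otimes> w')"
    using commutator_mem_D[OF inv_closed[OF x] wA] by blast
  have "x \<otimes> w \<otimes> inv x = x \<otimes> (inv x \<otimes> (w \<otimes> w'))" using x A_closed[OF wA] by (simp add: m_assoc flip: w'(2))
  also have "\<dots> = w \<otimes> w'" using x w'(1) D_A A_closed wA by (simp add: mult_inv_cancel subsetD)
  finally show ?thesis using w w'(1) subgroup.m_closed[OF D_subgroup] by simp
qed

text \<open>Both products have the main part a^(i+j) u v and differ from it by elements of D, which
  is normal. This bounds G' from above.\<close>

lemma swap_mod_D:
  assumes x: "x \<in> carrier G" and y: "y \<in> carrier G"
  shows "\<exists>w\<in>D. x \<otimes> y = w \<otimes> (y \<otimes> x)"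
proof -
  obtain i :: nat and u where u: "u \<in> A" "x = a [^] i \<otimes> u" using spanE[OF x] by metis
  obtain j :: nat and v where v: "v \<in> A" "y = a [^] j \<otimes> v" using spanE[OF y] by metis
  have G: "u \<in> carrier G" "v \<in> carrier G" using u v A_closed by auto
  obtain w1 where w1: "w1 \<in> D" "u \<otimes> a [^] j = a [^] j \<otimes> (u \<otimes> w1)"
    using commutator_mem_D[OF nat_pow_closed[OF closed(1)] u(1)] by blast
  obtain w2 where w2: "w2 \<in> D" "v \<otimes> a [^] i = a [^] i \<otimes> (v \<otimes> w2)"
    using commutator_mem_D[OF nat_pow_closed[OF closed(1)] v(1)] by blast
  have wA: "w1 \<in> A" "w2 \<in> A" using w1 w2 D_A by auto
  have wG: "w1 \<in> carrier G" "w2 \<in> carrier G" using wA A_closed by auto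
  let ?s = "a [^] (i + j) \<otimes> (u \<otimes> v)"
  have "x \<otimes> y = a [^] i \<otimes> (u \<otimes> a [^] j) \<otimes> v" using G by (simp add: u(2) v(2) m_assoc)
  also have "\<dots> = a [^] (i + j) \<otimes> (u \<otimes> (w1 \<otimes> v))"
    unfolding w1(2) using G wG by (simp add: m_assoc left_assoc[OF nat_pow_mult])
  also have "\<dots> = ?s \<otimes> w1" using A_commute[OF wA(1) v(1)] G wG by (simp add: m_assoc)
  finally have xy: "x \<otimes> y = ?s \<otimes> w1" .
  have "y \<otimes> x = a [^] j \<otimes> (v \<otimes> a [^] i) \<otimes> u" using G by (simp add: u(2) v(2) m_assoc)
  also have "\<dots> = a [^] (i + j) \<otimes> (v \<otimes> (w2 \<otimes> u))"
    unfolding w2(2) using G wG by (simp add: m_assoc left_assoc[OF nat_pow_mult] add.commute)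
  also have "v \<otimes> (w2 \<otimes> u) = (u \<otimes> v) \<otimes> w2"
    using A_commute[OF wA(2) u(1)] A_commute[OF v(1) u(1)] G wG by (simp flip: m_assoc)
  finally have yx: "y \<otimes> x = ?s \<otimes> w2" using G wG by (simp add: m_assoc)
  let ?w = "?s \<otimes> (w1 \<otimes> inv w2) \<otimes> inv ?s"
  have s: "?s \<in> carrier G" using G by simp
  have "?w \<in> D" using D_normal[OF s] w1 w2 subgroup.m_closed[OF D_subgroup] subgroup.m_inv_closed[OF D_subgroup] by blast
  moreover have "?w \<otimes> (y \<otimes> x) = x \<otimes> y"
    unfolding xy yx using s wG by (simp add: m_assoc mult_inv_cancel del: inv_mult_group)
  ultimately show ?thesis by metis
qed

lemma derived_eq: "derived_subgroup G = D"
proof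
  have "derived_set G (carrier G) \<subseteq> D"
  proof
    fix g assume "g \<in> derived_set G (carrier G)"
    then obtain x y where xy: "x \<in> carrier G" "y \<in> carrier G" "g = x \<otimes> y \<otimes> inv x \<otimes> inv y" by auto
    obtain w where w: "w \<in> D" "x \<otimes> y = w \<otimes> (y \<otimes> x)" using swap_mod_D[OF xy(1,2)] by blast
    have wG: "w \<in> carrier G" using w(1) D_A A_closed by blast
    have "g = w \<otimes> (y \<otimes> x) \<otimes> inv x \<otimes> inv y" using xy w by simp
    also have "\<dots> = w" using xy wG by (simp add: m_assoc mult_inv_cancel)
    finally show "g \<in> D" using w(1) by simp
  qed
  then show "derived_subgroup G \<subseteq> D" unfolding derived_def by (rule generate_subgroup_incl[OF _ D_subgroup])
next
  have sub: "subgroup (derived_subgroup G) G" by (rule derived_is_subgroup) simp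
  have comm: "x \<in> derived_subgroup G" if "x \<in> carrier G" "u \<in> carrier G" "v \<in> carrier G" "u \<otimes> v = v \<otimes> u \<otimes> x" for x u v
  proof -
    \<comment> \<open>\<open>derived_set\<close> consists of the products x y x^-1 y^-1, so u^-1
      v^-1 u v is matched with x = u^-1 and y = v^-1.\<close>
    have "x = inv u \<otimes> inv v \<otimes> inv (inv u) \<otimes> inv (inv v)"
      using commutator_eqI[OF that(2,3,1,4)] that by (simp add: commutator_def)
    moreover have "inv u \<otimes> inv v \<otimes> inv (inv u) \<otimes> inv (inv v) \<in> derived_set G (carrier G)"
      using inv_closed[OF that(2)] inv_closed[OF that(3)] by blast
    ultimately show ?thesis unfolding derived_def by (auto intro: generate.incl)
  qed
  have "c \<in> derived_subgroup G" "d \<in> derived_subgroup G"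
    using comm[OF closed(3) closed(2) closed(1) ba] comm[OF closed(4) closed(3) closed(1) ca] by auto
  then have "nf 0 k l \<in> derived_subgroup G" for k l
    using subgroup.m_closed[OF sub] subgroup_int_pow_closed[OF sub, of _ "int _"]
    by (simp add: nf_def int_pow_int)
  then show "D \<subseteq> derived_subgroup G" by (auto simp: D_def)
qed

text \<open>Commuting with c alone already forces an element into A, because conjugation by an
  element outside A multiplies c by a nontrivial power of d.\<close>

lemma centralizer_derived_eq: "centralizer G (derived_subgroup G) = A"
proof
  show "A \<subseteq> centralizer G (derived_subgroup G)"
    unfolding derived_eq using A_commute A_closed D_A by (auto simp: centralizer_def)
  show "centralizer G (derived_subgroup G) \<subseteq> A"
  proof
    fix x assume "x \<in> centralizer G (derived_subgroup G)"
    moreover have "c \<in> D" using nf_gens(2) by (auto simp: D_def)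
    ultimately have x: "x \<in> carrier G" "x \<otimes> c = c \<otimes> x" unfolding derived_eq by (auto simp: centralizer_def)
    obtain i where i: "inv x \<otimes> c \<otimes> x = c \<otimes> d [^] (i::nat)" "x \<notin> A \<longrightarrow> \<not> p dvd i" using conj_c[OF x(1)] by blast
    have "inv x \<otimes> c \<otimes> x = inv x \<otimes> (x \<otimes> c)" using x(1) by (subst x(2)) (simp add: m_assoc)
    then have "c \<otimes> d [^] i = c \<otimes> \<one>"
      using i(1) mult_inv_cancel(2)[OF x(1) closed(3)] by (metis closed(3) r_one)
    then have "d [^] i = \<one>" by (metis closed l_cancel nat_pow_closed one_closed)
    then show "x \<in> A" using i(2) by (simp add: d_pow_one_iff)
  qed
qed

text \<open>The elements a^i b^j c^k z with i, j, k < p and z central represent G without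
  repetition. For order p^5 this yields a centre of order p^2.\<close>

lemma order_eq: "card (carrier G) = p ^ 3 * card (center G)"
proof -
  let ?f = "\<lambda>(i, j, k, z). a [^] (i::nat) \<otimes> (nf j k 0 \<otimes> z)"
  let ?S = "{..<p} \<times> {..<p} \<times> {..<p} \<times> center G"
  have p0: "p > 0" using p5 by simp
  have A1: "i = i'" if "a [^] i \<otimes> u = a [^] i' \<otimes> u'" "i < p" "i' < p" "u \<in> A" "u' \<in> A" "i \<le> i'" for i i' :: nat and u u'
  proof -
    obtain m where m: "i' = i + m" using \<open>i \<le> i'\<close> le_Suc_ex by blast
    have G: "u \<in> carrier G" "u' \<in> carrier G" using \<open>u \<in> A\<close> \<open>u' \<in> A\<close> A_closed by auto
    have "a [^] i \<otimes> u = a [^] i \<otimes> (a [^] m \<otimes> u')"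
      using that(1) m G by (simp add: nat_pow_mult flip: m_assoc)
    then have "u = a [^] m \<otimes> u'" using G by (metis closed(1) l_cancel m_closed nat_pow_closed)
    then have "a [^] m = u \<otimes> inv u'" using G by (simp add: m_assoc)
    then have "a [^] m \<in> A" using \<open>u \<in> A\<close> \<open>u' \<in> A\<close> subgroup.m_closed[OF A_subgroup] subgroup.m_inv_closed[OF A_subgroup] by simp
    then have "p dvd m" by (simp add: a_pow_mem_A_iff)
    then show ?thesis using m \<open>i' < p\<close> by (auto dest: dvd_imp_le)
  qed
  have A2: "j = j' \<and> k = k' \<and> z = z'"
    if eq: "nf j k 0 \<otimes> z = nf j' k' 0 \<otimes> z'" and lt: "j < p" "j' < p" "k < p" "k' < p" and z: "z \<in> center G" "z' \<in> center G" and le: "j \<le> j'"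
    for j k j' k' z z'
  proof -
    obtain m where m: "j' = j + m" using le le_Suc_ex by blast
    have G: "z \<in> carrier G" "z' \<in> carrier G" using z center_closed by auto
    have nz: "nf j k 0 = nf j 0 0 \<otimes> nf 0 k 0" "nf j' k' 0 = nf j 0 0 \<otimes> nf m k' 0" by (simp_all add: nf_mult m)
    have "nf j 0 0 \<otimes> (nf 0 k 0 \<otimes> z) = nf j 0 0 \<otimes> (nf m k' 0 \<otimes> z')"
      using eq G unfolding nz by (simp add: m_assoc)
    then have eq': "nf 0 k 0 \<otimes> z = nf m k' 0 \<otimes> z'"
      using l_cancel[of "nf j 0 0" "nf 0 k 0 \<otimes> z" "nf m k' 0 \<otimes> z'"] G by simp
    \<comment> \<open>Conjugation by a multiplies the two sides by d^k and by c^m d^k'. So c^m is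
      central, which gives m = 0 and then k = k'.\<close>
    have "inv a \<otimes> (nf 0 k 0 \<otimes> z) \<otimes> a = inv a \<otimes> (nf m k' 0 \<otimes> z') \<otimes> a" using eq' by simp
    then have "nf 0 k k \<otimes> z = nf m (m + k') k' \<otimes> z'"
      using conj_a[OF z(1), of 0 k 0] conj_a[OF z(2), of m k' 0] by simp
    moreover have "nf 0 k k \<otimes> z = d [^] k \<otimes> (nf 0 k 0 \<otimes> z)"
      using nf_mult[of 0 0 k 0 k 0] G by (simp add: nf_powers flip: m_assoc)
    moreover have "nf m (m + k') k' \<otimes> z' = (c [^] m \<otimes> d [^] k') \<otimes> (nf m k' 0 \<otimes> z')"
      using nf_mult[of 0 m k' m k' 0] G by (simp add: nf_powers nf_mult flip: m_assoc)
    ultimately have "d [^] k \<otimes> (nf m k' 0 \<otimes> z') = (c [^] m \<otimes> d [^] k') \<otimes> (nf m k' 0 \<otimes> z')" using eq' by simp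
    then have dk: "d [^] k = c [^] m \<otimes> d [^] k'" using G by (metis closed r_cancel m_closed nat_pow_closed nf_closed)
    then have "c [^] m = d [^] k \<otimes> inv (d [^] k')" by (simp add: m_assoc)
    then have "c [^] m \<in> center G"
      using d_pow_center subgroup.m_closed[OF center_subgroup] subgroup.m_inv_closed[OF center_subgroup] by simp
    then have "p dvd m" by (simp add: c_pow_center_iff)
    then have m0: "m = 0" using m lt(2) by (auto dest: dvd_imp_le)
    then have "d [^] k = d [^] k'" using dk by simp
    then have "k = k'" using lt by (simp add: d_pow_eq_iff)
    then show ?thesis using m0 m eq' G by (metis add.right_neutral l_cancel nf_closed)
  qed
  have inj: "inj_on ?f ?S"
  proof (rule inj_onI, clarsimp)
    fix i j k z i' j' k' z'
    assume h: "i < p" "j < p" "k < p" "z \<in> center G" "i' < p" "j' < p" "k' < p" "z' \<in> center G"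
      "a [^] i \<otimes> (nf j k 0 \<otimes> z) = a [^] i' \<otimes> (nf j' k' 0 \<otimes> z')"
    have G: "nf j k 0 \<otimes> z \<in> carrier G" "nf j' k' 0 \<otimes> z' \<in> carrier G" using h(4,8) center_closed by auto
    have i: "i = i'"
      using A1[OF h(9,1,5) AI[OF h(4)] AI[OF h(8)]] A1[OF h(9)[symmetric] h(5,1) AI[OF h(8)] AI[OF h(4)]]
      by (cases "i \<le> i'") auto
    then have "nf j k 0 \<otimes> z = nf j' k' 0 \<otimes> z'"
      using h(9) G l_cancel[of "a [^] i" "nf j k 0 \<otimes> z" "nf j' k' 0 \<otimes> z'"] by simp
    then show "i = i' \<and> j = j' \<and> k = k' \<and> z = z'"
      using i A2[of j k z j' k' z'] A2[of j' k' z' j k z] h by (cases "j \<le> j'") auto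
  qed
  have img: "?f ` ?S = carrier G"
  proof (intro subset_antisym subsetI)
    fix x assume "x \<in> carrier G"
    then obtain i j k :: nat and z where x: "z \<in> center G" "x = a [^] i \<otimes> (nf j k 0 \<otimes> z)"
      using span[of x] by metis
    define y where "y = (a [^] p) [^] (i div p)"
    define w where "w = (b [^] p) [^] (j div p)"
    have yw: "y \<in> center G" "w \<in> center G" unfolding y_def w_def using a_pow b_pow center_pow by auto
    have G: "y \<in> carrier G" "w \<in> carrier G" "z \<in> carrier G" using yw x(1) center_closed by auto
    have ai: "a [^] i = a [^] (i mod p) \<otimes> y" unfolding y_def by (rule nat_pow_mod) simp
    have "b [^] j = b [^] (j mod p) \<otimes> w" unfolding w_def by (rule nat_pow_mod) simp
    moreover have "c [^] k = c [^] (k mod p)" using c_pow by (intro nat_pow_eq_pow_mod) auto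
    ultimately have "nf j k 0 = b [^] (j mod p) \<otimes> (w \<otimes> c [^] (k mod p))" using G by (simp add: nf_def m_assoc)
    then have nf: "nf j k 0 = nf (j mod p) (k mod p) 0 \<otimes> w"
      using centerD(2)[OF yw(2), of "c [^] (k mod p)"] G by (simp add: nf_def m_assoc)
    have "x = a [^] (i mod p) \<otimes> (y \<otimes> (nf (j mod p) (k mod p) 0 \<otimes> (w \<otimes> z)))"
      using G by (simp add: x(2) ai nf m_assoc)
    also have "\<dots> = a [^] (i mod p) \<otimes> (nf (j mod p) (k mod p) 0 \<otimes> (w \<otimes> z \<otimes> y))"
      using G centerD(2)[OF yw(1), of "nf (j mod p) (k mod p) 0 \<otimes> (w \<otimes> z)"] by (simp add: m_assoc)
    finally have "x = ?f (i mod p, j mod p, k mod p, w \<otimes> z \<otimes> y)" by simp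
    moreover have "w \<otimes> z \<otimes> y \<in> center G" using yw x(1) center_mult by blast
    ultimately show "x \<in> ?f ` ?S" using p0
      by (intro image_eqI[of _ _ "(i mod p, j mod p, k mod p, w \<otimes> z \<otimes> y)"]) auto
  next
    fix x assume "x \<in> ?f ` ?S"
    then obtain i j k :: nat and z where "z \<in> center G" "x = a [^] i \<otimes> (nf j k 0 \<otimes> z)" by clarsimp
    then show "x \<in> carrier G" using center_closed by simp
  qed
  have "card (carrier G) = card ?S" using card_image[OF inj] by (simp only: img)
  then show ?thesis by (simp add: card_cartesian_product power3_eq_cube)
qed

end

subsection \<open>Characters of these groups\<close>

lemma zeta_power: "zeta n ^ k = cis (2 * pi * real k / real n)"
  by (simp add: zeta_def DeMoivre algebra_simps)

lemma zeta_power_self: "n > 0 \<Longrightarrow> zeta n ^ n = 1"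
  by (simp add: zeta_power)

lemma zeta_power_neq_one:
  assumes "0 < k" "k < n"
  shows "zeta n ^ k \<noteq> 1"
proof
  assume "zeta n ^ k = 1"
  then have "cis (2 * pi * real k / real n) = cis (2 * pi * real 0 / real n)" by (simp add: zeta_power)
  moreover have "inj_on (\<lambda>k. cis (2 * pi * real k / real n)) {..<n}"
    using bij_betw_roots_unity[of n] assms by (simp add: bij_betw_def)
  ultimately have "k = 0" using assms by (metis (mono_tags, lifting) inj_onD lessThan_iff less_trans)
  then show False using assms by simp
qed

lemma zeta_power_sum:
  assumes "t < n"
  shows "(\<Sum>i<n. zeta n ^ (i * t)) = (if t = 0 then of_nat n else 0)"
proof (cases "t = 0")
  case False
  then have "zeta n ^ t \<noteq> 1" using zeta_power_neq_one assms by simp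
  moreover have "(zeta n ^ t) ^ n = 1"
    using zeta_power_self[of n] assms by (simp add: power_mult[symmetric] mult.commute) (simp add: power_mult)
  ultimately have "(\<Sum>i<n. (zeta n ^ t) ^ i) = 0" by (simp add: geometric_sum)
  then show ?thesis using False by (simp add: power_mult[symmetric] mult.commute)
qed simp

lemma mult_vec_sum:
  fixes M :: "complex mat"
  assumes "M \<in> carrier_mat n n" "\<And>t. u t \<in> carrier_vec n" "i < n"
  shows "(M *\<^sub>v vec n (\<lambda>j. \<Sum>t\<in>S. \<alpha> t * u t $ j)) $ i = (\<Sum>t\<in>S. \<alpha> t * (M *\<^sub>v u t) $ i)"
proof -
  have "(M *\<^sub>v vec n (\<lambda>j. \<Sum>t\<in>S. \<alpha> t * u t $ j)) $ i
      = (\<Sum>k<n. \<Sum>t\<in>S. \<alpha> t * (M $$ (i, k) * u t $ k))"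
    using assms(1,3) by (simp add: scalar_prod_def lessThan_atLeast0 sum_distrib_left algebra_simps)
  also have "\<dots> = (\<Sum>t\<in>S. \<alpha> t * (\<Sum>k<n. M $$ (i, k) * u t $ k))"
    by (subst sum.swap) (simp add: sum_distrib_left)
  also have "\<dots> = (\<Sum>t\<in>S. \<alpha> t * (M *\<^sub>v u t) $ i)"
  proof (rule sum.cong[OF refl])
    fix t
    show "\<alpha> t * (\<Sum>k<n. M $$ (i, k) * u t $ k) = \<alpha> t * (M *\<^sub>v u t) $ i"
      using assms(1,3) carrier_vecD[OF assms(2)[of t]] by (simp add: scalar_prod_def lessThan_atLeast0)
  qed
  finally show ?thesis .
qed

(* The \<gamma>-eigenspaces of C are the images of the discrete Fourier transforms of the powers of C. *)
lemma common_eigenvector: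
  fixes B C :: "complex mat"
  assumes B: "B \<in> carrier_mat n n" and C: "C \<in> carrier_mat n n" and n: "n > 0" and comm: "B * C = C * B"
    and p: "p > 0" and Cp: "C ^\<^sub>m p = 1\<^sub>m n"
  shows "\<exists>v \<beta> \<gamma>. v \<in> carrier_vec n \<and> v \<noteq> 0\<^sub>v n \<and> B *\<^sub>v v = \<beta> \<cdot>\<^sub>v v \<and> C *\<^sub>v v = \<gamma> \<cdot>\<^sub>v v"
proof -
  obtain \<beta> v where v: "v \<in> carrier_vec n" "v \<noteq> 0\<^sub>v n" "B *\<^sub>v v = \<beta> \<cdot>\<^sub>v v"
    using exists_eigenvector[OF B n] by blast
  let ?z = "zeta p"
  define u where "u t = C ^\<^sub>m t *\<^sub>v v" for t
  have Ct: "C ^\<^sub>m t \<in> carrier_mat n n" for t using C by (rule pow_carrier_mat)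
  have u: "u t \<in> carrier_vec n" for t unfolding u_def using Ct v(1) by (rule mult_mat_vec_carrier)
  have CC: "C * C ^\<^sub>m t = C ^\<^sub>m t * C" for t
  proof (induction t)
    case (Suc t)
    have "C * C ^\<^sub>m Suc t = (C * C ^\<^sub>m t) * C" using C Ct[of t] by (simp add: assoc_mult_mat[of _ n n _ n _ n])
    then show ?case using Suc by simp
  qed (use C in simp)
  have BC: "B * C ^\<^sub>m t = C ^\<^sub>m t * B" for t
  proof (induction t)
    case (Suc t)
    have "B * C ^\<^sub>m Suc t = (B * C ^\<^sub>m t) * C" using B C Ct[of t] by (simp add: assoc_mult_mat[of _ n n _ n _ n])
    also have "\<dots> = C ^\<^sub>m t * (B * C)" unfolding Suc using B C Ct[of t] by (simp add: assoc_mult_mat[of _ n n _ n _ n])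
    also have "\<dots> = C ^\<^sub>m Suc t * B" unfolding comm using B C Ct[of t] by (simp add: assoc_mult_mat[of _ n n _ n _ n])
    finally show ?case .
  qed (use B C in simp)
  have Bu: "B *\<^sub>v u t = \<beta> \<cdot>\<^sub>v u t" for t
  proof -
    have "B *\<^sub>v u t = (C ^\<^sub>m t * B) *\<^sub>v v" using B Ct[of t] v(1) by (simp add: u_def flip: BC)
    also have "\<dots> = C ^\<^sub>m t *\<^sub>v (\<beta> \<cdot>\<^sub>v v)" using B Ct[of t] v by simp
    finally show ?thesis using mult_mat_vec[OF Ct v(1)] by (simp add: u_def)
  qed
  have Cu: "C *\<^sub>v u t = u (Suc t)" for t
  proof -
    have "C *\<^sub>v u t = (C * C ^\<^sub>m t) *\<^sub>v v" unfolding u_def by (rule assoc_mult_mat_vec[OF C Ct v(1), symmetric])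
    then show ?thesis by (simp add: CC u_def)
  qed
  have up: "u p = u 0" using Cp C v(1) by (simp add: u_def)
  \<comment> \<open>Up to the factor p, the projection of v to the eigenspace of C for zeta^(-i).
    These vectors remain in the beta-eigenspace of B, since B commutes with C, and they sum to p v,
    so one of them is nonzero.\<close>
  define w where "w i = vec n (\<lambda>j. \<Sum>t<p. ?z ^ (i * t) * u t $ j)" for i
  have w: "w i \<in> carrier_vec n" for i by (simp add: w_def)
  have "\<exists>i<p. w i \<noteq> 0\<^sub>v n"
  proof (rule ccontr)
    assume "\<not> ?thesis"
    then have 0: "w i = 0\<^sub>v n" if "i < p" for i using that by blast
    have "v $ j = 0" if j: "j < n" for j
    proof -
      have "0 = (\<Sum>i<p. w i $ j)" using 0 j by simp
      also have "\<dots> = (\<Sum>t<p. (\<Sum>i<p. ?z ^ (i * t)) * u t $ j)"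
        using j by (simp add: w_def sum_distrib_right) (rule sum.swap)
      also have "\<dots> = (\<Sum>t<p. if t = 0 then of_nat p * u 0 $ j else 0)"
        by (rule sum.cong[OF refl]) (simp add: zeta_power_sum)
      also have "\<dots> = of_nat p * v $ j" using p C v(1) by (simp add: u_def)
      finally show ?thesis using p by simp
    qed
    then show False using v(1,2) by (auto simp: vec_eq_iff)
  qed
  then obtain i where i: "i < p" "w i \<noteq> 0\<^sub>v n" by blast
  have "B *\<^sub>v w i = \<beta> \<cdot>\<^sub>v w i"
  proof (rule eq_vecI)
    fix j assume "j < dim_vec (\<beta> \<cdot>\<^sub>v w i)"
    then have j: "j < n" by (simp add: w_def)
    have "(B *\<^sub>v w i) $ j = (\<Sum>t<p. ?z ^ (i * t) * (\<beta> * u t $ j))"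
      unfolding w_def mult_vec_sum[OF B u j] Bu using j carrier_vecD[OF u] by simp
    then show "(B *\<^sub>v w i) $ j = (\<beta> \<cdot>\<^sub>v w i) $ j" using j by (simp add: w_def sum_distrib_left algebra_simps)
  qed (use B w in \<open>simp add: w_def\<close>)
  moreover have "C *\<^sub>v w i = inverse (?z ^ i) \<cdot>\<^sub>v w i"
  proof (rule eq_vecI)
    fix j assume "j < dim_vec (inverse (?z ^ i) \<cdot>\<^sub>v w i)"
    then have j: "j < n" by (simp add: w_def)
    define g where "g t = ?z ^ (i * t) * u t $ j" for t
    have z0: "?z ^ i \<noteq> 0" by (simp add: zeta_def)
    have "?z ^ (i * p) = 1" using zeta_power_self[OF p] by (metis mult.commute power_mult power_one)
    then have "g p = g 0" by (simp add: g_def up)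
    then have shift: "(\<Sum>t<p. g (Suc t)) = (\<Sum>t<p. g t)"
      using sum.lessThan_Suc_shift[of g p] by simp
    have "?z ^ i * (C *\<^sub>v w i) $ j = (\<Sum>t<p. g (Suc t))"
      unfolding w_def mult_vec_sum[OF C u j] Cu g_def by (simp add: sum_distrib_left power_add mult.assoc)
    also have "\<dots> = w i $ j" unfolding shift using j by (simp add: w_def g_def)
    finally show "(C *\<^sub>v w i) $ j = (inverse (?z ^ i) \<cdot>\<^sub>v w i) $ j"
      using z0 j by (simp add: w_def field_simps)
  qed (use C w in \<open>simp add: w_def\<close>)
  ultimately show ?thesis using w i(2) by blast
qed

section \<open>Nonlinear characters and their fields of values\<close>

context phi3
begin

lemma conj_b:
  assumes "x \<in> carrier G"
  shows "\<exists>i l. inv x \<otimes> b \<otimes> x = nf 1 i l \<and> (x \<notin> A \<longrightarrow> \<not> p dvd i)"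
proof -
  obtain i :: nat and v where v: "v \<in> A" "x = a [^] i \<otimes> v" using spanE[OF assms] by metis
  have "inv x \<otimes> b \<otimes> x = nf 1 i (i choose 2)"
    using conj_a_pow[OF subgroup.one_closed[OF center_subgroup] v(1), of i 1 0 0] nf_gens(1) by (simp add: v(2))
  moreover have "x \<in> A" if "p dvd i"
    using that v a_pow_mem_A_iff subgroup.m_closed[OF A_subgroup] by simp
  ultimately show ?thesis by blast
qed

text \<open>For a linear character of A this means that G' is not in the kernel, by
  \<open>trivial_on_derived_iff\<close>. Extensionality is left out so that eigenvalue functions are
  covered.\<close>

definition nontrivial_on_derived :: "('a \<Rightarrow> complex) \<Rightarrow> bool" where
  "nontrivial_on_derived \<psi> \<longleftrightarrow> linear_character (subgroup_monoid G A) \<psi> \<and> (\<psi> c \<noteq> 1 \<or> \<psi> d \<noteq> 1)"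

lemma char_D_values:
  assumes "linear_character (subgroup_monoid G A) \<psi>"
  shows "\<psi> (nf j k l) = \<psi> b ^ j * \<psi> c ^ k * \<psi> d ^ l" "\<psi> c ^ p = 1" "\<psi> d ^ p = 1"
proof -
  note L = linear_character_subgroup[OF is_group A_subgroup assms]
  have pw: "x [^] (i::nat) \<in> A" if "x \<in> A" for x i
    using that subgroup.one_closed[OF A_subgroup] subgroup.m_closed[OF A_subgroup] by (induction i) auto
  have "c [^] k \<otimes> d [^] l \<in> A" using pw gens_A subgroup.m_closed[OF A_subgroup] by simp
  then show "\<psi> (nf j k l) = \<psi> b ^ j * \<psi> c ^ k * \<psi> d ^ l"
    unfolding nf_def using L(2,5) pw gens_A by simp
  show "\<psi> c ^ p = 1" "\<psi> d ^ p = 1"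
    using L(5)[OF gens_A(2), of p] L(5)[OF gens_A(3), of p] L(1) c_pow d_pow by simp_all
qed

lemma trivial_on_derived_iff:
  assumes "linear_character (subgroup_monoid G A) \<psi>"
  shows "(\<forall>w\<in>D. \<psi> w = 1) \<longleftrightarrow> \<psi> c = 1 \<and> \<psi> d = 1"
proof
  have "c \<in> D" "d \<in> D" using nf_gens(2,3) by (auto simp: D_def)
  then show "\<psi> c = 1 \<and> \<psi> d = 1" if "\<forall>w\<in>D. \<psi> w = 1" using that by blast
qed (use char_D_values(1)[OF assms, of 0] in \<open>auto simp: D_def\<close>)

lemma power_neq_one:
  fixes w :: complex
  assumes "w ^ p = 1" "w \<noteq> 1" "\<not> p dvd i"
  shows "w ^ i \<noteq> 1"
  using power_prime_power_eq_one[OF prime, of w 0 i] assms by auto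

text \<open>The stabiliser of psi in G is A. Conjugation by an element outside A multiplies psi(c)
  by a nontrivial power of psi(d) or, when psi(d) = 1, multiplies psi(b) by a nontrivial power of
  psi(c).\<close>

lemma separating:
  assumes \<psi>: "nontrivial_on_derived \<psi>" and x: "x \<in> carrier G" "x \<notin> A"
  shows "\<exists>u\<in>A. \<psi> (inv x \<otimes> u \<otimes> x) \<noteq> \<psi> u"
proof -
  have lc: "linear_character (subgroup_monoid G A) \<psi>" using \<psi> by (simp add: nontrivial_on_derived_def)
  note V = char_D_values[OF lc]
  note L = linear_character_subgroup[OF is_group A_subgroup lc]
  show ?thesis
  proof (cases "\<psi> d = 1")
    case False
    obtain i where i: "inv x \<otimes> c \<otimes> x = c \<otimes> d [^] (i::nat)" "\<not> p dvd i" using conj_c[OF x(1)] x(2) by blast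
    have "\<psi> (inv x \<otimes> c \<otimes> x) = \<psi> c * \<psi> d ^ i" using V(1)[of 0 1 i] i(1) by (simp add: nf_def)
    then have "\<psi> (inv x \<otimes> c \<otimes> x) \<noteq> \<psi> c" using power_neq_one[OF V(3) False i(2)] L(4)[OF gens_A(2)] by simp
    then show ?thesis using gens_A(2) by blast
  next
    case True
    then have c: "\<psi> c \<noteq> 1" using \<psi> by (simp add: nontrivial_on_derived_def)
    obtain i l where i: "inv x \<otimes> b \<otimes> x = nf 1 i l" "\<not> p dvd i" using conj_b[OF x(1)] x(2) by blast
    have "\<psi> (inv x \<otimes> b \<otimes> x) = \<psi> b * \<psi> c ^ i" using V(1)[of 1 i l] i(1) True by simp
    then have "\<psi> (inv x \<otimes> b \<otimes> x) \<noteq> \<psi> b" using power_neq_one[OF V(2) c i(2)] L(4)[OF gens_A(1)] by simp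
    then show ?thesis using gens_A(1) by blast
  qed
qed

lemma central_conj:
  assumes "x \<in> carrier G" "z \<in> center G"
  shows "inv x \<otimes> z \<otimes> x = z"
  using centerD(1)[OF assms(2)] centerD(2)[OF assms(2,1)] assms(1) by (simp add: m_assoc mult_inv_cancel)

lemma values_in_char_field:
  assumes \<psi>: "nontrivial_on_derived \<psi>" and \<kappa>: "\<kappa> \<noteq> 0" "\<And>F. csubfield F \<Longrightarrow> \<kappa> \<in> F"
    and \<chi>: "\<And>g. g \<in> carrier G \<Longrightarrow> \<chi> g = \<kappa> * induced_char G A \<psi> g"
    and alt: "\<psi> d \<noteq> 1 \<or> (\<forall>u\<in>A. \<exists>l. u [^] p = d [^] (l::nat))" and u: "u \<in> A"
  shows "\<psi> u \<in> char_field G \<chi>"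
proof -
  let ?F = "char_field G \<chi>"
  have F: "csubfield ?F" by (simp add: char_field_def csubfield_rat_adjoin)
  have lc: "linear_character (subgroup_monoid G A) \<psi>" using \<psi> by (simp add: nontrivial_on_derived_def)
  note V = char_D_values[OF lc]
  note L = linear_character_subgroup[OF is_group A_subgroup lc]
  \<comment> \<open>One nontrivial p-th root of unity in the field provides all of them.\<close>
  have gen: "w \<in> ?F" if z: "z \<in> ?F" "z ^ p = 1" "z \<noteq> 1" and w: "w ^ p = 1" for z w
    using root_of_unity_power[OF prime, of z 0 w] z w csubfield_power[OF F z(1)] by auto
  show ?thesis
  proof (cases "\<psi> d = 1")
    case False
    \<comment> \<open>As d is central, psi(d) can be read off from chi. It is a nontrivial p-th root
      of unity and brings psi(c) into the field; orthogonality over D, where c separates the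
      conjugates, then gives all values of psi.\<close>
    have dF: "\<psi> d \<in> ?F"
      by (rule invariant_value_in_char_field[OF A_normal fin \<kappa> \<chi> gens_A(3)]) (simp_all add: central_conj d_center)
    have cF: "\<psi> c \<in> ?F" using gen[OF dF V(3) False V(2)] .
    show ?thesis
    proof (rule value_in_char_field[OF A_normal fin \<kappa> \<chi> lc D_subgroup D_A _ _ A_commute u])
      fix w assume "w \<in> D"
      then show "\<psi> w \<in> ?F" using V(1)[of 0] csubfield_power[OF F cF] csubfield_power[OF F dF] csubfieldD(5)[OF F]
        by (auto simp: D_def)
    next
      fix x assume x: "x \<in> carrier G" "x \<notin> A"
      obtain i where i: "inv x \<otimes> c \<otimes> x = c \<otimes> d [^] (i::nat)" "\<not> p dvd i" using conj_c[OF x(1)] x(2) by blast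
      have "\<psi> (inv x \<otimes> c \<otimes> x) = \<psi> c * \<psi> d ^ i" using V(1)[of 0 1 i] i(1) by (simp add: nf_def)
      then have "\<psi> (inv x \<otimes> c \<otimes> x) \<noteq> \<psi> c" using power_neq_one[OF V(3) False i(2)] L(4)[OF gens_A(2)] by simp
      moreover have "c \<in> D" using nf_gens(2) by (auto simp: D_def)
      ultimately show "\<exists>w\<in>D. \<psi> (inv x \<otimes> w \<otimes> x) \<noteq> \<psi> w" by blast
    qed
  next
    case True
    then have c: "\<psi> c \<noteq> 1" using \<psi> by (simp add: nontrivial_on_derived_def)
    \<comment> \<open>With psi(d) = 1 the value psi(c) is invariant under conjugation and can be
      read off. Each psi(u) is then a p-th root of unity, because u^p is a power of d.\<close>
    have cF: "\<psi> c \<in> ?F"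
    proof (rule invariant_value_in_char_field[OF A_normal fin \<kappa> \<chi> gens_A(2)])
      fix x assume "x \<in> carrier G"
      then obtain i where "inv x \<otimes> c \<otimes> x = c \<otimes> d [^] (i::nat)" using conj_c by blast
      then show "\<psi> (inv x \<otimes> c \<otimes> x) = \<psi> c" using V(1)[of 0 1 i] True by (simp add: nf_def)
    qed
    obtain l where "u [^] p = d [^] (l::nat)" using alt True u by blast
    then have "\<psi> u ^ p = 1" using L(5)[OF u, of p] L(5)[OF gens_A(3), of l] True by simp
    then show ?thesis using gen[OF cF V(2) c] by blast
  qed
qed

text \<open>That the field of psi contains the field of the induced character is general;
  \<open>alt\<close> serves the opposite inclusion.\<close>

lemma required_pair_centralizer:
  assumes \<psi>: "\<psi> \<in> Irr_over (subgroup_monoid G A) D"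
    and alt: "\<psi> d \<noteq> 1 \<or> (\<forall>u\<in>A. \<exists>l. u [^] p = d [^] (l::nat))"
  shows "required_pair G (induced_char G A \<psi>) A \<psi>"
proof -
  let ?S = "subgroup_monoid G A" and ?\<chi> = "induced_char G A \<psi>"
  have S: "group ?S" using subgroup_imp_group[OF A_subgroup] .
  have lin: "\<psi> \<in> lin ?S"
    by (rule Irr_commutative[OF S]) (use A_commute \<psi> in \<open>auto simp: Irr_over_def\<close>)
  then have lc: "linear_character ?S \<psi>" using lin_iff[OF S] by blast
  have "\<exists>w\<in>D. \<psi> w \<noteq> 1"
    using \<psi> D_A linear_characterD(1)[OF lc] by (auto simp: Irr_over_def ker_char_def)
  then have nt: "nontrivial_on_derived \<psi>"
    using trivial_on_derived_iff[OF lc] lc by (auto simp: nontrivial_on_derived_def)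
  have "char_field ?S \<psi> \<subseteq> char_field G ?\<chi>"
    unfolding char_field_def[of ?S]
  proof (rule rat_adjoin_least)
    show "csubfield (char_field G ?\<chi>)" by (simp add: char_field_def csubfield_rat_adjoin)
    show "\<psi> ` carrier ?S \<subseteq> char_field G ?\<chi>"
      using values_in_char_field[OF nt, of 1 ?\<chi>] alt csubfieldD(1) by auto
  qed
  moreover have "char_field G ?\<chi> \<subseteq> char_field ?S \<psi>"
  proof (rule char_field_induced_le[OF A_normal, where \<psi> = \<psi> and c = 1])
    show F: "csubfield (char_field ?S \<psi>)" by (simp add: char_field_def csubfield_rat_adjoin)
    show "1 \<in> char_field ?S \<psi>" using csubfieldD(1)[OF F] .
    show "\<psi> u \<in> char_field ?S \<psi>" if "u \<in> A" for u using value_mem_char_field[of u ?S] that by simp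
  qed simp
  ultimately show ?thesis using A_subgroup lin by (simp add: required_pair_def)
qed

text \<open>A is generated by b, c and the centre. The centre acts by scalars, and b commutes with
  c, which has order p, so \<open>common_eigenvector\<close> provides one vector for all of
  A.\<close>

lemma irreducible_eigenvector:
  assumes irr: "irreducible_representation G n \<rho>"
  shows "\<exists>v \<psi>. v \<in> carrier_vec n \<and> v \<noteq> 0\<^sub>v n \<and> (\<forall>u\<in>A. \<rho> u *\<^sub>v v = \<psi> u \<cdot>\<^sub>v v)"
proof -
  note D = irreducible_representationD[OF irr]
  note R = representationD[OF is_group D(1)]
  have pow: "\<rho> (x [^] t) = \<rho> x ^\<^sub>m t" if "x \<in> carrier G" for x and t :: nat
  proof (induction t)
    case 0
    then show ?case using R(1)[OF that] R(3) by simp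
  qed (use that R in simp)
  have "\<rho> b * \<rho> c = \<rho> c * \<rho> b" using R(2)[of b c] R(2)[of c b] cb by simp
  moreover have "\<rho> c ^\<^sub>m p = 1\<^sub>m n" using pow[of c p] c_pow R(3) by simp
  ultimately obtain v \<beta> \<gamma> where v: "v \<in> carrier_vec n" "v \<noteq> 0\<^sub>v n" "\<rho> b *\<^sub>v v = \<beta> \<cdot>\<^sub>v v" "\<rho> c *\<^sub>v v = \<gamma> \<cdot>\<^sub>v v"
    using common_eigenvector[of "\<rho> b" n "\<rho> c" p] R(1) D(2) p5 by auto
  have eig_mult: "\<rho> (x \<otimes> y) *\<^sub>v v = (\<alpha> * \<beta>) \<cdot>\<^sub>v v"
    if "x \<in> carrier G" "y \<in> carrier G" "\<rho> x *\<^sub>v v = \<alpha> \<cdot>\<^sub>v v" "\<rho> y *\<^sub>v v = \<beta> \<cdot>\<^sub>v v" for x y \<alpha> \<beta>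
  proof -
    have "\<rho> (x \<otimes> y) *\<^sub>v v = \<rho> x *\<^sub>v (\<rho> y *\<^sub>v v)"
      using R(2)[OF that(1,2)] R(1)[OF that(1)] R(1)[OF that(2)] v(1) by simp
    then show ?thesis using that(3,4) R(1)[OF that(1)] v(1) by (simp add: mult_mat_vec smult_smult_assoc mult.commute)
  qed
  have eig_pow: "\<exists>\<gamma>. \<rho> (x [^] (t::nat)) *\<^sub>v v = \<gamma> \<cdot>\<^sub>v v" if x: "x \<in> carrier G" "\<rho> x *\<^sub>v v = \<alpha> \<cdot>\<^sub>v v" for x \<alpha> t
  proof (induction t)
    case 0
    show ?case using v(1) R(3) by (intro exI[of _ 1]) simp
  next
    case (Suc t)
    then show ?case using eig_mult[OF nat_pow_closed[OF x(1)] x(1) _ x(2)] by auto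
  qed
  have "\<exists>\<gamma>. \<rho> u *\<^sub>v v = \<gamma> \<cdot>\<^sub>v v" if u: "u \<in> A" for u
  proof -
    obtain j k z where z: "z \<in> center G" "u = nf j k 0 \<otimes> z" using u by (rule AE)
    obtain \<zeta> where "\<rho> z = \<zeta> \<cdot>\<^sub>m 1\<^sub>m n" using central_scalar[OF is_group irr z(1)] by blast
    then have "\<rho> z *\<^sub>v v = \<zeta> \<cdot>\<^sub>v v" using v(1) by (simp add: smult_mat_mult_vec[of _ n])
    moreover obtain \<beta>' where "\<rho> (b [^] j) *\<^sub>v v = \<beta>' \<cdot>\<^sub>v v" using eig_pow[OF closed(2) v(3)] by blast
    moreover obtain \<gamma>' where "\<rho> (c [^] k) *\<^sub>v v = \<gamma>' \<cdot>\<^sub>v v" using eig_pow[OF closed(3) v(4)] by blast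
    ultimately have "\<rho> (b [^] j \<otimes> c [^] k \<otimes> z) *\<^sub>v v = (\<beta>' * \<gamma>' * \<zeta>) \<cdot>\<^sub>v v"
      using center_closed[OF z(1)] by (intro eig_mult) auto
    then show ?thesis using z(2) by (auto simp: nf_def)
  qed
  then obtain \<psi> where "\<forall>u\<in>A. \<rho> u *\<^sub>v v = \<psi> u \<cdot>\<^sub>v v" by metis
  then show ?thesis using v(1,2) by blast
qed

text \<open>If psi were trivial on D, its eigenspace would be invariant under G, because ug and gu
  agree modulo D; so it would be everything. Then A acts by scalars, every element of G acts as a
  multiple of a power of rho a, and the matrices commute.\<close>

lemma eigenvector_nontrivial:
  assumes irr: "irreducible_representation G n \<rho>" and n: "n \<noteq> 1"
    and v: "v \<in> carrier_vec n" "v \<noteq> 0\<^sub>v n" "\<And>u. u \<in> A \<Longrightarrow> \<rho> u *\<^sub>v v = \<psi> u \<cdot>\<^sub>v v"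
  shows "nontrivial_on_derived \<psi>"
proof (rule ccontr)
  assume triv: "\<not> nontrivial_on_derived \<psi>"
  note R = irreducible_representationD[OF irr]
  note R1 = representationD[OF is_group R(1)]
  have lc: "linear_character (subgroup_monoid G A) \<psi>"
    using eigenvector_linear_character[OF is_group A_subgroup R(1), of v] v by blast
  note L = linear_character_subgroup[OF is_group A_subgroup lc]
  have triv_D: "\<psi> w = 1" if "w \<in> D" for w
    using triv lc trivial_on_derived_iff[OF lc] that by (auto simp: nontrivial_on_derived_def)
  let ?W = "{w \<in> carrier_vec n. \<forall>u\<in>A. \<rho> u *\<^sub>v w = \<psi> u \<cdot>\<^sub>v w}"
  have "?W = {0\<^sub>v n} \<or> ?W = carrier_vec n"
  proof (rule R(3))
    show "?W \<subseteq> carrier_vec n" by blast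
    have "\<rho> u *\<^sub>v 0\<^sub>v n = \<psi> u \<cdot>\<^sub>v 0\<^sub>v n" if "u \<in> A" for u using R1(1)[OF A_closed[OF that]] by auto
    then show "0\<^sub>v n \<in> ?W" by simp
  next
    fix x y assume xy: "x \<in> ?W" "y \<in> ?W"
    have "\<rho> u *\<^sub>v (x + y) = \<psi> u \<cdot>\<^sub>v (x + y)" if "u \<in> A" for u
      using xy that mult_add_distrib_mat_vec[OF R1(1)[OF A_closed[OF that]]] by (simp add: smult_add_distrib_vec[of _ n])
    then show "x + y \<in> ?W" using xy by simp
  next
    fix \<alpha> x assume x: "x \<in> ?W"
    have "\<rho> u *\<^sub>v (\<alpha> \<cdot>\<^sub>v x) = \<psi> u \<cdot>\<^sub>v (\<alpha> \<cdot>\<^sub>v x)" if "u \<in> A" for u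
      using x that mult_mat_vec[OF R1(1)[OF A_closed[OF that]]] by (simp add: smult_smult_assoc mult.commute)
    then show "\<alpha> \<cdot>\<^sub>v x \<in> ?W" using x by simp
  next
    fix g w assume g: "g \<in> carrier G" and w: "w \<in> ?W"
    have "\<rho> u *\<^sub>v (\<rho> g *\<^sub>v w) = \<psi> u \<cdot>\<^sub>v (\<rho> g *\<^sub>v w)" if u: "u \<in> A" for u
    proof -
      obtain y where y: "y \<in> D" "u \<otimes> g = g \<otimes> (u \<otimes> y)" using commutator_mem_D[OF g u] by blast
      have yA: "y \<in> A" using y(1) D_A by blast
      have uy: "u \<otimes> y \<in> A" using u yA subgroup.m_closed[OF A_subgroup] by blast
      have "\<rho> u *\<^sub>v (\<rho> g *\<^sub>v w) = \<rho> (u \<otimes> g) *\<^sub>v w"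
        using w R1(1)[OF g] R1(1)[OF A_closed[OF u]] R1(2)[OF A_closed[OF u] g] by simp
      also have "\<dots> = \<rho> g *\<^sub>v (\<rho> (u \<otimes> y) *\<^sub>v w)"
        unfolding y(2) using w R1(1)[OF g] R1(1)[OF A_closed[OF uy]] R1(2)[OF g A_closed[OF uy]] by simp
      also have "\<rho> (u \<otimes> y) *\<^sub>v w = \<psi> u \<cdot>\<^sub>v w" using w uy L(2)[OF u yA] triv_D[OF y(1)] by simp
      finally show ?thesis using w mult_mat_vec[OF R1(1)[OF g]] by simp
    qed
    then show "\<rho> g *\<^sub>v w \<in> ?W" using w R1(1)[OF g] by simp
  qed
  moreover have "v \<in> ?W" using v by blast
  ultimately have W: "?W = carrier_vec n" using v(2) by blast
  have scal: "\<rho> u = \<psi> u \<cdot>\<^sub>m 1\<^sub>m n" if u: "u \<in> A" for u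
  proof (rule eq_matI)
    fix i j assume ij: "i < dim_row (\<psi> u \<cdot>\<^sub>m 1\<^sub>m n)" "j < dim_col (\<psi> u \<cdot>\<^sub>m 1\<^sub>m n)"
    have "unit_vec n j \<in> ?W" by (subst W) simp
    then have "\<rho> u *\<^sub>v unit_vec n j = \<psi> u \<cdot>\<^sub>v unit_vec n j" using u by simp
    then have "(\<rho> u *\<^sub>v unit_vec n j) $ i = (\<psi> u \<cdot>\<^sub>v unit_vec n j) $ i" by simp
    then show "\<rho> u $$ (i, j) = (\<psi> u \<cdot>\<^sub>m 1\<^sub>m n) $$ (i, j)" using ij R1(1)[OF A_closed[OF u]] by auto
  qed (use R1(1)[OF A_closed[OF u]] in auto)
  have form: "\<exists>i \<alpha>. \<rho> g = \<alpha> \<cdot>\<^sub>m \<rho> (a [^] (i::nat))" if g: "g \<in> carrier G" for g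
  proof -
    obtain i :: nat and u where u: "u \<in> A" "g = a [^] i \<otimes> u" using spanE[OF g] by metis
    have "\<rho> g = \<psi> u \<cdot>\<^sub>m \<rho> (a [^] i)"
      using R1(2)[of "a [^] i" u] A_closed[OF u(1)] R1(1)[of "a [^] i"] scal[OF u(1)]
      by (simp add: u(2) mult_smult_distrib[of _ n n _ n])
    then show ?thesis by blast
  qed
  have "n = 1"
  proof (rule irreducible_commuting_degree[OF is_group irr])
    fix g h assume "g \<in> carrier G" "h \<in> carrier G"
    then obtain i j :: nat and \<alpha> \<beta> where gh: "\<rho> g = \<alpha> \<cdot>\<^sub>m \<rho> (a [^] i)" "\<rho> h = \<beta> \<cdot>\<^sub>m \<rho> (a [^] j)"
      using form by metis
    have car: "\<rho> (a [^] i) \<in> carrier_mat n n" "\<rho> (a [^] j) \<in> carrier_mat n n" using R1(1) by auto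
    have "\<rho> (a [^] i) * \<rho> (a [^] j) = \<rho> (a [^] j) * \<rho> (a [^] i)"
      by (simp add: nat_pow_mult add.commute flip: R1(2))
    then show "\<rho> g * \<rho> h = \<rho> h * \<rho> g"
      unfolding gh using car
      by (simp add: mult_smult_distrib[of _ n n _ n] mult_smult_assoc_mat[of _ n n _ n] smult_smult_mat mult.commute)
  qed
  then show False using n by simp
qed

text \<open>The multiplier comes from \<open>character_of_eigenvector\<close>. Being nonzero and in
  every subfield is the form in which it enters the arguments about fields and kernels.\<close>

lemma nl_multiple_of_induced:
  assumes \<chi>: "\<chi> \<in> nl G"
  shows "\<exists>\<psi> \<kappa>. nontrivial_on_derived \<psi> \<and> \<kappa> \<noteq> 0 \<and> (\<forall>F. csubfield F \<longrightarrow> \<kappa> \<in> F) \<and>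
    (\<forall>g\<in>carrier G. \<chi> g = \<kappa> * induced_char G A \<psi> g)"
proof -
  obtain n \<rho> where \<rho>: "irreducible_representation G n \<rho>" "\<chi> = character_of G n \<rho>"
    using \<chi> by (auto simp: nl_def elim: IrrE)
  note D = irreducible_representationD[OF \<rho>(1)]
  have n: "n \<noteq> 1" using \<chi> \<rho>(2) character_one[OF is_group D(1)] by (auto simp: nl_def)
  obtain v \<psi> where v: "v \<in> carrier_vec n" "v \<noteq> 0\<^sub>v n" "\<And>u. u \<in> A \<Longrightarrow> \<rho> u *\<^sub>v v = \<psi> u \<cdot>\<^sub>v v"
    using irreducible_eigenvector[OF \<rho>(1)] by blast
  have nt: "nontrivial_on_derived \<psi>" by (rule eigenvector_nontrivial[OF \<rho>(1) n v])
  let ?\<kappa> = "of_nat n * of_nat (card A) / of_nat (card (carrier G)) :: complex"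
  have "card A \<noteq> 0" "card (carrier G) \<noteq> 0"
    using fin finite_subset[OF subgroup.subset[OF A_subgroup] fin] subgroup.one_closed[OF A_subgroup]
    by (metis card_0_eq empty_iff one_closed)+
  then have "?\<kappa> \<noteq> 0" using D(2) by simp
  moreover have "?\<kappa> \<in> F" if "csubfield F" for F
    using that by (intro csubfield_divide csubfieldD(5) csubfield_of_nat)
  moreover have "\<chi> g = ?\<kappa> * induced_char G A \<psi> g" if "g \<in> carrier G" for g
    unfolding \<rho>(2) by (rule character_of_eigenvector[OF A_normal fin \<rho>(1) v separating[OF nt] that])
  ultimately show ?thesis using nt by blast
qed

lemma d_in_ker_iff:
  assumes \<psi>: "nontrivial_on_derived \<psi>" and \<kappa>: "\<kappa> \<noteq> 0"
    and \<chi>: "\<And>g. g \<in> carrier G \<Longrightarrow> \<chi> g = \<kappa> * induced_char G A \<psi> g"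
  shows "d \<in> ker_char G \<chi> \<longleftrightarrow> \<psi> d = 1"
proof -
  have lc: "linear_character (subgroup_monoid G A) \<psi>" using \<psi> by (simp add: nontrivial_on_derived_def)
  note L = linear_character_subgroup[OF is_group A_subgroup lc]
  have val: "\<chi> z = \<kappa> * (of_nat (card (carrier G)) / of_nat (card A)) * \<psi> z" if z: "z \<in> center G" for z
    using \<chi>[OF center_closed[OF z]] induced_char_normal(1)[OF A_normal center_closed[OF z], of \<psi>]
      center_A z central_conj[OF _ z] by auto
  have "card A \<noteq> 0" "card (carrier G) \<noteq> 0"
    using fin finite_subset[OF subgroup.subset[OF A_subgroup] fin] subgroup.one_closed[OF A_subgroup]
    by (metis card_0_eq empty_iff one_closed)+
  then show ?thesis
    using val[OF d_center] val[OF subgroup.one_closed[OF center_subgroup]] \<kappa> L(1) by (simp add: ker_char_def)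
qed

end

subsection \<open>Isoclinism and presentations\<close>

context phi3_relations
begin

text \<open>The collected words are the image of a set of p^3 m exponent vectors. When G has order
  p^3 m, this surjection is a bijection, whence the uniqueness in the second claim.\<close>

lemma normal_form_card:
  fixes p m s t :: nat
  assumes "finite (carrier G)" "generate G S = carrier G"
    "\<And>s. s \<in> S \<Longrightarrow> \<exists>(i::nat) j k l. s = a [^] i \<otimes> nf j k l"
    "a [^] p = d [^] s" "b [^] m = d [^] t" "c [^] p = \<one>" "d [^] p = \<one>" "p > 0" "m > 0"
  shows "card (carrier G) \<le> p ^ 3 * m"
    and "card (carrier G) = p ^ 3 * m \<Longrightarrow> i < p \<Longrightarrow> j < m \<Longrightarrow> k < p \<Longrightarrow> l < p \<Longrightarrow> i' < p \<Longrightarrow> j' < m \<Longrightarrow> k' < p \<Longrightarrow> l' < p \<Longrightarrow>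
      a [^] i \<otimes> nf j k l = a [^] i' \<otimes> nf j' k' l' \<Longrightarrow> i = i' \<and> j = j' \<and> k = k' \<and> l = l'"
proof -
  let ?f = "\<lambda>(i, j, k, l). a [^] (i::nat) \<otimes> nf j k l" and ?S = "{..<p} \<times> {..<m} \<times> {..<p} \<times> {..<p}"
  have img: "carrier G = ?f ` ?S" by (rule normal_form[OF assms])
  have cS: "card ?S = p ^ 3 * m" by (simp add: card_cartesian_product power3_eq_cube)
  show "card (carrier G) \<le> p ^ 3 * m" unfolding img cS[symmetric] by (rule card_image_le) simp
  assume "card (carrier G) = p ^ 3 * m"
  then have "card (?f ` ?S) = card ?S" by (simp only: cS flip: img)
  then have inj: "inj_on ?f ?S" by (rule eq_card_imp_inj_on[rotated]) simp
  assume "i < p" "j < m" "k < p" "l < p" "i' < p" "j' < m" "k' < p" "l' < p" "a [^] i \<otimes> nf j k l = a [^] i' \<otimes> nf j' k' l'"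
  then have "(i, j, k, l) = (i', j', k', l')" by (intro inj_onD[OF inj]) auto
  then show "i = i' \<and> j = j' \<and> k = k' \<and> l = l'" by simp
qed

text \<open>Shows that the generators of the presentations are collected words. A power of d appears
  because alpha_3 is d^r in \<open>Phi3_311b\<close>.\<close>

lemma gens_form:
  "\<exists>(i::nat) j k l. a = a [^] i \<otimes> nf j k l" "\<exists>(i::nat) j k l. b = a [^] i \<otimes> nf j k l"
  "\<exists>(i::nat) j k l. c = a [^] i \<otimes> nf j k l" "\<exists>(i::nat) j k l. d [^] (r::nat) = a [^] i \<otimes> nf j k l"
proof -
  have h: "a = a [^] (1::nat) \<otimes> nf 0 0 0" "b = a [^] (0::nat) \<otimes> nf 1 0 0" "c = a [^] (0::nat) \<otimes> nf 0 1 0"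
    "d [^] r = a [^] (0::nat) \<otimes> nf 0 0 r"
    by (simp_all add: nf_def)
  show "\<exists>(i::nat) j k l. a = a [^] i \<otimes> nf j k l" by (intro exI) (rule h(1))
  show "\<exists>(i::nat) j k l. b = a [^] i \<otimes> nf j k l" by (intro exI) (rule h(2))
  show "\<exists>(i::nat) j k l. c = a [^] i \<otimes> nf j k l" by (intro exI) (rule h(3))
  show "\<exists>(i::nat) j k l. d [^] r = a [^] i \<otimes> nf j k l" by (intro exI) (rule h(4))
qed

text \<open>Attaining the bound of \<open>normal_form_card\<close> makes normal forms unique and so
  separates d from 1; the other conditions are consequences of the relations.\<close>

lemma phi3I:
  fixes p m s t :: nat
  assumes p: "prime p" "p \<ge> 5" and gen: "generate G S = carrier G"
    and S: "\<And>s. s \<in> S \<Longrightarrow> \<exists>(i::nat) j k l. s = a [^] i \<otimes> nf j k l"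
    and rel: "a [^] p = d [^] s" "b [^] m = d [^] t" "c [^] p = \<one>" "d [^] p = \<one>" "m > 0"
    and card: "card (carrier G) = p ^ 3 * m"
  shows "phi3 G a b c d p"
proof -
  have p0: "p > 0" "p > 1" using p by auto
  have fin: "finite (carrier G)" using card p0 rel(5) by (metis card.infinite mult_eq_0_iff power_eq_0_iff less_not_refl)
  have nform: "\<exists>(i::nat) j k l. x = a [^] i \<otimes> nf j k l" if "x \<in> carrier G" for x
    using normal_form[OF fin gen S rel(1-4) p0(1) rel(5)] that by auto
  have centerI: "z \<in> center G" if z: "z \<in> carrier G" and za: "z \<otimes> a = a \<otimes> z" and zn: "\<And>j k l. z \<otimes> nf j k l = nf j k l \<otimes> z" for z
    unfolding centralizer_def
  proof (intro CollectI conjI ballI z)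
    fix x assume "x \<in> carrier G"
    then obtain i j k l where x: "x = a [^] (i::nat) \<otimes> nf j k l" using nform by metis
    have "z \<otimes> a [^] i = a [^] i \<otimes> z" using nat_pow_commute[OF z closed(1) za, of 1 i] z by simp
    then have "z \<otimes> x = a [^] i \<otimes> z \<otimes> nf j k l" using z by (simp add: x flip: m_assoc)
    also have "\<dots> = a [^] i \<otimes> (nf j k l \<otimes> z)" using z by (simp add: m_assoc flip: zn)
    finally show "z \<otimes> x = x \<otimes> z" using z by (simp add: x m_assoc)
  qed
  have d_center: "d \<in> center G"
    by (rule centerI[OF closed(4) da]) (use nf_commute[of 0 0 1] nf_gens(3) in auto)
  have d_pow_center: "d [^] (i::nat) \<in> center G" for i using center_pow[OF d_center] .
  show ?thesis
  proof
    show "prime p" "p \<ge> 5" "finite (carrier G)" "d \<in> center G" "c [^] p = \<one>" by fact+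
    show "a [^] p \<in> center G" using rel(1) d_pow_center by simp
    show "b [^] p \<in> center G"
    proof (rule centerI)
      have "b [^] p \<otimes> a = a \<otimes> nf p p 0" using nf_a[of p 0 0] by (simp add: nf_powers)
      then show "b [^] p \<otimes> a = a \<otimes> b [^] p" using rel(3) by (simp add: nf_def)
      show "b [^] p \<otimes> nf j k l = nf j k l \<otimes> b [^] p" for j k l by (simp only: nf_powers nf_commute)
    qed simp
    show "d \<noteq> \<one>"
    proof
      assume "d = \<one>"
      then have "nf 0 0 1 = nf 0 0 0" by (metis nf_gens(3) nf_zero)
      then have "a [^] (0::nat) \<otimes> nf 0 0 1 = a [^] (0::nat) \<otimes> nf 0 0 0" by simp
      then have "(1::nat) = 0"
        using normal_form_card(2)[OF fin gen S rel(1-4) p0(1) rel(5) card, of 0 0 0 1 0 0 0 0] p0 rel(5) by simp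
      then show False by simp
    qed
    fix x assume "x \<in> carrier G"
    then obtain i j k l where x: "x = a [^] (i::nat) \<otimes> nf j k l" using nform by metis
    have "x = a [^] i \<otimes> (nf j k 0 \<otimes> d [^] l)" by (simp add: x nf_def m_assoc)
    then show "\<exists>(i::nat) j k. \<exists>z\<in>center G. x = a [^] i \<otimes> (nf j k 0 \<otimes> z)" using d_pow_center by blast
  qed
qed

end

section \<open>Transfer of the structure along an isoclinism\<close>

lemma (in group) central_subgroup_normal:
  assumes "subgroup K G" "K \<subseteq> center G"
  shows "K \<lhd> G"
  unfolding normal_inv_iff
proof (intro conjI ballI assms(1))
  fix x h assume x: "x \<in> carrier G" and h: "h \<in> K"
  have hG: "h \<in> carrier G" "h \<otimes> x = x \<otimes> h" using centerD[of h] h assms(2) x by auto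
  have "x \<otimes> h \<otimes> inv x = h" using x hG(1) by (simp add: m_assoc flip: hG(2))
  then show "x \<otimes> h \<otimes> inv x \<in> K" using h by simp
qed

lemmas (in group) center_normal = central_subgroup_normal[OF center_subgroup subset_refl]

lemma (in group) commutator_in_derived:
  assumes "x \<in> carrier G" "y \<in> carrier G"
  shows "commutator G x y \<in> derived_subgroup G"
proof -
  have "commutator G x y = inv x \<otimes> inv y \<otimes> inv (inv x) \<otimes> inv (inv y)"
    using assms by (simp add: commutator_def)
  then have "commutator G x y \<in> derived_set G (carrier G)"
    using inv_closed[OF assms(1)] inv_closed[OF assms(2)] by blast
  then show ?thesis unfolding derived_def by (rule generate.incl)
qed

(* The relation x ~ y, meaning that the cosets of x and y correspond under \<phi>, respects products. *)
lemma isoclinic_phi3: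
  fixes H (structure)
  assumes iso: "isoclinic G H" and H: "phi3 H a b c d p" and finG: "finite (carrier G)"
  shows "\<exists>a b c d. phi3 G a b c d p"
proof -
  interpret H: phi3 H a b c d p by fact
  obtain \<phi> \<theta> where \<phi>: "\<phi> \<in> Group.iso (G Mod center G) (H Mod center H)"
    and \<theta>: "\<theta> \<in> Group.iso (subgroup_monoid G (derived_subgroup G)) (subgroup_monoid H (derived_subgroup H))"
    and comp: "\<And>x y x' y'. x \<in> carrier G \<Longrightarrow> y \<in> carrier G \<Longrightarrow> x' \<in> \<phi> (center G #>\<^bsub>G\<^esub> x) \<Longrightarrow>
        y' \<in> \<phi> (center G #>\<^bsub>G\<^esub> y) \<Longrightarrow> \<theta> (commutator G x y) = commutator H x' y'"
    and G: "group G"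
    using iso unfolding isoclinic_def by blast
  interpret G: group G by fact
  have ZG: "center G \<lhd> G"
    by (rule G.center_normal)
  have ZH: "center H \<lhd> H"
    by (rule H.center_normal)
  interpret ZG: normal "center G" G by fact
  interpret ZH: normal "center H" H by fact
  define sim where "sim x y \<longleftrightarrow> x \<in> carrier G \<and> y \<in> carrier H \<and> \<phi> (center G #>\<^bsub>G\<^esub> x) = center H #> y" for x y
  have \<phi>_hom: "\<phi> \<in> hom (G Mod center G) (H Mod center H)" and \<phi>_bij: "bij_betw \<phi> (carrier (G Mod center G)) (carrier (H Mod center H))"
    using \<phi> by (auto simp: Group.iso_def)
  have simD: "x \<in> carrier G" "y \<in> carrier H" "y \<in> \<phi> (center G #>\<^bsub>G\<^esub> x)" if "sim x y" for x y
    using that H.rcos_self[of y] H.center_subgroup by (auto simp: sim_def)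
  have sim_ex: "\<exists>x. sim x y" if y: "y \<in> carrier H" for y
  proof -
    have "center H #> y \<in> \<phi> ` carrier (G Mod center G)"
      using \<phi>_bij y by (auto simp: bij_betw_def carrier_FactGroup)
    then show ?thesis using y by (auto simp: sim_def carrier_FactGroup)
  qed
  have sim_mult: "sim (x \<otimes>\<^bsub>G\<^esub> x') (y \<otimes> y')" if "sim x y" "sim x' y'" for x y x' y'
  proof -
    have xy: "x \<in> carrier G" "x' \<in> carrier G" "y \<in> carrier H" "y' \<in> carrier H"
      "\<phi> (center G #>\<^bsub>G\<^esub> x) = center H #> y" "\<phi> (center G #>\<^bsub>G\<^esub> x') = center H #> y'"
      using that by (auto simp: sim_def)
    have "center G #>\<^bsub>G\<^esub> (x \<otimes>\<^bsub>G\<^esub> x') = (center G #>\<^bsub>G\<^esub> x) \<otimes>\<^bsub>G Mod center G\<^esub> (center G #>\<^bsub>G\<^esub> x')"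
      using xy by (simp add: ZG.rcos_sum)
    then have "\<phi> (center G #>\<^bsub>G\<^esub> (x \<otimes>\<^bsub>G\<^esub> x')) = (center H #> y) \<otimes>\<^bsub>H Mod center H\<^esub> (center H #> y')"
      using hom_mult[OF \<phi>_hom, of "center G #>\<^bsub>G\<^esub> x" "center G #>\<^bsub>G\<^esub> x'"] xy by (simp add: carrier_FactGroup)
    then show ?thesis using xy by (simp add: sim_def ZH.rcos_sum)
  qed
  have sim_one: "sim \<one>\<^bsub>G\<^esub> \<one>"
    using hom_one[OF \<phi>_hom ZG.factorgroup_is_group ZH.factorgroup_is_group] ZG.subset ZH.subset
    by (simp add: sim_def)
  have sim_pow: "sim (x [^]\<^bsub>G\<^esub> n) (y [^] n)" if "sim x y" for x y and n :: nat
    using that by (induction n) (auto simp: sim_one sim_mult)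
  have sim_center: "x \<in> center G \<longleftrightarrow> y \<in> center H" if xy: "sim x y" for x y
  proof -
    have G1: "x \<in> center G \<longleftrightarrow> center G #>\<^bsub>G\<^esub> x = center G"
      using simD(1)[OF xy] G.coset_join1[OF _ _ G.center_subgroup] G.coset_join2[OF _ G.center_subgroup] by blast
    have H1: "y \<in> center H \<longleftrightarrow> center H #> y = center H"
      using simD(2)[OF xy] H.coset_join1[OF _ _ H.center_subgroup] H.coset_join2[OF _ H.center_subgroup] by blast
    have one: "\<phi> (center G) = center H"
      using hom_one[OF \<phi>_hom ZG.factorgroup_is_group ZH.factorgroup_is_group] by simp
    have inj: "inj_on \<phi> (carrier (G Mod center G))" using \<phi>_bij by (simp add: bij_betw_def)
    have "center G \<in> carrier (G Mod center G)"
      using group.is_monoid[OF ZG.factorgroup_is_group] monoid.one_closed by fastforce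
    then have "\<phi> (center G #>\<^bsub>G\<^esub> x) = \<phi> (center G) \<longleftrightarrow> center G #>\<^bsub>G\<^esub> x = center G"
      using inj_on_eq_iff[OF inj] simD(1)[OF xy] by (simp add: carrier_FactGroup)
    then show ?thesis using G1 H1 one xy by (simp add: sim_def)
  qed
  have \<theta>_comm: "\<theta> (commutator G x x') = commutator H y y'" if "sim x y" "sim x' y'" for x x' y y'
    using comp simD that by metis
  have sim_cong: "sim (w \<otimes>\<^bsub>G\<^esub> z) y" if "sim w y" "z \<in> center G" for w z y
  proof -
    have wz: "w \<in> carrier G" "z \<in> carrier G" using simD(1) that G.centerD(1) by auto
    have "center G #>\<^bsub>G\<^esub> (w \<otimes>\<^bsub>G\<^esub> z) = center G #>\<^bsub>G\<^esub> z #>\<^bsub>G\<^esub> w"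
      using wz G.centerD(2)[OF that(2) wz(1)] ZG.subset by (simp add: G.coset_mult_assoc)
    also have "center G #>\<^bsub>G\<^esub> z = center G" using G.coset_join2[OF wz(2) G.center_subgroup that(2)] .
    finally show ?thesis using that(1) wz by (simp add: sim_def)
  qed
  have sim_inv: "sim (inv\<^bsub>G\<^esub> x) (inv y)" if xy: "sim x y" for x y
  proof -
    obtain w where w: "sim w (inv y)" using sim_ex[of "inv y"] simD(2)[OF xy] by auto
    have G': "x \<in> carrier G" "w \<in> carrier G" using simD(1) xy w by auto
    have "sim (x \<otimes>\<^bsub>G\<^esub> w) \<one>" using sim_mult[OF xy w] simD(2)[OF xy] by simp
    then have "x \<otimes>\<^bsub>G\<^esub> w \<in> center G" using sim_center subgroup.one_closed[OF H.center_subgroup] by blast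
    then have "inv\<^bsub>G\<^esub> (x \<otimes>\<^bsub>G\<^esub> w) \<in> center G" using subgroup.m_inv_closed[OF G.center_subgroup] by blast
    then have "sim (w \<otimes>\<^bsub>G\<^esub> inv\<^bsub>G\<^esub> (x \<otimes>\<^bsub>G\<^esub> w)) (inv y)" by (rule sim_cong[OF w])
    then show ?thesis using G' by (simp add: G.inv_mult_group G.mult_inv_cancel)
  qed
  have sim_comm: "sim (commutator G x x') (commutator H y y')" if "sim x y" "sim x' y'" for x y x' y'
    using that by (simp add: commutator_def sim_mult sim_inv)
  have sim_uniq: "\<exists>z\<in>center G. x = x' \<otimes>\<^bsub>G\<^esub> z" if "sim x y" "sim x' y" for x x' y
  proof -
    have G': "x \<in> carrier G" "x' \<in> carrier G" using simD(1) that by auto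
    have "sim (inv\<^bsub>G\<^esub> x' \<otimes>\<^bsub>G\<^esub> x) \<one>" using sim_mult[OF sim_inv[OF that(2)] that(1)] simD(2)[OF that(1)] by simp
    then have "inv\<^bsub>G\<^esub> x' \<otimes>\<^bsub>G\<^esub> x \<in> center G" using sim_center subgroup.one_closed[OF H.center_subgroup] by blast
    then show ?thesis using G' G.mult_inv_cancel(1)[of x' x] by metis
  qed
  let ?DG = "derived_subgroup G" and ?DH = "derived_subgroup H"
  have DG: "subgroup ?DG G" by (rule G.derived_is_subgroup) simp
  have DH: "subgroup ?DH H" by (rule H.derived_is_subgroup) simp
  have \<theta>_mult: "\<theta> (x \<otimes>\<^bsub>G\<^esub> y) = \<theta> x \<otimes> \<theta> y" if "x \<in> ?DG" "y \<in> ?DG" for x y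
    using \<theta> that by (auto simp: Group.iso_def dest: hom_mult)
  have \<theta>_one: "\<theta> \<one>\<^bsub>G\<^esub> = \<one>"
    using hom_one[of \<theta> "subgroup_monoid G ?DG" "subgroup_monoid H ?DH"] \<theta> G.subgroup_imp_group[OF DG] H.subgroup_imp_group[OF DH]
    by (simp add: Group.iso_def)
  have \<theta>_inj: "x = \<one>\<^bsub>G\<^esub>" if "x \<in> ?DG" "\<theta> x = \<one>" for x
  proof -
    have "inj_on \<theta> ?DG" using \<theta> by (simp add: Group.iso_def bij_betw_def)
    then show ?thesis using that \<theta>_one subgroup.one_closed[OF DG] by (metis inj_onD)
  qed
  have \<theta>_pow: "\<theta> (x [^]\<^bsub>G\<^esub> n) = \<theta> x [^] n \<and> x [^]\<^bsub>G\<^esub> n \<in> ?DG" if "x \<in> ?DG" for x and n :: nat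
    using that by (induction n) (auto simp: \<theta>_one \<theta>_mult subgroup.one_closed[OF DG] subgroup.m_closed[OF DG])
  obtain a' b' where ab: "sim a' a" "sim b' b" using sim_ex H.closed by metis
  \<comment> \<open>c' and d' are commutators in G and not arbitrary lifts, so that \<theta> maps
    them exactly to c and d. Relations inside G' are pulled back through the injective \<theta>,
    relations modulo the centre through \<open>sim\<close>.\<close>
  define c' where "c' = commutator G b' a'"
  define d' where "d' = commutator G c' a'"
  have G': "a' \<in> carrier G" "b' \<in> carrier G" using ab simD(1) by auto
  have cG: "c' \<in> carrier G" unfolding c'_def by (rule G.commutator_closed[OF G'(2,1)])
  have dG: "d' \<in> carrier G" unfolding d'_def by (rule G.commutator_closed[OF cG G'(1)])
  have c: "commutator H b a = c" by (rule H.commutator_eqI) (simp_all add: H.ba)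
  have d: "commutator H c a = d" by (rule H.commutator_eqI) (simp_all add: H.ca)
  have sc: "sim c' c" using sim_comm[OF ab(2,1)] by (simp add: c'_def c)
  have sd: "sim d' d" using sim_comm[OF sc ab(1)] by (simp add: d'_def d)
  have \<theta>c: "\<theta> c' = c" using \<theta>_comm[OF ab(2,1)] by (simp add: c'_def c)
  have \<theta>d: "\<theta> d' = d" using \<theta>_comm[OF sc ab(1)] by (simp add: d'_def d)
  have d'Z: "d' \<in> center G" using sim_center[OF sd] H.d_center by blast
  have "\<theta> (commutator G c' b') = \<one>"
    using \<theta>_comm[OF sc ab(2)] H.cb H.commutator_eq_one_iff[of c b] by simp
  then have "commutator G c' b' = \<one>\<^bsub>G\<^esub>" using \<theta>_inj G.commutator_in_derived[OF cG G'(2)] by blast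
  then have cb: "c' \<otimes>\<^bsub>G\<^esub> b' = b' \<otimes>\<^bsub>G\<^esub> c'" using G.commutator_eq_one_iff[OF cG G'(2)] by blast
  interpret P: phi3_relations G a' b' c' d'
    by unfold_locales
      (use G' cG dG cb G.commutator_swap[OF G'(2,1)] G.commutator_swap[OF cG G'(1)] G.centerD(2)[OF d'Z]
        in \<open>simp_all add: c'_def[symmetric] d'_def[symmetric]\<close>)
  have "phi3 G a' b' c' d' p"
  proof
    show "prime p" "p \<ge> 5" "finite (carrier G)" "d' \<in> center G" using H.prime H.p5 finG d'Z by auto
    show "d' \<noteq> \<one>\<^bsub>G\<^esub>" using \<theta>d \<theta>_one H.d_neq by metis
    have "\<theta> (c' [^]\<^bsub>G\<^esub> p) = \<one>" "c' [^]\<^bsub>G\<^esub> p \<in> ?DG"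
      using \<theta>_pow[of c' p] G.commutator_in_derived[OF G'(2,1)] \<theta>c H.c_pow by (auto simp: c'_def)
    then show "c' [^]\<^bsub>G\<^esub> p = \<one>\<^bsub>G\<^esub>" using \<theta>_inj by blast
    show "a' [^]\<^bsub>G\<^esub> p \<in> center G" "b' [^]\<^bsub>G\<^esub> p \<in> center G"
      using sim_center[OF sim_pow[OF ab(1)], of p] sim_center[OF sim_pow[OF ab(2)], of p] H.a_pow H.b_pow by auto
    fix x assume x: "x \<in> carrier G"
    then have "\<phi> (center G #>\<^bsub>G\<^esub> x) \<in> carrier (H Mod center H)"
      using hom_in_carrier[OF \<phi>_hom] by (simp add: carrier_FactGroup)
    then obtain y where y: "sim x y" using x by (auto simp: carrier_FactGroup sim_def)
    obtain i j k z where z: "z \<in> center H" "y = a [^] (i::nat) \<otimes> (H.nf j k 0 \<otimes> z)"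
      using H.span[OF simD(2)[OF y]] by metis
    let ?y = "a [^] i \<otimes> H.nf j k 0" and ?x = "a' [^]\<^bsub>G\<^esub> i \<otimes>\<^bsub>G\<^esub> P.nf j k 0"
    have zH: "z \<in> carrier H" using z(1) by (rule H.center_closed)
    have "center H #> y = center H #> (z \<otimes> ?y)"
      using zH H.centerD(2)[OF z(1), of ?y] by (simp add: z(2) H.m_assoc)
    also have "\<dots> = center H #> z #> ?y" using zH ZH.subset by (simp add: H.coset_mult_assoc)
    also have "center H #> z = center H" using H.coset_join2[OF zH H.center_subgroup z(1)] .
    finally have "sim x ?y" using y by (simp add: sim_def)
    moreover have "sim ?x ?y"
      unfolding H.nf_def P.nf_def by (intro sim_mult sim_pow ab sc sd)
    ultimately obtain z' where z': "z' \<in> center G" "x = ?x \<otimes>\<^bsub>G\<^esub> z'" using sim_uniq by blast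
    have "x = a' [^]\<^bsub>G\<^esub> i \<otimes>\<^bsub>G\<^esub> (P.nf j k 0 \<otimes>\<^bsub>G\<^esub> z')" using z' G.centerD(1)[OF z'(1)] G' by (simp add: G.m_assoc)
    then show "\<exists>(i::nat) j k. \<exists>z\<in>center G. x = a' [^]\<^bsub>G\<^esub> i \<otimes>\<^bsub>G\<^esub> (P.nf j k 0 \<otimes>\<^bsub>G\<^esub> z)" using z'(1) by blast
  qed
  then show ?thesis by blast
qed

text \<open>One scheme for the four presentations, so that a single order bound serves them all: (r,
  s, t, m) is (1, 0, 0, p) for order p^4, (r, 0, 1, p^2) for \<open>Phi3_311b\<close>, (1, 1, 0,
  p^2) for \<open>Phi3_221a\<close> and (1, 0, 0, p^2) for \<open>Phi3_2111e\<close>.\<close>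

definition phi3_sat :: "('a, 'b) monoid_scheme \<Rightarrow> (gen \<Rightarrow> 'a) \<Rightarrow> nat \<Rightarrow> nat \<Rightarrow> nat \<Rightarrow> nat \<Rightarrow> nat \<Rightarrow> bool" where
  "phi3_sat G x p r s t m \<longleftrightarrow> range x \<subseteq> carrier G \<and>
    commutator G (x Alpha1) (x Alpha) = x Alpha2 \<and> commutator G (x Alpha3) (x Alpha) = \<one>\<^bsub>G\<^esub> \<and>
    commutator G (x Alpha1) (x Alpha2) = \<one>\<^bsub>G\<^esub> \<and> commutator G (x Alpha1) (x Alpha3) = \<one>\<^bsub>G\<^esub> \<and>
    commutator G (x Alpha2) (x Alpha3) = \<one>\<^bsub>G\<^esub> \<and>
    commutator G (x Alpha2) (x Alpha) [^]\<^bsub>G\<^esub> r = x Alpha3 \<and> x Alpha [^]\<^bsub>G\<^esub> p = x Alpha3 [^]\<^bsub>G\<^esub> s \<and>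
    x Alpha1 [^]\<^bsub>G\<^esub> m = x Alpha3 [^]\<^bsub>G\<^esub> t \<and> x Alpha2 [^]\<^bsub>G\<^esub> p = \<one>\<^bsub>G\<^esub> \<and> x Alpha3 [^]\<^bsub>G\<^esub> p = \<one>\<^bsub>G\<^esub>"

lemma (in group) satisfies_rels_iff_phi3_sat:
  "satisfies_rels G x (Phi3_1111 p) \<longleftrightarrow> phi3_sat G x p 1 0 0 p"
  "satisfies_rels G x (Phi3_311b p r) \<longleftrightarrow> phi3_sat G x p r 0 1 (p\<^sup>2)"
  "satisfies_rels G x (Phi3_221a p) \<longleftrightarrow> phi3_sat G x p 1 1 0 (p\<^sup>2)"
  "satisfies_rels G x (Phi3_2111e p) \<longleftrightarrow> phi3_sat G x p 1 0 0 (p\<^sup>2)"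
proof -
  have "x v \<in> carrier G" if "range x \<subseteq> carrier G" for v using that by blast
  then have *: "x v [^] (1::nat) = x v" "commutator G (x v) (x w) [^] (1::nat) = commutator G (x v) (x w)"
    if "range x \<subseteq> carrier G" for v w using that commutator_closed by simp_all
  show "satisfies_rels G x (Phi3_1111 p) \<longleftrightarrow> phi3_sat G x p 1 0 0 p"
    using * unfolding satisfies_rels_def phi3_sat_def Phi3_1111_def Phi3_common_def by auto
  show "satisfies_rels G x (Phi3_311b p r) \<longleftrightarrow> phi3_sat G x p r 0 1 (p\<^sup>2)"
    using * unfolding satisfies_rels_def phi3_sat_def Phi3_311b_def Phi3_common_def by auto
  show "satisfies_rels G x (Phi3_221a p) \<longleftrightarrow> phi3_sat G x p 1 1 0 (p\<^sup>2)"
    using * unfolding satisfies_rels_def phi3_sat_def Phi3_221a_def Phi3_common_def by auto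
  show "satisfies_rels G x (Phi3_2111e p) \<longleftrightarrow> phi3_sat G x p 1 0 0 (p\<^sup>2)"
    using * unfolding satisfies_rels_def phi3_sat_def Phi3_2111e_def Phi3_common_def by auto
qed

(* The relation [\<alpha>2,\<alpha>]^r = \<alpha>3 only gives [\<alpha>2,\<alpha>] as a power of \<alpha>3 because the group is a p-group. *)
lemma (in group) phi3_sat_relations:
  assumes G: "p_group p G" and p: "prime p" and sat: "phi3_sat G x p r s t m" and r: "coprime r p"
  defines "\<delta> \<equiv> commutator G (x Alpha2) (x Alpha)"
  shows "phi3_relations G (x Alpha) (x Alpha1) (x Alpha2) \<delta>" "\<delta> [^] p = \<one>" "x Alpha3 = \<delta> [^] r"
    "\<delta> \<in> generate G {x Alpha3}"
proof -
  have C: "x v \<in> carrier G" for v using sat by (auto simp: phi3_sat_def)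
  have \<delta>: "\<delta> \<in> carrier G" unfolding \<delta>_def by (rule commutator_closed[OF C C])
  obtain k where k: "order G = p ^ k" using G by (auto simp: p_group_def)
  show dr: "x Alpha3 = \<delta> [^] r" using sat by (simp add: \<delta>_def phi3_sat_def)
  have "\<delta> [^] (r * p) = \<one>" using sat \<delta> dr by (simp add: phi3_sat_def flip: nat_pow_pow)
  then have "ord \<delta> dvd r * p" using \<delta> by (simp add: pow_eq_id)
  moreover have "coprime (ord \<delta>) r"
  proof -
    have "ord \<delta> dvd p ^ k" using ord_dvd_group_order[OF \<delta>] k by simp
    moreover have "coprime (p ^ k) r" using r by (simp add: coprime_commute)
    ultimately show ?thesis by (meson coprime_divisors dvd_refl)
  qed
  ultimately have "ord \<delta> dvd p" by (simp add: coprime_dvd_mult_right_iff)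
  then show \<delta>p: "\<delta> [^] p = \<one>" using \<delta> by (simp add: pow_eq_id)
  have "\<exists>s. \<delta> = x Alpha3 [^] (s::nat)"
  proof -
    have r0: "r \<noteq> 0" using r prime_gt_1_nat[OF p] by (intro notI) simp
    obtain s t where st: "r * s = p * t + 1" using bezout_nat[OF r0, of p] r by auto
    have "x Alpha3 [^] s = \<delta> [^] (p * t + 1)" using \<delta> by (simp add: nat_pow_pow st dr)
    also have "\<dots> = (\<delta> [^] p) [^] t \<otimes> \<delta>" using \<delta> by (simp add: nat_pow_pow)
    also have "\<dots> = \<delta>" using \<delta> \<delta>p by simp
    finally show ?thesis by metis
  qed
  then obtain s where s: "\<delta> = x Alpha3 [^] (s::nat)" ..
  have "x Alpha3 [^] n \<in> generate G {x Alpha3}" for n :: nat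
    by (induction n) (auto intro: generate.intros)
  then show "\<delta> \<in> generate G {x Alpha3}" by (subst s)
  have comm: "\<delta> \<otimes> y = y \<otimes> \<delta>" if "y \<in> carrier G" "x Alpha3 \<otimes> y = y \<otimes> x Alpha3" for y
    unfolding s using group_commutes_pow[OF that(2) C that(1)] .
  have eqs: "x Alpha3 \<otimes> x Alpha = x Alpha \<otimes> x Alpha3" "x Alpha1 \<otimes> x Alpha2 = x Alpha2 \<otimes> x Alpha1"
    "x Alpha1 \<otimes> x Alpha3 = x Alpha3 \<otimes> x Alpha1" "x Alpha2 \<otimes> x Alpha3 = x Alpha3 \<otimes> x Alpha2"
    "commutator G (x Alpha1) (x Alpha) = x Alpha2"
    using sat C by (simp_all add: phi3_sat_def commutator_eq_one_iff)
  show "phi3_relations G (x Alpha) (x Alpha1) (x Alpha2) \<delta>"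
  proof
    show "x Alpha1 \<otimes> x Alpha = x Alpha \<otimes> x Alpha1 \<otimes> x Alpha2"
      using commutator_swap[OF C C, of Alpha1 Alpha] eqs(5) by simp
    show "x Alpha2 \<otimes> x Alpha = x Alpha \<otimes> x Alpha2 \<otimes> \<delta>"
      using commutator_swap[OF C C, of Alpha2 Alpha] by (simp add: \<delta>_def)
  qed (use C \<delta> comm eqs in simp_all)
qed

text \<open>The last claim detects a collapse: if a smaller power of alpha_1 is already a power of
  [alpha_2, alpha], the order bound drops accordingly. It is applied with m' = p.\<close>

lemma (in group) phi3_sat_structure:
  assumes G: "p_group p G" and p: "prime p" and sat: "phi3_sat G x p r s t m" and r: "coprime r p" and m: "m > 0"
    and gen: "generate G (range x) = carrier G"
  shows "card (carrier G) \<le> p ^ 3 * m"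
    and "p \<ge> 5 \<Longrightarrow> card (carrier G) = p ^ 3 * m \<Longrightarrow>
      phi3 G (x Alpha) (x Alpha1) (x Alpha2) (commutator G (x Alpha2) (x Alpha)) p"
    and "m' > 0 \<Longrightarrow> x Alpha1 [^] m' = commutator G (x Alpha2) (x Alpha) [^] (t' :: nat) \<Longrightarrow> card (carrier G) \<le> p ^ 3 * m'"
proof -
  define \<delta> where "\<delta> = commutator G (x Alpha2) (x Alpha)"
  note rel = phi3_sat_relations[OF G p sat r, folded \<delta>_def]
  interpret R: phi3_relations G "x Alpha" "x Alpha1" "x Alpha2" \<delta> by (rule rel(1))
  obtain k where k: "order G = p ^ k" using G by (auto simp: p_group_def)
  have p0: "p > 0" using p by (rule prime_gt_0_nat)
  have fin: "finite (carrier G)" using k p0 order_gt_0_iff_finite by simp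
  have S: "\<exists>(i::nat) j k l. g = x Alpha [^] i \<otimes> R.nf j k l" if "g \<in> range x" for g
  proof -
    obtain v where v: "g = x v" using \<open>g \<in> range x\<close> by blast
    show ?thesis unfolding v using R.gens_form(1-3) R.gens_form(4)[of r, folded rel(3)] by (cases v) auto
  qed
  have e1: "x Alpha [^] p = \<delta> [^] (r * s)" and e2: "x Alpha1 [^] m = \<delta> [^] (r * t)" and e3: "x Alpha2 [^] p = \<one>"
    using sat rel(3) by (simp_all add: phi3_sat_def nat_pow_pow)
  show "card (carrier G) \<le> p ^ 3 * m"
    by (rule R.normal_form_card(1)[OF fin gen S e1 e2 e3 rel(2) p0 m])
  show "card (carrier G) \<le> p ^ 3 * m'"
    if "m' > 0" "x Alpha1 [^] m' = commutator G (x Alpha2) (x Alpha) [^] (t' :: nat)"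
    by (rule R.normal_form_card(1)[OF fin gen S e1 that(2)[folded \<delta>_def] e3 rel(2) p0 that(1)])
  show "phi3 G (x Alpha) (x Alpha1) (x Alpha2) (commutator G (x Alpha2) (x Alpha)) p"
    if "p \<ge> 5" "card (carrier G) = p ^ 3 * m"
    using R.phi3I[OF p that(1) gen S e1 e2 e3 rel(2) m that(2)] by (simp add: \<delta>_def)
qed

section \<open>Universal property from an order bound\<close>

lemma term_value_DirProd:
  assumes G: "group G" and H: "group H" and x: "range x \<subseteq> carrier G" and y: "range y \<subseteq> carrier H"
  shows "term_value (G \<times>\<times> H) (\<lambda>v. (x v, y v)) t = (term_value G x t, term_value H y t)
    \<and> term_value G x t \<in> carrier G \<and> term_value H y t \<in> carrier H"
proof (induction t)
  case (Pow t n)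
  interpret G: group G by fact
  interpret H: group H by fact
  have "(u, v) [^]\<^bsub>G \<times>\<times> H\<^esub> n = (u [^]\<^bsub>G\<^esub> n, v [^]\<^bsub>H\<^esub> n)" for u v by (induction n) (auto simp: DirProd_def nat_pow_def)
  then show ?case using Pow by simp
next
  case (Comm s t)
  then show ?case using inv_DirProd[OF G H] group.commutator_closed[OF G] group.commutator_closed[OF H]
    by (simp add: commutator_def)
next
  case (Gen v)
  then show ?case using x y by auto
next
  case Unit
  then show ?case using group.is_monoid[OF G] group.is_monoid[OF H] by (simp add: monoid.one_closed)
qed

lemma (in group) term_value_subgroup:
  assumes S: "subgroup S G" and x: "range x \<subseteq> S"
  shows "term_value (subgroup_monoid G S) x t = term_value G x t \<and> term_value G x t \<in> S"
proof (induction t)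
  case (Gen v)
  then show ?case using x by auto
next
  case Unit
  then show ?case using subgroup.one_closed[OF S] by simp
next
  case (Comm s t)
  then show ?case using m_inv_consistent[OF S] subgroup.m_closed[OF S] subgroup.m_inv_closed[OF S]
    by (simp add: commutator_def)
next
  case (Pow t n)
  have "u [^] n \<in> S" if "u \<in> S" for u
    using that by (induction n) (auto simp: subgroup.one_closed[OF S] subgroup.m_closed[OF S])
  then show ?case using Pow nat_pow_consistent by simp
qed

lemma p_group_subgroup:
  assumes G: "p_group p G" and p: "prime p" and S: "subgroup S G"
  shows "p_group p (subgroup_monoid G S)"
proof -
  have gr: "group G" using G by (simp add: p_group_def)
  obtain k where k: "order G = p ^ k" using G by (auto simp: p_group_def)
  then have "card S dvd p ^ k" using group.lagrange[OF gr S] by (metis dvd_triv_right)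
  then obtain i where "card S = p ^ i" using divides_primepow_nat[OF p] by blast
  then show ?thesis using group.subgroup_imp_group[OF gr S] by (auto simp: p_group_def Coset.order_def)
qed

(* The graph of the required homomorphism G \<rightarrow> H is the subgroup of G \<times> H generated by the pairs of
   generators: it satisfies the relations, hence is not larger than G. *)
lemma p_presentationI:
  fixes G :: "('a, 'b) monoid_scheme" (structure)
  assumes G: "p_group p G" and p: "prime p" and rels: "satisfies_rels G x R" and gen: "generate G (range x) = carrier G"
    and bound: "\<And>(K :: ('a \<times> nat) monoid) y. p_group p K \<Longrightarrow> satisfies_rels K y R \<Longrightarrow>
      generate K (range y) = carrier K \<Longrightarrow> card (carrier K) \<le> card (carrier G)"
  shows "p_presentation p R G x"
  unfolding p_presentation_def
proof (intro conjI allI impI G rels gen)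
  fix H :: "nat monoid" and y
  assume "p_group p H \<and> satisfies_rels H y R"
  then have H: "p_group p H" and rels': "satisfies_rels H y R" by auto
  interpret G: group G using G by (simp add: p_group_def)
  interpret H: group H using H by (simp add: p_group_def)
  let ?P = "G \<times>\<times> H" and ?z = "\<lambda>v. (x v, y v)"
  interpret P: group ?P by (rule DirProd_group[OF G.is_group H.is_group])
  have xy: "range x \<subseteq> carrier G" "range y \<subseteq> carrier H" using rels rels' by (auto simp: satisfies_rels_def)
  then have z: "range ?z \<subseteq> carrier ?P" by auto
  define S where "S = generate ?P (range ?z)"
  have S: "subgroup S ?P" unfolding S_def by (rule P.generate_is_subgroup[OF z])
  have zS: "range ?z \<subseteq> S" unfolding S_def by (auto intro: generate.incl)
  let ?K = "subgroup_monoid ?P S"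
  have "p_group p ?P"
  proof -
    obtain k l where "order G = p ^ k" "order H = p ^ l" using G H by (auto simp: p_group_def)
    then have "order ?P = p ^ (k + l)" by (simp add: Coset.order_def card_cartesian_product power_add)
    then show ?thesis using P.is_group by (auto simp: p_group_def)
  qed
  then have K: "p_group p ?K" by (rule p_group_subgroup[OF _ p S])
  have "satisfies_rels ?K ?z R"
    unfolding satisfies_rels_def
  proof (intro conjI ballI)
    fix st assume "st \<in> R"
    moreover obtain s t where st: "st = (s, t)" by fastforce
    ultimately have "term_value G x s = term_value G x t" "term_value H y s = term_value H y t"
      using rels rels' by (auto simp: satisfies_rels_def)
    then show "case st of (s, t) \<Rightarrow> term_value ?K ?z s = term_value ?K ?z t"
      using P.term_value_subgroup[OF S zS] term_value_DirProd[OF G.is_group H.is_group xy] st by simp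
  qed (use zS in auto)
  moreover have "generate ?K (range ?z) = carrier ?K"
    using P.generate_consistent[OF zS S] by (simp add: S_def)
  ultimately have le: "card S \<le> card (carrier G)" using bound[OF K] by simp
  have hom: "fst \<in> hom ?P G" by (auto simp: hom_def)
  interpret F: group_hom ?P G fst by unfold_locales (rule hom)
  have img: "fst ` S = carrier G"
    using F.generate_img[OF z] gen by (simp add: S_def image_image)
  have finS: "finite S"
  proof -
    obtain k where "order ?K = p ^ k" using K by (auto simp: p_group_def)
    then have "card S > 0" using prime_gt_0_nat[OF p] by (simp add: Coset.order_def)
    then show ?thesis by (rule card_ge_0_finite)
  qed
  then have "card (fst ` S) = card S" using le img card_image_le[OF finS, of fst] by simp
  then have inj: "inj_on fst S" by (rule eq_card_imp_inj_on[OF finS])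
  define h where "h g = snd (the_inv_into S fst g)" for g
  have h: "h (fst s) = snd s" if "s \<in> S" for s unfolding h_def by (simp add: the_inv_into_f_f[OF inj that])
  have "h \<in> hom G H"
  proof (rule homI)
    fix g assume "g \<in> carrier G"
    then obtain s where "s \<in> S" "g = fst s" using img by blast
    then show "h g \<in> carrier H" using h subgroup.subset[OF S] by auto
  next
    fix g g' assume "g \<in> carrier G" "g' \<in> carrier G"
    then obtain s s' where s: "s \<in> S" "g = fst s" "s' \<in> S" "g' = fst s'" using img by (metis imageE)
    have "s \<otimes>\<^bsub>?P\<^esub> s' \<in> S" using subgroup.m_closed[OF S s(1,3)] .
    then show "h (g \<otimes> g') = h g \<otimes>\<^bsub>H\<^esub> h g'"
      using h[of "s \<otimes>\<^bsub>?P\<^esub> s'"] h s by (simp add: mult_DirProd')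
  qed
  moreover have "h (x v) = y v" for v using h[OF subsetD[OF zS rangeI, of v]] by simp
  ultimately show "\<exists>h\<in>hom G H. \<forall>v. h (x v) = y v" by blast
qed

lemma p_presentation_of_phi3_sat:
  fixes G :: "('a, 'b) monoid_scheme" (structure)
  assumes G: "p_group p G" and p: "prime p" and sat: "satisfies_rels G x R" and gen: "generate G (range x) = carrier G"
    and card: "card (carrier G) = p ^ 3 * m" and m: "m > 0" and r: "coprime r p"
    and R: "\<And>(K :: ('a \<times> nat) monoid) y. group K \<Longrightarrow> satisfies_rels K y R \<longleftrightarrow> phi3_sat K y p r s t m"
  shows "p_presentation p R G x"
proof (rule p_presentationI[OF G p sat gen])
  fix K :: "('a \<times> nat) monoid" and y
  assume K: "p_group p K" "satisfies_rels K y R" "generate K (range y) = carrier K"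
  then have gr: "group K" by (simp add: p_group_def)
  show "card (carrier K) \<le> card (carrier G)"
    using group.phi3_sat_structure(1)[OF gr K(1) p _ r m K(3)] K(2) R[OF gr] card by simp
qed

section \<open>Square classes modulo p\<close>

lemma nonresidue_mult:
  assumes p: "prime p" "p > 2" and a: "\<not> QuadRes (int p) a" and b: "\<not> QuadRes (int p) b"
  shows "QuadRes (int p) (a * b)"
proof -
  have nz: "\<not> [x = 0] (mod int p)" if "\<not> QuadRes (int p) x" for x
  proof
    assume "[x = 0] (mod int p)"
    then have "[0\<^sup>2 = x] (mod int p)" by (simp add: cong_sym)
    then show False using that unfolding QuadRes_def by blast
  qed
  have leg: "[-1 = x ^ ((p - 1) div 2)] (mod int p)" if x: "\<not> QuadRes (int p) x" for x
    using euler_criterion[of p x] p x nz[OF x] by (simp add: Legendre_def)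
  have "[(-1) * (-1) = a ^ ((p - 1) div 2) * b ^ ((p - 1) div 2)] (mod int p)"
    by (intro cong_mult leg a b)
  then have 1: "[1 = (a * b) ^ ((p - 1) div 2)] (mod int p)" by (simp add: power_mult_distrib)
  have "[Legendre (a * b) (int p) = (a * b) ^ ((p - 1) div 2)] (mod int p)"
    using euler_criterion[of p "a * b"] p by simp
  then have 2: "[Legendre (a * b) (int p) = 1] (mod int p)" using 1 by (meson cong_sym cong_trans)
  show ?thesis
  proof (rule ccontr)
    assume "\<not> ?thesis"
    then have "Legendre (a * b) (int p) = -1" using nz by (simp add: Legendre_def)
    then have "int p dvd 2" using 2 by (simp add: cong_iff_dvd_diff)
    then show False using p(2) by (auto dest: zdvd_imp_le)
  qed
qed

text \<open>If every element were a square, squaring on {0, ..., p-1} would be onto and hence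
  injective, but 1 and p-1 have the same square.\<close>

lemma exists_nonresidue:
  assumes p: "prime p" "p > 2"
  shows "\<exists>n>0. \<not> QuadRes (int p) (int n)"
proof (rule ccontr)
  assume "\<not> ?thesis"
  then have res: "QuadRes (int p) (int n)" if "n > 0" for n using that by blast
  let ?f = "\<lambda>y::int. y\<^sup>2 mod int p" and ?S = "{0..<int p}"
  have "?S \<subseteq> ?f ` ?S"
  proof
    fix a assume a: "a \<in> ?S"
    have "QuadRes (int p) a"
    proof (cases "a = 0")
      case True
      then show ?thesis unfolding QuadRes_def by (intro exI[of _ 0]) simp
    qed (use res[of "nat a"] a in auto)
    then obtain y where y: "[y\<^sup>2 = a] (mod int p)" by (auto simp: QuadRes_def)
    have "?f (y mod int p) = a" using y a by (simp add: power_mod cong_def)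
    moreover have "y mod int p \<in> ?S" using p by simp
    ultimately show "a \<in> ?f ` ?S" by blast
  qed
  then have "inj_on ?f ?S" by (intro finite_surj_inj) auto
  moreover have "?f 1 = ?f (int p - 1)"
  proof -
    have "(int p - 1)\<^sup>2 = 1 + int p * (int p - 2)" by (simp add: power2_eq_square algebra_simps)
    then show ?thesis by simp
  qed
  ultimately have "1 = int p - 1" using p by (elim inj_onD) auto
  then show False using p by simp
qed

lemma least_nonresidue:
  assumes "prime p" "p > 2"
  shows "\<not> QuadRes (int p) (int (least_nonresidue p))"
  using LeastI_ex[OF exists_nonresidue[OF assms]] by (simp add: least_nonresidue_def)

lemma coprime_one_or_nonresidue:
  assumes p: "prime p" "p > 2" and r: "r \<in> {1, least_nonresidue p}"
  shows "coprime r p"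
proof (cases "r = 1")
  case False
  then have "\<not> QuadRes (int p) (int r)" using least_nonresidue[OF p] r by simp
  \<comment> \<open>A multiple of p is congruent to 0^2 and thus a residue.\<close>
  then have "\<not> p dvd r" unfolding QuadRes_def by (metis cong_0_iff cong_sym int_dvd_int_iff zero_power2)
  then show ?thesis using p(1) by (metis coprime_commute prime_imp_coprime)
qed simp

text \<open>The units modulo p form two square classes, represented by 1 and the least nonresidue: r
  e is a square y^2 for one choice of r, and n = y/r. Passing from a to a^n turns d = [[b,a],a] into
  d^(n^2), and this is why \<open>Phi3_311b\<close> needs just these two parameters.\<close>

lemma square_class_representative:
  assumes p: "prime p" "p > 2" and e: "\<not> p dvd e"
  shows "\<exists>r\<in>{1, least_nonresidue p}. \<exists>n. \<not> p dvd n \<and> [r * n\<^sup>2 = e] (mod p)"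
proof -
  let ?\<nu> = "least_nonresidue p"
  have key: "\<exists>n. \<not> p dvd n \<and> [r * n\<^sup>2 = e] (mod p)" if y: "[y\<^sup>2 = int r * int e] (mod int p)" and r: "coprime r p" for y r
  proof -
    obtain s where s: "[r * s = 1] (mod p)" using cong_solve_coprime_nat[OF r] by auto
    define n where "n = nat ((y * int s) mod int p)"
    have p0: "int p > 0" using p by simp
    have n: "[int n = y * int s] (mod int p)" using p0 by (simp add: n_def cong_def)
    have s': "[int r * int s = 1] (mod int p)" using s by (metis cong_int_iff of_nat_1 of_nat_mult)
    have "[int r * (int n)\<^sup>2 = int r * (y * int s)\<^sup>2] (mod int p)" by (intro cong_mult cong_pow cong_refl n)
    also have "int r * (y * int s)\<^sup>2 = int r * (int s)\<^sup>2 * y\<^sup>2" by (simp add: power_mult_distrib)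
    also have "[\<dots> = int r * (int s)\<^sup>2 * (int r * int e)] (mod int p)" by (intro cong_mult cong_refl y)
    also have "int r * (int s)\<^sup>2 * (int r * int e) = (int r * int s) * (int r * int s) * int e" by (simp add: power2_eq_square)
    also have "[\<dots> = 1 * 1 * int e] (mod int p)" by (intro cong_mult cong_refl s')
    finally have "[int (r * n\<^sup>2) = int e] (mod int p)" by simp
    then have eq: "[r * n\<^sup>2 = e] (mod p)" by (simp only: cong_int_iff)
    moreover have "\<not> p dvd n"
    proof
      assume "p dvd n"
      then have "p dvd r * n\<^sup>2" by (simp only: power2_eq_square dvd_mult)
      then show False using eq e by (simp add: cong_dvd_iff)
    qed
    ultimately show ?thesis by blast
  qed
  show ?thesis
  proof (cases "QuadRes (int p) (int e)")
    case True
    then show ?thesis using key[of _ 1] by (auto simp: QuadRes_def)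
  next
    case False
    have "QuadRes (int p) (int ?\<nu> * int e)" by (rule nonresidue_mult[OF p least_nonresidue[OF p] False])
    then show ?thesis using key[of _ ?\<nu>] coprime_one_or_nonresidue[OF p, of ?\<nu>] by (auto simp: QuadRes_def)
  qed
qed

lemma (in group) mem_subgroup_of_coprime_power:
  fixes n N :: nat
  assumes S: "subgroup S G" and x: "x \<in> carrier G" "x [^] N = \<one>" "coprime n N" "n \<noteq> 0" "x [^] n \<in> S"
  shows "x \<in> S"
proof -
  obtain s t where st: "n * s = N * t + 1" using bezout_nat[OF x(4), of N] x(3) by auto
  have "x = (x [^] N) [^] t \<otimes> x" using x(1,2) by simp
  also have "\<dots> = (x [^] n) [^] s" using x(1) by (simp add: nat_pow_pow st)
  finally show ?thesis using subgroup_int_pow_closed[OF S x(5), of "int s"] by (simp add: int_pow_int)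
qed

section \<open>Groups of order p^5: centre and presentations\<close>

locale phi3_order5 = phi3 +
  assumes card: "card (carrier G) = p ^ 5"
begin

lemma p_gr: "p_group p G"
  using card is_group by (auto simp: p_group_def Coset.order_def)

lemma card_center: "card (center G) = p\<^sup>2"
proof -
  have "p ^ 3 * card (center G) = p ^ 3 * p\<^sup>2" using card order_eq by (simp add: power_add[symmetric])
  moreover have "p ^ 3 > 0" using p5 by simp
  ultimately show ?thesis by (metis nat_mult_eq_cancel1)
qed

text \<open>The centre has order p^2 and <d> has order p, so the quotient has order p and p-th
  powers of central elements fall into <d>.\<close>

lemma center_pow_p:
  assumes z: "z \<in> center G"
  shows "\<exists>l. z [^] p = d [^] (l::nat)"
proof -
  let ?Z = "subgroup_monoid G (center G)"
  interpret Z: comm_group ?Z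
    by (rule group.group_comm_groupI[OF subgroup_imp_group[OF center_subgroup]]) (auto simp: centerD)
  let ?H = "(\<lambda>l. d [^] l) ` {..<p}"
  have p0: "p > 0" using p5 by simp
  have H: "subgroup ?H ?Z"
  proof (rule Z.finite_mult_closed_subgroup)
    show "finite (carrier ?Z)" using fin finite_subset[OF subgroup.subset[OF center_subgroup]] by simp
    show "?H \<subseteq> carrier ?Z" using d_pow_center by auto
    show "\<one>\<^bsub>?Z\<^esub> \<in> ?H" using p0 by (intro image_eqI[of _ _ 0]) auto
    fix x y assume "x \<in> ?H" "y \<in> ?H"
    then obtain i j :: nat where "x = d [^] i" "y = d [^] j" by blast
    then have "x \<otimes> y = d [^] ((i + j) mod p)"
      using nat_pow_eq_pow_mod[OF closed(4) d_pow, of "i + j"] by (simp add: nat_pow_mult)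
    then show "x \<otimes>\<^bsub>?Z\<^esub> y \<in> ?H" using p0 by simp
  qed
  have "inj_on (\<lambda>l. d [^] l) {..<p}" by (rule inj_onI) (simp add: d_pow_eq_iff)
  then have cH: "card ?H = p" by (simp add: card_image)
  interpret N: normal ?H ?Z by (rule Z.subgroup_imp_normal[OF H])
  have "card (rcosets\<^bsub>?Z\<^esub> ?H) * p = p * p"
    using Z.lagrange[OF H] cH card_center by (simp add: Coset.order_def power2_eq_square)
  then have ord: "order (?Z Mod ?H) = p" using p0 by (simp add: Coset.order_def FactGroup_def)
  have zZ: "z \<in> carrier ?Z" using z by simp
  have "(?H #>\<^bsub>?Z\<^esub> z) [^]\<^bsub>?Z Mod ?H\<^esub> p = ?H"
    using group.pow_order_eq_1[OF N.factorgroup_is_group, of "?H #>\<^bsub>?Z\<^esub> z"] zZ ord by (simp add: carrier_FactGroup)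
  then have "?H #>\<^bsub>?Z\<^esub> (z [^]\<^bsub>?Z\<^esub> p) = ?H" using N.FactGroup_pow[OF zZ] by simp
  then have "z [^]\<^bsub>?Z\<^esub> p \<in> ?H" using Z.coset_join1[OF _ Z.nat_pow_closed[OF zZ] H] by simp
  moreover have "z [^]\<^bsub>?Z\<^esub> p = z [^] p" by (rule nat_pow_consistent[symmetric])
  ultimately show ?thesis by auto
qed

text \<open>On the abelian group A taking p-th powers is a homomorphism, so it is enough to look at
  b, c and the centre.\<close>

lemma A_pow_p:
  assumes b: "\<exists>l. b [^] p = d [^] (l::nat)" and u: "u \<in> A"
  shows "\<exists>l. u [^] p = d [^] (l::nat)"
proof -
  obtain j k z where z: "z \<in> center G" "u = nf j k 0 \<otimes> z" using u by (rule AE)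
  obtain l l' :: nat where l: "b [^] p = d [^] l" "z [^] p = d [^] l'" using b center_pow_p[OF z(1)] by blast
  have zG: "z \<in> carrier G" using z(1) center_closed by blast
  have "nf j k 0 [^] p = (b [^] p) [^] j \<otimes> (c [^] p) [^] k" unfolding nf_pow by (simp add: nf_def nat_pow_pow)
  then have "nf j k 0 [^] p = d [^] (l * j)" using l(1) c_pow by (simp add: nat_pow_pow)
  moreover have "u [^] p = nf j k 0 [^] p \<otimes> z [^] p"
    unfolding z(2) using zG centerD(2)[OF z(1), of "nf j k 0"] by (intro pow_mult_distrib) auto
  ultimately have "u [^] p = d [^] (l * j + l')" using l(2) by (simp add: nat_pow_mult)
  then show ?thesis by blast
qed

text \<open>If b^p lies outside <d>, the products of powers of b^p and d are p^2 distinct central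
  elements and fill the centre.\<close>

lemma center_form:
  assumes b: "\<And>l. b [^] p \<noteq> d [^] (l::nat)" and z: "z \<in> center G"
  shows "\<exists>(i::nat) (j::nat). z = (b [^] p) [^] i \<otimes> d [^] j"
proof -
  let ?b = "b [^] p"
  let ?f = "\<lambda>(i::nat, j::nat). ?b [^] i \<otimes> d [^] j" and ?S = "{..<p} \<times> {..<p}"
  obtain e :: nat where e: "?b [^] p = d [^] e" using center_pow_p[OF b_pow] by blast
  have no: "?b [^] m \<noteq> d [^] l" if m: "0 < m" "m < p" for m l :: nat
  proof
    assume eq: "?b [^] m = d [^] l"
    have "coprime m p" using m prime by (metis coprime_commute nat_dvd_not_less prime_imp_coprime)
    then obtain s t where st: "m * s = p * t + 1" using bezout_nat[of m p] m by auto
    have "d [^] (l * s) = ?b [^] (m * s)" by (simp add: nat_pow_pow[symmetric] eq del: nat_pow_pow)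
    also have "\<dots> = (?b [^] p) [^] t \<otimes> ?b" unfolding st by (simp add: nat_pow_pow nat_pow_mult algebra_simps)
    also have "\<dots> = d [^] (e * t) \<otimes> ?b" by (simp add: e nat_pow_pow)
    finally have eq2: "d [^] (l * s) = d [^] (e * t) \<otimes> ?b" .
    \<comment> \<open>Exponents are natural numbers, so the inverse of d^x is written as
      d^((p-1)x).\<close>
    have "d [^] ((p - 1) * (e * t) + l * s) = d [^] ((p - 1) * (e * t)) \<otimes> (d [^] (e * t) \<otimes> ?b)"
      by (simp only: eq2[symmetric]) (simp add: nat_pow_mult)
    also have "\<dots> = d [^] ((p - 1) * (e * t) + e * t) \<otimes> ?b" by (simp add: nat_pow_mult flip: m_assoc)
    also have "(p - 1) * (e * t) + e * t = p * (e * t)" using p5 by (cases p) auto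
    also have "d [^] (p * (e * t)) = \<one>" using d_pow_one_iff by simp
    finally show False using b[of "(p - 1) * (e * t) + l * s"] by simp
  qed
  have le: "i = i' \<and> j = j'"
    if eq: "?b [^] i \<otimes> d [^] j = ?b [^] i' \<otimes> d [^] j'" and lt: "i < p" "i' < p" "j < p" "j' < p" and "i \<le> i'" for i j i' j' :: nat
  proof -
    obtain m where m: "i' = i + m" using \<open>i \<le> i'\<close> le_Suc_ex by blast
    have "?b [^] i \<otimes> d [^] j = ?b [^] i \<otimes> (?b [^] m \<otimes> d [^] j')" using eq m by (simp add: nat_pow_mult flip: m_assoc)
    then have eq': "d [^] j = ?b [^] m \<otimes> d [^] j'" using l_cancel[of "?b [^] i" "d [^] j" "?b [^] m \<otimes> d [^] j'"] by simp
    have "d [^] (j + (p - 1) * j') = ?b [^] m \<otimes> (d [^] j' \<otimes> d [^] ((p - 1) * j'))"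
      using eq' by (simp add: m_assoc flip: nat_pow_mult)
    also have "d [^] j' \<otimes> d [^] ((p - 1) * j') = d [^] (p * j')" using p5 by (cases p) (auto simp: nat_pow_mult)
    also have "\<dots> = \<one>" using d_pow_one_iff by simp
    finally have "?b [^] m = d [^] (j + (p - 1) * j')" by simp
    then have "m = 0" using no[of m] m lt by auto
    then show ?thesis using eq' m lt by (simp add: d_pow_eq_iff)
  qed
  have inj: "inj_on ?f ?S"
  proof (rule inj_onI, clarsimp)
    fix i j i' j' :: nat
    assume "i < p" "j < p" "i' < p" "j' < p" "?b [^] i \<otimes> d [^] j = ?b [^] i' \<otimes> d [^] j'"
    then show "i = i' \<and> j = j'" using le[of i j i' j'] le[of i' j' i j] by (cases "i \<le> i'") auto
  qed
  have sub: "?f ` ?S \<subseteq> center G" using center_pow[OF b_pow] d_pow_center center_mult by auto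
  have finZ: "finite (center G)" using fin finite_subset[OF subgroup.subset[OF center_subgroup]] by blast
  have "card (?f ` ?S) = card (center G)"
    using card_image[OF inj] card_center by (simp add: card_cartesian_product power2_eq_square)
  then have "?f ` ?S = center G" by (rule card_subset_eq[OF finZ sub])
  then obtain ij where ij: "z = ?f ij" using z by blast
  show ?thesis by (cases ij) (use ij in auto)
qed

text \<open>Here p >= 5 is decisive: C(p,2) and C(p,3) are multiples of p, so the collected powers
  of c and d disappear. For p = 3 a factor d^t would survive.\<close>

lemma ab_pow_p: fixes t :: nat shows "(a \<otimes> b [^] t) [^] p = a [^] p \<otimes> (b [^] p) [^] t"
proof -
  have "p dvd p choose 2" "p dvd p choose 3" using prime p5 by (auto intro!: dvd_choose_prime)
  then have "p dvd t * (p choose 2)" "p dvd t * (p choose 3)" by auto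
  then have "nf (p * t) (t * (p choose 2)) (t * (p choose 3)) = b [^] (p * t)"
    by (simp add: nf_def c_pow_one_iff[THEN iffD2] d_pow_one_iff[THEN iffD2])
  then show ?thesis by (simp add: ab_pow nat_pow_pow)
qed

text \<open>Since b^t commutes with b and c, replacing a by a b^t changes neither of the commutators
  c and d. The change of a^p is the freedom exploited in \<open>presented_of_b_pow\<close>.\<close>

lemma shift: fixes t :: nat shows "phi3_order5 G (a \<otimes> b [^] t) b c d p"
proof -
  let ?a = "a \<otimes> b [^] (t::nat)"
  have "b \<otimes> ?a = a \<otimes> (nf 1 1 0 \<otimes> nf t 0 0)" using ba by (simp add: nf_def m_assoc flip: m_assoc[of b a])
  also have "\<dots> = a \<otimes> (nf t 0 0 \<otimes> nf 1 1 0)" by (subst nf_commute) (rule refl)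
  also have "\<dots> = ?a \<otimes> b \<otimes> c" by (simp add: nf_def m_assoc)
  finally have ba': "b \<otimes> ?a = ?a \<otimes> b \<otimes> c" .
  have "c \<otimes> ?a = a \<otimes> (nf 0 1 1 \<otimes> nf t 0 0)" using ca by (simp add: nf_def m_assoc flip: m_assoc[of c a])
  also have "\<dots> = a \<otimes> (nf t 0 0 \<otimes> nf 0 1 1)" by (subst nf_commute) (rule refl)
  also have "\<dots> = ?a \<otimes> c \<otimes> d" by (simp add: nf_def m_assoc)
  finally have ca': "c \<otimes> ?a = ?a \<otimes> c \<otimes> d" .
  interpret R: phi3_relations G ?a b c d
    by unfold_locales (use ba' ca' cb db dc centerD(2)[OF d_center] in simp_all)
  show ?thesis
  proof
    show "?a [^] p \<in> center G" unfolding ab_pow_p using a_pow b_pow center_pow center_mult by blast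
    fix x assume "x \<in> carrier G"
    then obtain i :: nat and u where u: "u \<in> A" "x = a [^] i \<otimes> u" using spanE by metis
    define w where "w = nf (i * t) (t * (i choose 2)) (t * (i choose 3))"
    have w: "w \<in> A" "?a [^] i = a [^] i \<otimes> w" unfolding w_def by (rule nf_A) (rule ab_pow)
    have G': "u \<in> carrier G" "w \<in> carrier G" using u w A_closed by auto
    have "x = ?a [^] i \<otimes> (inv w \<otimes> u)" unfolding w(2) u(2) using G' by (simp add: m_assoc mult_inv_cancel)
    moreover have "inv w \<otimes> u \<in> A" using u w subgroup.m_closed[OF A_subgroup] subgroup.m_inv_closed[OF A_subgroup] by blast
    then obtain j k z where "z \<in> center G" "inv w \<otimes> u = nf j k 0 \<otimes> z" by (rule AE)
    ultimately have "z \<in> center G" "x = ?a [^] i \<otimes> (nf j k 0 \<otimes> z)" by simp_all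
    then show "\<exists>(i::nat) j k. \<exists>z\<in>center G. x = ?a [^] i \<otimes> (nf j k 0 \<otimes> z)" by blast
  qed (use prime p5 fin d_center d_neq c_pow b_pow card in simp_all)
qed

text \<open>c and d are commutators built from a and b, and \<open>center_form\<close> puts the
  centre into the subgroup as well.\<close>

lemma generators:
  assumes b: "\<And>l. b [^] p \<noteq> d [^] (l::nat)" and S: "subgroup S G" and ab: "a \<in> S" "b \<in> S"
  shows "S = carrier G"
proof (rule subset_antisym[OF subgroup.subset[OF S]], rule subsetI)
  interpret S: subgroup S G by fact
  have comm: "commutator G x y \<in> S" if "x \<in> S" "y \<in> S" for x y using that by (simp add: commutator_def)
  have "commutator G b a = c" by (rule commutator_eqI) (simp_all add: ba)
  then have c: "c \<in> S" using comm ab by metis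
  have "commutator G c a = d" by (rule commutator_eqI) (simp_all add: ca)
  then have d: "d \<in> S" using comm c ab(1) by metis
  have pw: "x [^] (n::nat) \<in> S" if "x \<in> S" for x n using that by (induction n) auto
  fix x assume "x \<in> carrier G"
  then obtain i j k :: nat and z where x: "z \<in> center G" "x = a [^] i \<otimes> (nf j k 0 \<otimes> z)" using span by metis
  then obtain i' j' where "z = (b [^] p) [^] (i'::nat) \<otimes> d [^] (j'::nat)" using center_form[OF b] by metis
  then show "x \<in> S" using pw ab c d by (simp add: x(2) nf_def)
qed

text \<open>Write b^(p^2) = d^e and a^p = b^(pi) d^j. If p divides e, a shift of a gives a^p = d^j:
  the case p | j is \<open>Phi3_2111e\<close>, and otherwise the j-th powers of b, c, d lead to
  \<open>Phi3_221a\<close>. If p does not divide e, a shift gives a^p = 1, and replacing a by some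
  a^n adjusts the square class of e, which leads to \<open>Phi3_311b\<close>.\<close>

lemma presented_of_b_pow:
  assumes b: "\<And>l. b [^] p \<noteq> d [^] (l::nat)"
  shows "(\<exists>r\<in>{1, least_nonresidue p}. p_presented_by p (Phi3_311b p r) G) \<or>
    p_presented_by p (Phi3_221a p) G \<or> p_presented_by p (Phi3_2111e p) G"
proof -
  have p2: "p > 2" "p > 0" using p5 by auto
  have m: "p\<^sup>2 > 0" "card (carrier G) = p ^ 3 * p\<^sup>2" using p2 card by (auto simp: power_add[symmetric])
  obtain e :: nat where e: "(b [^] p) [^] p = d [^] e" using center_pow_p[OF b_pow] by blast
  then have bp2: "b [^] p\<^sup>2 = d [^] e" by (simp add: nat_pow_pow power2_eq_square)
  obtain i j :: nat where ij: "a [^] p = (b [^] p) [^] i \<otimes> d [^] j" using center_form[OF b a_pow] by blast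
  \<comment> \<open>The multiple (p-1)i cancels b^(pi) up to b^(p^2 i) = d^(ei). The extra ps
    contributes d^(es), which is the adjustable part.\<close>
  have shifted: "(a \<otimes> b [^] ((p - 1) * i + p * s)) [^] p = d [^] (j + e * (i + s))" for s
  proof -
    have "(p - 1) * i + i = p * i" using p2 by (cases p) auto
    then have "i + ((p - 1) * i + p * s) = p * (i + s)" by (simp add: algebra_simps)
    then have "(b [^] p) [^] i \<otimes> (b [^] p) [^] ((p - 1) * i + p * s) = (b [^] p) [^] (p * (i + s))"
      by (simp add: nat_pow_mult)
    also have "\<dots> = d [^] (e * (i + s))" using e by (simp flip: nat_pow_pow[of "b [^] p"]) (simp add: nat_pow_pow)
    finally have *: "(b [^] p) [^] i \<otimes> (b [^] p) [^] ((p - 1) * i + p * s) = d [^] (e * (i + s))" .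
    have "(a \<otimes> b [^] ((p - 1) * i + p * s)) [^] p = d [^] j \<otimes> ((b [^] p) [^] i \<otimes> (b [^] p) [^] ((p - 1) * i + p * s))"
      unfolding ab_pow_p ij using centerD(2)[OF d_pow_center, of "(b [^] p) [^] i" j] by (simp flip: m_assoc)
    then show ?thesis unfolding * by (simp add: nat_pow_mult)
  qed
  have rg: "range x = {x Alpha, x Alpha1, x Alpha2, x Alpha3}" for x :: "gen \<Rightarrow> 'a"
    by (auto simp: image_def) (metis gen.exhaust)+
  show ?thesis
  proof (cases "p dvd e")
    case True
    define a' where "a' = a \<otimes> b [^] ((p - 1) * i + p * 0)"
    interpret P: phi3_order5 G a' b c d p unfolding a'_def by (rule shift)
    have "d [^] (e * (i + 0)) = \<one>" using True d_pow_one_iff by simp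
    then have a'p: "a' [^] p = d [^] j" using shifted[of 0] by (simp add: a'_def flip: nat_pow_mult)
    have b1: "b [^] p\<^sup>2 = \<one>" using bp2 True d_pow_one_iff by simp
    show ?thesis
    proof (cases "p dvd j")
      case True
      define x where "x v = (case v of Alpha \<Rightarrow> a' | Alpha1 \<Rightarrow> b | Alpha2 \<Rightarrow> c | Alpha3 \<Rightarrow> d)" for v
      have comm: "commutator G b a' = c" "commutator G c a' = d"
        by (rule commutator_eqI, simp_all add: P.ba P.ca)+
      have "phi3_sat G x p 1 0 0 (p\<^sup>2)"
        using True a'p b1 c_pow d_pow comm cb db dc P.da d_pow_one_iff
        by (auto simp: phi3_sat_def x_def rg commutator_eq_one_iff)
      then have sat: "satisfies_rels G x (Phi3_2111e p)" by (simp add: satisfies_rels_iff_phi3_sat)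
      have gen: "generate G (range x) = carrier G"
        by (rule P.generators[OF b generate_is_subgroup]) (auto simp: rg x_def intro: generate.incl)
      have "p_presentation p (Phi3_2111e p) G x"
        by (rule p_presentation_of_phi3_sat[OF p_gr prime sat gen m(2,1)])
          (auto simp: group.satisfies_rels_iff_phi3_sat)
      then show ?thesis by (auto simp: p_presented_by_def)
    next
      case False
      \<comment> \<open>Passing to j-th powers makes alpha_3 = d^j, the value of a'^p. As p does not
        divide j, the element b is recovered from b^j.\<close>
      define x where "x v = (case v of Alpha \<Rightarrow> a' | Alpha1 \<Rightarrow> b [^] j | Alpha2 \<Rightarrow> c [^] j | Alpha3 \<Rightarrow> d [^] j)" for v
      have "b [^] j \<otimes> a' = a' \<otimes> P.nf j j 0" "c [^] j \<otimes> a' = a' \<otimes> P.nf 0 j j" "d [^] j \<otimes> a' = a' \<otimes> d [^] j"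
        using P.nf_a[of j 0 0] P.nf_a[of 0 j 0] P.nf_a[of 0 0 j] by (simp_all add: nf_def)
      then have comm: "commutator G (b [^] j) a' = c [^] j" "commutator G (c [^] j) a' = d [^] j" "commutator G (d [^] j) a' = \<one>"
        by (intro commutator_eqI; simp add: nf_def m_assoc)+
      have sw: "b [^] j \<otimes> c [^] j = c [^] j \<otimes> b [^] j" "b [^] j \<otimes> d [^] j = d [^] j \<otimes> b [^] j" "c [^] j \<otimes> d [^] j = d [^] j \<otimes> c [^] j"
        using swaps by metis+
      have pws: "(b [^] j) [^] p\<^sup>2 = \<one>" "(c [^] j) [^] p = \<one>" "(d [^] j) [^] p = \<one>"
        using b1 c_pow d_pow by (metis closed mult.commute nat_pow_pow nat_pow_one)+
      have "phi3_sat G x p 1 1 0 (p\<^sup>2)"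
        using a'p comm sw pws by (auto simp: phi3_sat_def x_def rg commutator_eq_one_iff)
      then have sat: "satisfies_rels G x (Phi3_221a p)" by (simp add: satisfies_rels_iff_phi3_sat)
      have sub: "subgroup (generate G (range x)) G" by (rule generate_is_subgroup) (auto simp: rg x_def)
      have mem: "a' \<in> generate G (range x)" "b [^] j \<in> generate G (range x)"
        by (auto simp: rg x_def intro: generate.incl)
      have "coprime j (p\<^sup>2)" using False prime by (metis coprime_commute coprime_power_right_iff prime_imp_coprime)
      moreover have "j \<noteq> 0" using False by (metis dvd_0_right)
      ultimately have "b \<in> generate G (range x)"
        by (rule mem_subgroup_of_coprime_power[OF sub closed(2) b1 _ _ mem(2)])
      then have gen: "generate G (range x) = carrier G" using P.generators[OF b sub mem(1)] by blast
      have "p_presentation p (Phi3_221a p) G x"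
        by (rule p_presentation_of_phi3_sat[OF p_gr prime sat gen m(2,1)])
          (auto simp: group.satisfies_rels_iff_phi3_sat)
      then show ?thesis by (auto simp: p_presented_by_def)
    qed
  next
    case False
    then have "coprime e p" using prime by (metis coprime_commute prime_imp_coprime)
    then obtain f where f: "[e * f = 1] (mod p)" using cong_solve_coprime_nat by auto
    \<comment> \<open>With f inverse to e modulo p and p - 1 in the role of -1, this s solves j +
      e(i + s) = 0 modulo p.\<close>
    define s where "s = f * ((p - 1) * (j + e * i))"
    define a' where "a' = a \<otimes> b [^] ((p - 1) * i + p * s)"
    interpret P: phi3_order5 G a' b c d p unfolding a'_def by (rule shift)
    have a'p: "a' [^] p = \<one>"
    proof -
      have "[j + e * (i + s) = (j + e * i) + (e * f) * ((p - 1) * (j + e * i))] (mod p)"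
        by (simp add: s_def algebra_simps)
      also have "[(j + e * i) + (e * f) * ((p - 1) * (j + e * i)) = (j + e * i) + 1 * ((p - 1) * (j + e * i))] (mod p)"
        by (intro cong_add cong_mult cong_refl f)
      also have "(j + e * i) + 1 * ((p - 1) * (j + e * i)) = p * (j + e * i)" using p2 by (cases p) auto
      finally have "p dvd j + e * (i + s)" by (simp add: cong_0_iff cong_dvd_iff)
      then show ?thesis using shifted[of s] d_pow_one_iff by (simp add: a'_def)
    qed
    obtain r n where rn: "r \<in> {1, least_nonresidue p}" "\<not> p dvd n" "[r * n\<^sup>2 = e] (mod p)"
      using square_class_representative[OF prime p2(1) False] by blast
    have r: "coprime r p" by (rule coprime_one_or_nonresidue[OF prime p2(1) rn(1)])
    \<comment> \<open>The commutator of b with a'^n. Its own commutator with a'^n is d^(n^2), whose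
      r-th power is d^e = b^(p^2).\<close>
    let ?c = "nf 0 n (n choose 2)"
    define x where "x v = (case v of Alpha \<Rightarrow> a' [^] n | Alpha1 \<Rightarrow> b | Alpha2 \<Rightarrow> ?c | Alpha3 \<Rightarrow> d [^] e)" for v
    have b1: "nf (Suc 0) 0 0 = b" using nf_gens(1) by simp
    have b2: "nf (Suc 0) n (n choose 2) = b \<otimes> ?c" by (simp add: nf_def)
    have "b \<otimes> a' [^] n = a' [^] n \<otimes> (nf 1 0 0 \<otimes> ?c)" "?c \<otimes> a' [^] n = a' [^] n \<otimes> (?c \<otimes> nf 0 0 (n\<^sup>2))"
      using P.nf_a_pow[of 1 0 0 n] P.nf_a_pow[of 0 n "n choose 2" n]
      by (simp_all add: nf_mult b1 b2 power2_eq_square add.commute)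
    then have comm: "commutator G b (a' [^] n) = ?c" "commutator G ?c (a' [^] n) = d [^] (n\<^sup>2)"
      by (auto intro!: commutator_eqI simp: m_assoc nf_powers b1)
    have de: "(d [^] (n\<^sup>2)) [^] r = d [^] e" using rn(3) by (simp add: nat_pow_pow d_pow_eq_iff cong_def mult.commute)
    have sw: "commutator G (d [^] e) (a' [^] n) = \<one>" "commutator G b ?c = \<one>" "commutator G b (d [^] e) = \<one>" "commutator G ?c (d [^] e) = \<one>"
      using centerD(2)[OF d_pow_center] nf_commute[of 1 0 0] by (auto simp: commutator_eq_one_iff b1)
    have cp: "?c [^] p = \<one>" unfolding nf_pow by (simp add: nf_def c_pow_one_iff[THEN iffD2] d_pow_one_iff[THEN iffD2])
    have dep: "(d [^] e) [^] p = \<one>" using d_pow by (metis closed(4) mult.commute nat_pow_pow nat_pow_one)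
    have ap: "(a' [^] n) [^] p = \<one>" using a'p by (metis P.closed(1) mult.commute nat_pow_pow nat_pow_one)
    have "phi3_sat G x p r 0 1 (p\<^sup>2)"
      using comm sw cp dep ap de bp2 by (auto simp: phi3_sat_def x_def rg)
    then have sat: "satisfies_rels G x (Phi3_311b p r)" by (simp add: satisfies_rels_iff_phi3_sat)
    have sub: "subgroup (generate G (range x)) G" by (rule generate_is_subgroup) (auto simp: rg x_def)
    have mem: "a' [^] n \<in> generate G (range x)" "b \<in> generate G (range x)"
      by (auto simp: rg x_def intro: generate.incl)
    have "coprime n p" using rn(2) prime by (metis coprime_commute prime_imp_coprime)
    moreover have "n \<noteq> 0" using rn(2) by (metis dvd_0_right)
    ultimately have "a' \<in> generate G (range x)"
      by (rule mem_subgroup_of_coprime_power[OF sub P.closed(1) a'p _ _ mem(1)])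
    then have gen: "generate G (range x) = carrier G" using P.generators[OF b sub _ mem(2)] by blast
    have "p_presentation p (Phi3_311b p r) G x"
      by (rule p_presentation_of_phi3_sat[OF p_gr prime sat gen m(2,1) r])
        (auto simp: group.satisfies_rels_iff_phi3_sat)
    then show ?thesis using rn(1) by (auto simp: p_presented_by_def)
  qed
qed

end

subsection \<open>Characters over the centre\<close>

lemma (in group) prime_order_iso:
  assumes p: "prime p" and card: "card (carrier G) = p"
  shows "G \<cong> integer_mod_group p"
proof -
  have p0: "p > 0" using p by (rule prime_gt_0_nat)
  have fin: "finite (carrier G)" using card p0 by (metis card_ge_0_finite)
  have "carrier G \<noteq> {\<one>}" using card prime_gt_1_nat[OF p] by auto
  then obtain g where g: "g \<in> carrier G" "g \<noteq> \<one>" using one_closed by blast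
  have gp: "g [^] p = \<one>" using pow_order_eq_1[OF g(1)] card by (simp add: Coset.order_def)
  let ?h = "\<lambda>i::int. g [^] nat i"
  have hom: "?h \<in> hom (integer_mod_group p) G"
  proof (rule homI)
    fix i j assume "i \<in> carrier (integer_mod_group p)" "j \<in> carrier (integer_mod_group p)"
    then have ij: "i \<ge> 0" "j \<ge> 0" using p0 by (auto simp: carrier_integer_mod_group)
    then have "nat ((i + j) mod int p) = (nat i + nat j) mod p" using p0 by (simp add: nat_mod_distrib nat_add_distrib)
    then show "?h (i \<otimes>\<^bsub>integer_mod_group p\<^esub> j) = ?h i \<otimes> ?h j"
      using nat_pow_eq_pow_mod[OF g(1) gp, of "nat i + nat j"] g(1) by (simp add: nat_pow_mult)
  qed (use g in simp)
  have inj: "inj_on ?h (carrier (integer_mod_group p))"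
  proof (rule inj_onI)
    fix i j assume "i \<in> carrier (integer_mod_group p)" "j \<in> carrier (integer_mod_group p)" "?h i = ?h j"
    then show "i = j" using nat_pow_eq_iff[OF p g gp, of "nat i" "nat j"] p0
      by (auto simp: carrier_integer_mod_group nat_less_iff)
  qed
  have "card (?h ` carrier (integer_mod_group p)) = card (carrier G)"
    using card_image[OF inj] card p0 by (simp add: carrier_integer_mod_group)
  then have "?h ` carrier (integer_mod_group p) = carrier G"
    using g by (intro card_subset_eq[OF fin]) auto
  then have "?h \<in> Group.iso (integer_mod_group p) G"
    using hom inj by (simp add: Group.iso_def bij_betw_def)
  then have "integer_mod_group p \<cong> G" by (auto simp: is_iso_def)
  then show ?thesis using group.iso_sym[OF group_integer_mod_group] by blast
qed

lemma card_of_iso_integer_mod_group: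
  assumes "n > 0" "subgroup_monoid G K \<cong> integer_mod_group n"
  shows "card K = n"
proof -
  obtain h where "h \<in> Group.iso (subgroup_monoid G K) (integer_mod_group n)" using assms(2) by (auto simp: is_iso_def)
  then have "bij_betw h K {0..<int n}" using assms(1) by (simp add: Group.iso_def carrier_integer_mod_group)
  then show ?thesis by (simp add: bij_betw_same_card)
qed

text \<open>\<open>ker_char\<close> is given by character values; on the centre it agrees with the
  kernel of the representation, by \<open>central_in_ker_iff\<close>, and so is a subgroup
  there.\<close>

lemma ker_center_subgroup:
  assumes G: "group G" and \<chi>: "\<chi> \<in> Irr G"
  shows "subgroup (ker_char G \<chi> \<inter> center G) G"
proof -
  obtain n \<rho> where \<rho>: "irreducible_representation G n \<rho>" "\<chi> = character_of G n \<rho>" using \<chi> by (rule IrrE)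
  note R = representationD[OF G irreducible_representationD(1)[OF \<rho>(1)]]
  have eq: "ker_char G \<chi> \<inter> center G = {z \<in> center G. \<rho> z = 1\<^sub>m n}"
    using central_in_ker_iff[OF G \<rho>(1)] \<rho>(2) by auto
  note Z = group.center_subgroup[OF G]
  show ?thesis unfolding eq
  proof (rule group.subgroupI[OF G])
    show "{z \<in> center G. \<rho> z = 1\<^sub>m n} \<noteq> {}" using subgroup.one_closed[OF Z] R(3) by auto
    fix z assume z: "z \<in> {z \<in> center G. \<rho> z = 1\<^sub>m n}"
    have zG: "z \<in> carrier G" using z by (simp add: centralizer_def)
    have iG: "inv\<^bsub>G\<^esub> z \<in> carrier G" using group.inv_closed[OF G zG] .
    have "\<rho> (inv\<^bsub>G\<^esub> z) = \<rho> (inv\<^bsub>G\<^esub> z) * \<rho> z" using z R(1)[OF iG] by simp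
    also have "\<dots> = 1\<^sub>m n" using R(2)[OF iG zG] R(3) group.l_inv[OF G zG] by simp
    finally show "inv\<^bsub>G\<^esub> z \<in> {z \<in> center G. \<rho> z = 1\<^sub>m n}" using z subgroup.m_inv_closed[OF Z] by simp
  next
    fix z w assume zw: "z \<in> {z \<in> center G. \<rho> z = 1\<^sub>m n}" "w \<in> {z \<in> center G. \<rho> z = 1\<^sub>m n}"
    then have "\<rho> (z \<otimes>\<^bsub>G\<^esub> w) = 1\<^sub>m n" using R(2)[of z w] group.centerD(1)[OF G] by simp
    then show "z \<otimes>\<^bsub>G\<^esub> w \<in> {z \<in> center G. \<rho> z = 1\<^sub>m n}" using zw subgroup.m_closed[OF Z] by simp
  qed (auto simp: centralizer_def)
qed

lemma lift_in_nl_over_iff: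
  assumes K: "K \<lhd> G" and \<chi>: "\<chi> \<in> Irr (G Mod K)"
  shows "lift_char G K \<chi> \<in> nl_over G (center G) \<longleftrightarrow> \<chi> \<in> nl_over (G Mod K) (quotient_set G K (center G))"
proof -
  have one: "lift_char G K \<chi> \<one>\<^bsub>G\<^esub> = \<chi> \<one>\<^bsub>G Mod K\<^esub>" by (rule lift_char_one[OF K])
  have "center G \<subseteq> ker_char G (lift_char G K \<chi>) \<longleftrightarrow> quotient_set G K (center G) \<subseteq> ker_char (G Mod K) \<chi>"
    using one by (auto simp: ker_char_def quotient_set_def carrier_FactGroup centralizer_def lift_char_def subset_iff)
  then show ?thesis using one \<chi> lift_char_Irr[OF K \<chi>] by (simp add: nl_over_def nl_def)
qed

lemma central_values_root_of_unity:
  assumes G: "group G" and irr: "irreducible_representation G n \<rho>" and z: "z \<in> center G" "z [^]\<^bsub>G\<^esub> p = \<one>\<^bsub>G\<^esub>"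
    and c: "\<rho> z = c \<cdot>\<^sub>m 1\<^sub>m n"
  shows "c ^ p = 1"
proof -
  note D = irreducible_representationD[OF irr]
  note R = representationD[OF G D(1)]
  have zG: "z \<in> carrier G" using z(1) by (simp add: centralizer_def)
  have "\<rho> (z [^]\<^bsub>G\<^esub> k) = c ^ k \<cdot>\<^sub>m 1\<^sub>m n" for k :: nat
  proof (induction k)
    case (Suc k)
    interpret group G by fact
    have "\<rho> (z [^]\<^bsub>G\<^esub> Suc k) = (c ^ k \<cdot>\<^sub>m 1\<^sub>m n) * (c \<cdot>\<^sub>m 1\<^sub>m n)" using R(2)[of "z [^]\<^bsub>G\<^esub> k" z] zG Suc c by simp
    then show ?case by (simp add: mult_smult_distrib[of _ n n _ n] mult_smult_assoc_mat[of _ n n _ n] smult_smult_mat mult.commute)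
  qed (simp add: R(3) one_smult_mat group.is_monoid[OF G] monoid.nat_pow_0)
  then have "c ^ p \<cdot>\<^sub>m 1\<^sub>m n = 1\<^sub>m n" using z(2) R(3) by metis
  then have "(c ^ p \<cdot>\<^sub>m 1\<^sub>m n) $$ (0, 0) = 1\<^sub>m n $$ (0, 0)" by simp
  then show ?thesis using D(2) by simp
qed

(* A nontrivial central character of an elementary abelian centre of order p^2 has a kernel of order p. *)
lemma bij_betw_lift_char_center:
  fixes G (structure)
  assumes G: "group G" and fin: "finite (carrier G)" and p: "prime p" and cZ: "card (center G) = p\<^sup>2"
    and exp: "\<And>z. z \<in> center G \<Longrightarrow> z [^] p = \<one>"
  shows "bij_betw (\<lambda>(K, \<chi>'). lift_char G K \<chi>')
    (SIGMA K : {K. subgroup K G \<and> K \<subset> center G \<and> subgroup_monoid G K \<cong> integer_mod_group p}.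
       nl_over (G Mod K) (quotient_set G K (center G)))
    (nl_over G (center G))"
proof -
  interpret group G by fact
  have p0: "p > 0" using p by (rule prime_gt_0_nat)
  have finZ: "finite (center G)" using cZ p0 by (metis card_ge_0_finite zero_less_power)
  let ?S = "{K. subgroup K G \<and> K \<subset> center G \<and> subgroup_monoid G K \<cong> integer_mod_group p}"
  have S: "K \<lhd> G" "K \<subseteq> center G" "card K = p" "subgroup K G" if "K \<in> ?S" for K
    using that central_subgroup_normal card_of_iso_integer_mod_group[OF p0] by auto
  let ?N = "\<lambda>\<chi>. ker_char G \<chi> \<inter> center G"
  have N: "subgroup (?N \<chi>) G" "card (?N \<chi>) \<in> {1, p}" if \<chi>: "\<chi> \<in> nl_over G (center G)" for \<chi>
  proof -
    show sub: "subgroup (?N \<chi>) G" using ker_center_subgroup[OF G] \<chi> by (auto simp: nl_over_def nl_def)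
    have "subgroup (?N \<chi>) (subgroup_monoid G (center G))"
      using subgroup_incl[OF sub center_subgroup] by simp
    then have "card (rcosets\<^bsub>subgroup_monoid G (center G)\<^esub> (?N \<chi>)) * card (?N \<chi>) = card (center G)"
      using group.lagrange[OF subgroup_imp_group[OF center_subgroup], of "?N \<chi>"] by (simp add: Coset.order_def)
    then have "card (?N \<chi>) dvd card (center G)" by (metis dvd_triv_right)
    then obtain i where i: "i \<le> 2" "card (?N \<chi>) = p ^ i" using cZ divides_primepow_nat[OF p] by auto
    have "i \<noteq> 2"
    proof
      assume "i = 2"
      then have "?N \<chi> = center G" using i(2) cZ card_subset_eq[OF finZ, of "?N \<chi>"] by simp
      then show False using \<chi> by (auto simp: nl_over_def)
    qed
    then have "i = 0 \<or> i = 1" using i(1) by linarith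
    then show "card (?N \<chi>) \<in> {1, p}" using i(2) by auto
  qed
  have N_p: "card (?N \<chi>) = p" if \<chi>: "\<chi> \<in> nl_over G (center G)" for \<chi>
  proof (rule ccontr)
    assume "card (?N \<chi>) \<noteq> p"
    then have "card (?N \<chi>) = 1" using N(2)[OF \<chi>] by simp
    then have triv: "?N \<chi> = {\<one>}" using subgroup.one_closed[OF N(1)[OF \<chi>]] by (metis card_1_singletonE singletonD)
    have "\<chi> \<in> Irr G" using \<chi> by (simp add: nl_over_def nl_def)
    then obtain n \<rho> where \<rho>: "irreducible_representation G n \<rho>" "\<chi> = character_of G n \<rho>" by (rule IrrE)
    note R = representationD[OF G irreducible_representationD(1)[OF \<rho>(1)]]
    obtain \<mu> where l: "\<And>z. z \<in> center G \<Longrightarrow> \<rho> z = \<mu> z \<cdot>\<^sub>m 1\<^sub>m n"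
      using central_scalar[OF G \<rho>(1)] by metis
    \<comment> \<open>If the kernel met the centre trivially, the scalars would embed a group of
      order p^2 into the p-th roots of unity, of which there are p.\<close>
    have "inj_on \<mu> (center G)"
    proof (rule inj_onI)
      fix z w assume zw: "z \<in> center G" "w \<in> center G" "\<mu> z = \<mu> w"
      have G': "z \<in> carrier G" "w \<in> carrier G" using zw centerD by auto
      have "\<rho> z = \<rho> w" using l zw by simp
      then have "\<rho> (z \<otimes> inv w) = 1\<^sub>m n" using R(2)[of z "inv w"] R(2)[of w "inv w"] R(3) G' by simp
      moreover have zw': "z \<otimes> inv w \<in> center G"
        using zw subgroup.m_closed[OF center_subgroup] subgroup.m_inv_closed[OF center_subgroup] by blast
      ultimately have "z \<otimes> inv w \<in> ?N \<chi>" using central_in_ker_iff[OF G \<rho>(1) zw'] \<rho>(2) by simp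
      then have "z \<otimes> inv w = \<one>" using triv by blast
      then show "z = w" using G' by (metis inv_equality inv_inv inv_closed)
    qed
    moreover have "\<mu> ` center G \<subseteq> {w. w ^ p = 1}"
      using central_values_root_of_unity[OF G \<rho>(1) _ exp l] by blast
    ultimately have "card (center G) \<le> card {w::complex. w ^ p = 1}"
      using finite_roots_unity[of p] p0 by (intro card_inj_on_le) auto
    then have "p * p \<le> p" using cZ card_roots_unity_eq[OF p0] by (simp add: power2_eq_square)
    then show False using prime_gt_1_nat[OF p] by simp
  qed
  \<comment> \<open>K lies in this intersection and has the same order p, so it can be recovered
    from the lifted character. This makes the union disjoint.\<close>
  have K_eq: "K = ?N (lift_char G K \<chi>)" if "K \<in> ?S" "lift_char G K \<chi> \<in> nl_over G (center G)" for K \<chi>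
    using S[OF that(1)] lift_char_ker[of K G \<chi>] N_p[OF that(2)] finZ by (intro card_subset_eq) auto
  have lift: "lift_char G K \<chi> \<in> nl_over G (center G)" if "K \<in> ?S" "\<chi> \<in> nl_over (G Mod K) (quotient_set G K (center G))" for K \<chi>
    using lift_in_nl_over_iff[OF S(1)[OF that(1)], of \<chi>] that(2) by (auto simp: nl_over_def nl_def)
  show ?thesis
    unfolding bij_betw_def
  proof (intro conjI subset_antisym subsetI)
    show "inj_on (\<lambda>(K, \<chi>'). lift_char G K \<chi>') (SIGMA K : ?S. nl_over (G Mod K) (quotient_set G K (center G)))"
    proof (rule inj_onI)
      fix s t assume st: "s \<in> (SIGMA K : ?S. nl_over (G Mod K) (quotient_set G K (center G)))"
        "t \<in> (SIGMA K : ?S. nl_over (G Mod K) (quotient_set G K (center G)))"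
        "(case s of (K, \<chi>) \<Rightarrow> lift_char G K \<chi>) = (case t of (K, \<chi>) \<Rightarrow> lift_char G K \<chi>)"
      obtain K \<chi> K' \<chi>' where s: "s = (K, \<chi>)" "t = (K', \<chi>')" by (cases s, cases t)
      have h: "K \<in> ?S" "K' \<in> ?S" "\<chi> \<in> nl_over (G Mod K) (quotient_set G K (center G))"
        "\<chi>' \<in> nl_over (G Mod K') (quotient_set G K' (center G))" "lift_char G K \<chi> = lift_char G K' \<chi>'"
        using st unfolding s by auto
      have "K = K'" using K_eq[OF h(1) lift[OF h(1,3)]] K_eq[OF h(2) lift[OF h(2,4)]] h(5) by simp
      moreover from this have "\<chi> = \<chi>'" using h(3-5) inj_on_lift_char[of G K] by (auto simp: nl_over_def nl_def dest: inj_onD)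
      ultimately show "s = t" by (simp add: s)
    qed
  next
    fix \<chi> assume \<chi>: "\<chi> \<in> nl_over G (center G)"
    let ?K = "?N \<chi>"
    have "subgroup_monoid G ?K \<cong> integer_mod_group p"
      using group.prime_order_iso[OF subgroup_imp_group[OF N(1)[OF \<chi>]] p] N_p[OF \<chi>] by simp
    moreover have "?K \<noteq> center G" using N_p[OF \<chi>] cZ prime_gt_1_nat[OF p] by (auto simp: power2_eq_square)
    ultimately have K: "?K \<in> ?S" using N(1)[OF \<chi>] by blast
    obtain \<chi>' where \<chi>': "\<chi>' \<in> Irr (G Mod ?K)" "\<chi> = lift_char G ?K \<chi>'"
      using lift_char_surj[OF S(1,2)[OF K], of \<chi>] \<chi> by (auto simp: nl_over_def nl_def)
    then have "\<chi>' \<in> nl_over (G Mod ?K) (quotient_set G ?K (center G))"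
      using lift_in_nl_over_iff[OF S(1)[OF K] \<chi>'(1)] \<chi> by simp
    then show "\<chi> \<in> (\<lambda>(K, \<chi>'). lift_char G K \<chi>') ` (SIGMA K : ?S. nl_over (G Mod K) (quotient_set G K (center G)))"
      using K \<chi>'(2) by (intro image_eqI[of _ _ "(?K, \<chi>')"]) auto
  qed (use lift in auto)
qed

section \<open>Recognising the structure in the family and in the presented groups\<close>

lemma in_Phi3_phi3_order5:
  assumes p: "prime p" "p \<ge> 5" and G: "order G = p ^ 5" and fam: "in_Phi3 p G"
  shows "\<exists>a b c d. phi3_order5 G a b c d p"
proof -
  obtain H :: "nat monoid" and x where H: "order H = p ^ 4" "p_presentation p (Phi3_1111 p) H x" "isoclinic G H"
    using fam by (auto simp: in_Phi3_def p_presented_by_def)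
  then have pH: "p_group p H" "satisfies_rels H x (Phi3_1111 p)" "generate H (range x) = carrier H"
    by (auto simp: p_presentation_def)
  interpret H: group H using pH(1) by (simp add: p_group_def)
  have sat: "phi3_sat H x p 1 0 0 p" using pH(2) by (simp add: H.satisfies_rels_iff_phi3_sat)
  have "card (carrier H) = p ^ 3 * p" using H(1) by (simp add: Coset.order_def numeral_eq_Suc)
  then have "phi3 H (x Alpha) (x Alpha1) (x Alpha2) (commutator H (x Alpha2) (x Alpha)) p"
    using H.phi3_sat_structure(2)[OF pH(1) p(1) sat _ _ pH(3)] p by simp
  moreover have fin: "finite (carrier G)" using G p by (metis card.infinite Coset.order_def power_eq_0_iff not_prime_0)
  ultimately obtain a b c d where "phi3 G a b c d p" using isoclinic_phi3[OF H(3)] by blast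
  then have "phi3_order5 G a b c d p"
    using G by (simp add: phi3_order5_def phi3_order5_axioms_def Coset.order_def)
  then show ?thesis by blast
qed

text \<open>If the p-th power of alpha_1 were a power of \<delta>, the order bound with m' = p would
  give p^5 <= p^4.\<close>

lemma (in group) phi3_order5_of_sat:
  assumes p: "prime p" "p \<ge> 5" and card: "order G = p ^ 5" and G: "p_group p G" and sat: "phi3_sat G x p r s t (p\<^sup>2)"
    and r: "coprime r p" and gen: "generate G (range x) = carrier G"
  defines "\<delta> \<equiv> commutator G (x Alpha2) (x Alpha)"
  shows "phi3_order5 G (x Alpha) (x Alpha1) (x Alpha2) \<delta> p" "x Alpha1 [^] p \<noteq> \<delta> [^] (l::nat)"
proof -
  have m: "p\<^sup>2 > 0" "card (carrier G) = p ^ 3 * p\<^sup>2" using p card by (auto simp: power_add[symmetric] Coset.order_def)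
  note st = phi3_sat_structure[OF G p(1) sat r m(1) gen, folded \<delta>_def]
  show "phi3_order5 G (x Alpha) (x Alpha1) (x Alpha2) \<delta> p"
    using st(2)[OF p(2) m(2)] card by (simp add: phi3_order5_def phi3_order5_axioms_def Coset.order_def)
  show "x Alpha1 [^] p \<noteq> \<delta> [^] l"
  proof
    assume "x Alpha1 [^] p = \<delta> [^] l"
    then have "card (carrier G) \<le> p ^ 3 * p" using st(3)[of p l] p by simp
    then have "p * p \<le> p" using m p by (simp add: power2_eq_square)
    then show False using p by simp
  qed
qed

context phi3_order5
begin

lemma center_exponent_p:
  assumes b: "\<And>l. b [^] p \<noteq> d [^] (l::nat)" and b2: "b [^] p\<^sup>2 = \<one>" and z: "z \<in> center G"
  shows "z [^] p = \<one>"
proof -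
  obtain i j :: nat where ij: "z = (b [^] p) [^] i \<otimes> d [^] j" using center_form[OF b z] by blast
  have "z [^] p = ((b [^] p) [^] i) [^] p \<otimes> (d [^] j) [^] p"
    unfolding ij using centerD(2)[OF d_pow_center, of "(b [^] p) [^] i" j] by (intro pow_mult_distrib) auto
  also have "((b [^] p) [^] i) [^] p = (b [^] p\<^sup>2) [^] i" by (simp add: nat_pow_pow power2_eq_square ac_simps)
  also have "(d [^] j) [^] p = (d [^] p) [^] j" by (simp add: nat_pow_pow mult.commute)
  finally show ?thesis using b2 d_pow by simp
qed

lemma required_pair_of_no_presentation:
  assumes no: "\<forall>r \<in> {1, least_nonresidue p}. \<not> p_presented_by p (Phi3_311b p r) G"
      "\<not> p_presented_by p (Phi3_221a p) G" "\<not> p_presented_by p (Phi3_2111e p) G"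
    and \<psi>: "\<psi> \<in> Irr_over (subgroup_monoid G A) D"
  shows "required_pair G (induced_char G A \<psi>) A \<psi>"
proof (rule required_pair_centralizer[OF \<psi>])
  have "\<exists>l. b [^] p = d [^] (l::nat)" using presented_of_b_pow no by blast
  then show "\<psi> d \<noteq> 1 \<or> (\<forall>u\<in>A. \<exists>l. u [^] p = d [^] (l::nat))" using A_pow_p by blast
qed

end

section \<open>Groups in which b has order p^3\<close>

locale phi3_311b = phi3_order5 +
  fixes r :: nat
  assumes b_pow_p2: "b [^] p\<^sup>2 = d [^] r" and r: "\<not> p dvd r" and b_pow_p: "b [^] p \<noteq> d [^] (l::nat)"
begin

lemma d_r_neq: "d [^] r \<noteq> \<one>"
  using r by (simp add: d_pow_one_iff)

text \<open>r is invertible modulo p, so d^r generates the same subgroup as d. As d^r = b^(p^2),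
  this makes d a power of b.\<close>

lemma d_is_power: "\<exists>s. d = (d [^] r) [^] (s::nat)"
proof -
  have "coprime r p" "r \<noteq> 0" using r prime by (metis coprime_commute prime_imp_coprime, metis dvd_0_right)
  then obtain s t where st: "r * s = p * t + 1" using bezout_nat[of r p] by auto
  have "(d [^] r) [^] s = (d [^] p) [^] t \<otimes> d" by (simp add: nat_pow_pow st)
  then show ?thesis using d_pow by (intro exI[of _ s]) simp
qed

text \<open>The centre is generated by b^p and d, and d is a power of b, so only b and c are
  left.\<close>

lemma A_form: "u \<in> A \<Longrightarrow> \<exists>i j. u = nf i j 0"
proof -
  assume u: "u \<in> A"
  obtain j k z where z: "z \<in> center G" "u = nf j k 0 \<otimes> z" using u by (rule AE)
  obtain i l :: nat where il: "z = (b [^] p) [^] i \<otimes> d [^] l" using center_form[OF b_pow_p z(1)] by blast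
  obtain s :: nat where s: "d = (d [^] r) [^] s" using d_is_power by blast
  have "d = b [^] (p\<^sup>2 * s)" using s by (simp add: b_pow_p2[symmetric] nat_pow_pow)
  then have "d [^] l = nf (p\<^sup>2 * s * l) 0 0" by (metis closed(2) nat_pow_pow nf_powers(1))
  then have "z = nf (p * i + p\<^sup>2 * s * l) 0 0" using nf_powers(1)[of "p * i"] by (simp add: il nat_pow_pow nf_mult)
  then have "u = nf (j + (p * i + p\<^sup>2 * s * l)) k 0" by (simp add: z(2) nf_mult)
  then show ?thesis by blast
qed

lemma A_generate: "A = generate G {b, c}"
proof
  let ?H = "generate G {b, c}"
  have H: "subgroup ?H G" by (rule generate_is_subgroup) simp
  have pw: "x [^] (n::nat) \<in> ?H" if "x \<in> ?H" for x n
    using that subgroup.one_closed[OF H] subgroup.m_closed[OF H] by (induction n) auto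
  have "b \<in> ?H" "c \<in> ?H" by (auto intro: generate.incl)
  then have "nf i j 0 \<in> ?H" for i j using pw subgroup.m_closed[OF H] by (simp add: nf_def)
  then show "A \<subseteq> ?H" using A_form by blast
  show "?H \<subseteq> A" by (rule generate_subgroup_incl[OF _ A_subgroup]) (use gens_A in auto)
qed

lemma b_pow_p3: "b [^] p ^ 3 = \<one>"
proof -
  have "b [^] p ^ 3 = (b [^] p\<^sup>2) [^] p" by (simp add: nat_pow_pow power2_eq_square power3_eq_cube mult.assoc)
  also have "\<dots> = (d [^] p) [^] r" by (simp add: b_pow_p2 nat_pow_pow mult.commute)
  finally show ?thesis using d_pow by simp
qed

lemma b_pow_one: "b [^] i = \<one> \<Longrightarrow> p ^ 3 dvd i"
proof -
  assume i: "b [^] i = \<one>"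
  have dv: "ord b dvd p ^ 3" using b_pow_p3 by (simp add: pow_eq_id)
  then obtain k where k: "k \<le> 3" "ord b = p ^ k" using divides_primepow_nat[OF prime] by blast
  have "k = 3"
  proof (rule ccontr)
    assume "k \<noteq> 3"
    then have "k \<le> 2" using k(1) by simp
    then have "ord b dvd p\<^sup>2" using k(2) by (simp add: le_imp_power_dvd)
    then have "b [^] p\<^sup>2 = \<one>" by (simp add: pow_eq_id)
    then show False using b_pow_p2 d_r_neq by simp
  qed
  then show ?thesis using i k(2) by (simp add: pow_eq_id)
qed

lemma A_iso: "subgroup_monoid G A \<cong> integer_mod_group (p ^ 3) \<times>\<times> integer_mod_group p"
proof -
  let ?P = "integer_mod_group (p ^ 3) \<times>\<times> integer_mod_group p" and ?A = "subgroup_monoid G A"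
  let ?h = "\<lambda>(i::int, j::int). nf (nat i) (nat j) 0"
  have p0: "p > 0" "p ^ 3 > 0" using p5 by auto
  have car: "carrier ?P = {0..<int (p ^ 3)} \<times> {0..<int p}" using p0 by (simp add: carrier_integer_mod_group)
  have red: "nf i j 0 = nf (i mod p ^ 3) (j mod p) 0" for i j
    unfolding nf_def using nat_pow_eq_pow_mod[OF closed(2) b_pow_p3, of i] nat_pow_eq_pow_mod[OF closed(3) c_pow, of j] by simp
  have hom: "?h \<in> hom ?P ?A"
  proof (rule homI)
    fix x y assume "x \<in> carrier ?P" "y \<in> carrier ?P"
    then obtain i j i' j' where xy: "x = (i, j)" "y = (i', j')" "i \<ge> 0" "j \<ge> 0" "i' \<ge> 0" "j' \<ge> 0"
      unfolding car by auto
    have e: "nat ((i + i') mod int (p ^ 3)) = (nat i + nat i') mod p ^ 3" "nat ((j + j') mod int p) = (nat j + nat j') mod p"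
      using xy p0 by (simp_all add: nat_mod_distrib nat_add_distrib del: of_nat_power)
    have "?h (x \<otimes>\<^bsub>?P\<^esub> y) = nf ((nat i + nat i') mod p ^ 3) ((nat j + nat j') mod p) 0"
      using xy(1,2) by (simp add: e del: of_nat_power)
    also have "\<dots> = nf (nat i + nat i') (nat j + nat j') 0" by (rule red[symmetric])
    finally show "?h (x \<otimes>\<^bsub>?P\<^esub> y) = ?h x \<otimes>\<^bsub>?A\<^esub> ?h y" using xy(1,2) by (simp add: nf_mult)
  qed (auto simp: nf_A)
  interpret P: group ?P by (intro DirProd_group group_integer_mod_group)
  interpret h: group_hom ?P ?A ?h
    using hom P.is_group subgroup_imp_group[OF A_subgroup] by (simp add: group_hom_def group_hom_axioms_def)
  have "?h \<in> Group.iso ?P ?A"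
    unfolding h.iso_iff
  proof (intro conjI ballI impI)
    show "carrier ?A \<subseteq> ?h ` carrier ?P"
    proof
      fix u assume "u \<in> carrier ?A"
      then have "u \<in> A" by simp
      then obtain i j where "u = nf i j 0" using A_form by blast
      then have "u = ?h (int (i mod p ^ 3), int (j mod p))" using red by simp
      moreover have "(int (i mod p ^ 3), int (j mod p)) \<in> carrier ?P"
        unfolding car using p0 by (simp del: of_nat_power)
      ultimately show "u \<in> ?h ` carrier ?P" by blast
    qed
    fix x assume "x \<in> carrier ?P" and one: "?h x = \<one>\<^bsub>?A\<^esub>"
    then obtain i j where x: "x = (int i, int j)" "i < p ^ 3" "j < p"
      unfolding car by (auto simp del: of_nat_power) (metis nat_0_le nat_less_iff)
    have nf1: "nf i j 0 = \<one>" using one x by simp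
    \<comment> \<open>Conjugating b^i c^j = 1 by a yields c^i d^j = 1. So c^i is central and p
      divides i; then p divides j, and what remains is b^i = 1.\<close>
    then have "a \<otimes> nf i (i + j) j = a \<otimes> \<one>" using nf_a[of i j 0] by simp
    then have "nf i (i + j) j = \<one>" using l_cancel[of a "nf i (i + j) j" \<one>] by simp
    moreover have "nf i (i + j) j = nf i j 0 \<otimes> nf 0 i j" by (simp add: nf_mult add.commute)
    ultimately have "nf 0 i j = \<one>" using nf1 by (metis l_one nf_closed)
    then have cd: "c [^] i \<otimes> d [^] j = \<one>" by (simp add: nf_def)
    then have "c [^] i = inv (d [^] j)" by (simp add: inv_equality)
    then have "c [^] i \<in> center G" using d_pow_center subgroup.m_inv_closed[OF center_subgroup] by simp
    then have "p dvd i" by (simp add: c_pow_center_iff)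
    then have "c [^] i = \<one>" by (simp add: c_pow_one_iff)
    then have "d [^] j = \<one>" using cd by simp
    then have "p dvd j" by (simp add: d_pow_one_iff)
    then have j: "j = 0" using x(3) by (auto dest: dvd_imp_le)
    then have "b [^] i = \<one>" using nf1 by (simp add: nf_def)
    then have "p ^ 3 dvd i" by (rule b_pow_one)
    then have "i = 0" using x(2) by (auto dest: dvd_imp_le)
    then show "x = \<one>\<^bsub>?P\<^esub>" using x j by simp
  qed
  then have "?P \<cong> ?A" by (auto simp: is_iso_def)
  then show ?thesis using P.iso_sym by blast
qed

text \<open>These equations tie the order of psi(b) to psi(d): as p does not divide r, psi(b) is a
  primitive p^3-th root of unity exactly when psi(d) \<noteq> 1.\<close>

lemma char_b_values:
  assumes "linear_character (subgroup_monoid G A) \<psi>"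
  shows "\<psi> b ^ p\<^sup>2 = \<psi> d ^ r" "\<psi> b ^ (p ^ 3) = 1"
proof -
  note L = linear_character_subgroup[OF is_group A_subgroup assms]
  show "\<psi> b ^ p\<^sup>2 = \<psi> d ^ r"
    using L(5)[OF gens_A(1), of "p\<^sup>2"] L(5)[OF gens_A(3), of r] b_pow_p2 by simp
  show "\<psi> b ^ (p ^ 3) = 1" using L(5)[OF gens_A(1), of "p ^ 3"] L(1) b_pow_p3 by simp
qed

text \<open>All values of psi are products of powers of psi(b) and psi(c), with psi(c)^p = 1. If
  psi(d) \<noteq> 1, then psi(b) lies in the field and has order p^3. Otherwise all values are
  p^2-th roots of unity, contained in a subfield that misses the p^3-th root
  \<open>zeta (p ^ 3)\<close>.\<close>

lemma char_field_eq_iff: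
  assumes \<chi>: "\<chi> \<in> nl G"
  shows "char_field G \<chi> \<noteq> rat_adjoin {zeta (p ^ 3)} \<longleftrightarrow> d \<in> ker_char G \<chi>"
proof -
  obtain \<psi> \<kappa> where \<psi>: "nontrivial_on_derived \<psi>" and \<kappa>: "\<kappa> \<noteq> 0" "\<And>F. csubfield F \<Longrightarrow> \<kappa> \<in> F"
    and ind: "\<And>g. g \<in> carrier G \<Longrightarrow> \<chi> g = \<kappa> * induced_char G A \<psi> g"
    using nl_multiple_of_induced[OF \<chi>] by blast
  have lc: "linear_character (subgroup_monoid G A) \<psi>" using \<psi> by (simp add: nontrivial_on_derived_def)
  note V = char_D_values[OF lc] char_b_values[OF lc]
  let ?z = "zeta (p ^ 3)" and ?Q = "rat_adjoin {zeta (p ^ 3)}"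
  have p1: "p > 1" "p ^ 3 = p ^ Suc 2" using p5 by auto
  have z: "?z ^ (p ^ Suc 2) = 1" "?z ^ (p\<^sup>2) \<noteq> 1"
  proof -
    show "?z ^ (p ^ Suc 2) = 1" unfolding p1(2)[symmetric] using p1(1) by (intro zeta_power_self) simp
    show "?z ^ (p\<^sup>2) \<noteq> 1" using p1(1) by (intro zeta_power_neq_one power_strict_increasing) auto
  qed
  have Q: "csubfield ?Q" "?z \<in> ?Q" using csubfield_rat_adjoin rat_adjoin_superset[of "{?z}"] by auto
  have val: "\<exists>i j. \<psi> u = \<psi> b ^ i * \<psi> c ^ j" if u: "u \<in> A" for u
  proof -
    obtain i j where "u = nf i j 0" using A_form[OF u] by blast
    then show ?thesis using V(1)[of i j 0] by auto
  qed
  have in_field: "char_field G \<chi> \<subseteq> F" if F: "csubfield F" "\<psi> b \<in> F" "\<psi> c \<in> F" for F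
  proof (rule char_field_induced_le[OF A_normal F(1) _ \<kappa>(2)[OF F(1)] ind])
    fix u assume "u \<in> A"
    then obtain i j where "\<psi> u = \<psi> b ^ i * \<psi> c ^ j" using val by blast
    then show "\<psi> u \<in> F" using csubfield_power[OF F(1)] F csubfieldD(5)[OF F(1)] by simp
  qed
  have "\<psi> c ^ (p ^ Suc n) = 1" for n using V(2) by (simp add: power_mult)
  note cpow = this
  have bpow: "\<psi> b ^ (p ^ Suc 2) = 1" using V(5) by (simp only: p1(2))
  show ?thesis
  proof (cases "\<psi> d = 1")
    case False
    have "\<psi> b ^ p\<^sup>2 \<noteq> 1" using V(4) power_neq_one[OF V(3) False r] by simp
    then obtain i where i: "?z = \<psi> b ^ i"
      using root_of_unity_power[OF prime bpow _ z(1)] by blast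
    have "\<psi> b \<in> char_field G \<chi>" by (rule values_in_char_field[OF \<psi> \<kappa> ind]) (use False gens_A in auto)
    then have "?z \<in> char_field G \<chi>" unfolding i by (intro csubfield_power) (simp_all add: char_field_def csubfield_rat_adjoin)
    then have "?Q \<subseteq> char_field G \<chi>" by (intro rat_adjoin_least) (simp_all add: char_field_def csubfield_rat_adjoin)
    moreover have "\<psi> b \<in> ?Q"
      using root_of_unity_power[OF prime z bpow] csubfield_power[OF Q] by auto
    moreover have "\<psi> c \<in> ?Q"
      using root_of_unity_power[OF prime z cpow] csubfield_power[OF Q] by auto
    ultimately have "char_field G \<chi> = ?Q" using in_field[OF Q(1)] by blast
    then show ?thesis using d_in_ker_iff[OF \<psi> \<kappa>(1) ind] False by blast
  next
    case True
    obtain F where F: "csubfield F" "?z ^ p \<in> F" "?z \<notin> F"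
      using prime_power_root_not_in_subfield[OF prime z] by auto
    have zp: "(?z ^ p) ^ (p ^ Suc 1) = 1" "(?z ^ p) ^ (p ^ 1) \<noteq> 1"
    proof -
      have e: "p * p ^ Suc 1 = p ^ Suc 2" "p * p ^ 1 = p\<^sup>2" by (simp_all add: numeral_eq_Suc)
      show "(?z ^ p) ^ (p ^ Suc 1) = 1" "(?z ^ p) ^ (p ^ 1) \<noteq> 1"
        unfolding power_mult[symmetric] e by (fact z)+
    qed
    have "\<psi> b ^ (p ^ Suc 1) = 1" using V(4) True by (simp add: power2_eq_square)
    then have "\<psi> b \<in> F"
      using root_of_unity_power[OF prime zp, of "\<psi> b"] csubfield_power[OF F(1,2)] by auto
    moreover have "\<psi> c \<in> F"
      using root_of_unity_power[OF prime zp cpow] csubfield_power[OF F(1,2)] by auto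
    ultimately have "char_field G \<chi> \<subseteq> F" by (rule in_field[OF F(1)])
    then show ?thesis using d_in_ker_iff[OF \<psi> \<kappa>(1) ind] True F(3) Q(2) by blast
  qed
qed

text \<open>d is a power of d^r, so K contains d, and K lies in a kernel as soon as d does.\<close>

lemma generate_d_r:
  defines "K \<equiv> generate G {d [^] r}"
  shows "subgroup K G" "K \<subset> center G" "\<And>\<chi>. \<chi> \<in> nl G \<Longrightarrow> K \<subseteq> ker_char G \<chi> \<longleftrightarrow> d \<in> ker_char G \<chi>"
proof -
  show K: "subgroup K G" unfolding K_def by (rule generate_is_subgroup) simp
  have sub: "K \<subseteq> center G" unfolding K_def
    by (rule generate_subgroup_incl[OF _ center_subgroup]) (use d_pow_center in simp)
  have dK: "d \<in> K"
  proof -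
    obtain s :: nat where s: "d = (d [^] r) [^] s" using d_is_power by blast
    have "(d [^] r) [^] n \<in> K" for n :: nat
      unfolding K_def by (induction n) (auto intro: generate.intros)
    then show ?thesis using s by metis
  qed
  \<comment> \<open>K is contained in D, which has exponent p, whereas (b^p)^p = d^r is nontrivial.
    This makes K a proper subgroup of the centre.\<close>
  have "b [^] p \<notin> K"
  proof
    assume "b [^] p \<in> K"
    moreover have "subgroup D G" "d [^] r \<in> D" using D_subgroup by (auto simp: D_def nf_powers)
    then have "K \<subseteq> D" unfolding K_def by (intro generate_subgroup_incl) auto
    ultimately obtain k l where kl: "b [^] p = nf 0 k l" by (auto simp: D_def)
    then have "(b [^] p) [^] p = \<one>" by (simp add: nf_pow) (simp add: nf_def c_pow_one_iff[THEN iffD2] d_pow_one_iff[THEN iffD2])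
    then show False using b_pow_p2 d_r_neq by (simp add: nat_pow_pow power2_eq_square)
  qed
  then show "K \<subset> center G" using sub b_pow by blast
  fix \<chi> assume \<chi>: "\<chi> \<in> nl G"
  have N: "subgroup (ker_char G \<chi> \<inter> center G) G" using ker_center_subgroup[OF is_group] \<chi> by (simp add: nl_def)
  show "K \<subseteq> ker_char G \<chi> \<longleftrightarrow> d \<in> ker_char G \<chi>"
  proof
    assume "d \<in> ker_char G \<chi>"
    then have d: "d \<in> ker_char G \<chi> \<inter> center G" using d_center by blast
    have "d [^] n \<in> ker_char G \<chi> \<inter> center G" for n :: nat
      using d subgroup.one_closed[OF N] subgroup.m_closed[OF N] by (induction n) auto
    then have "K \<subseteq> ker_char G \<chi> \<inter> center G" unfolding K_def by (intro generate_subgroup_incl[OF _ N]) simp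
    then show "K \<subseteq> ker_char G \<chi>" by blast
  qed (use dK in blast)
qed

end

text \<open>In this presentation [alpha_2, alpha] is not itself among the generators; it takes the
  role of d, and alpha_3 is its r-th power.\<close>

lemma phi3_311b_of_presentation:
  fixes G (structure)
  assumes p: "prime p" "p \<ge> 5" and card: "order G = p ^ 5" and r: "r \<in> {1, least_nonresidue p}"
    and pres: "p_presentation p (Phi3_311b p r) G x"
  defines "\<delta> \<equiv> commutator G (x Alpha2) (x Alpha)"
  shows "phi3_311b G (x Alpha) (x Alpha1) (x Alpha2) \<delta> p r" "x Alpha3 = \<delta> [^] r" "x Alpha1 [^] p\<^sup>2 = x Alpha3"
proof -
  have G: "p_group p G" "satisfies_rels G x (Phi3_311b p r)" "generate G (range x) = carrier G"
    using pres by (auto simp: p_presentation_def)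
  interpret group G using G(1) by (simp add: p_group_def)
  have sat: "phi3_sat G x p r 0 1 (p\<^sup>2)" using G(2) by (simp add: satisfies_rels_iff_phi3_sat)
  have cop: "coprime r p" using coprime_one_or_nonresidue[OF p(1) _ r] p(2) by simp
  note st = phi3_order5_of_sat[OF p card G(1) sat cop G(3), folded \<delta>_def]
  have x3: "x Alpha3 \<in> carrier G" using sat by (auto simp: phi3_sat_def)
  show 3: "x Alpha3 = \<delta> [^] r" using sat by (simp add: phi3_sat_def \<delta>_def)
  show 1: "x Alpha1 [^] p\<^sup>2 = x Alpha3" using sat x3 by (simp add: phi3_sat_def)
  have "\<not> p dvd r" using cop p(1) by (metis coprime_absorb_right coprime_commute not_prime_unit)
  then show "phi3_311b G (x Alpha) (x Alpha1) (x Alpha2) \<delta> p r"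
    using st 1 3 by (simp add: phi3_311b_def phi3_311b_axioms_def)
qed

theorem theorem19:
  fixes p :: nat and G :: "('a, 'b) monoid_scheme"
  assumes "prime p" and "p \<ge> 5"
    and "group G" and "order G = p ^ 5" and "in_Phi3 p G"
  shows
    "((\<forall>r \<in> {1, least_nonresidue p}. \<not> p_presented_by p (Phi3_311b p r) G) \<and>
      \<not> p_presented_by p (Phi3_221a p) G \<and> \<not> p_presented_by p (Phi3_2111e p) G \<longrightarrow>
        (\<forall>\<chi> \<in> nl G.
         \<forall>\<psi> \<in> Irr_over (subgroup_monoid G (centralizer G (derived_subgroup G))) (derived_subgroup G).
           \<chi> = induced_char G (centralizer G (derived_subgroup G)) \<psi> \<longrightarrow>
           required_pair G \<chi> (centralizer G (derived_subgroup G)) \<psi>))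
     \<and>
     (p_presented_by p (Phi3_221a p) G \<or> p_presented_by p (Phi3_2111e p) G \<longrightarrow>
        bij_betw (\<lambda>(K, \<chi>'). lift_char G K \<chi>')
          (SIGMA K : {K. subgroup K G \<and> K \<subset> center G \<and>
                         subgroup_monoid G K \<cong> integer_mod_group p}.
             nl_over (G Mod K) (quotient_set G K (center G)))
          (nl_over G (center G)) \<and>
        (\<forall>K. subgroup K G \<and> K \<subset> center G \<and> subgroup_monoid G K \<cong> integer_mod_group p \<longrightarrow>
          (\<forall>\<chi>' \<in> nl_over (G Mod K) (quotient_set G K (center G)). \<forall>\<chi> \<in> nl_over G (center G).
             \<chi> = lift_char G K \<chi>' \<longrightarrow>
             (\<forall>H \<psi>'. subgroup H G \<and> K \<subseteq> H \<and>
                required_pair (G Mod K) \<chi>' (quotient_set G K H) \<psi>' \<longrightarrow>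
                required_pair G \<chi> H (lift_char (subgroup_monoid G H) K \<psi>')))))
     \<and>
     (\<forall>r \<in> {1, least_nonresidue p}. \<forall>x. p_presentation p (Phi3_311b p r) G x \<longrightarrow>
        centralizer G (derived_subgroup G) = generate G {x Alpha1, x Alpha2} \<and>
        subgroup_monoid G (centralizer G (derived_subgroup G))
          \<cong> integer_mod_group (p ^ 3) \<times>\<times> integer_mod_group p \<and>
        (\<forall>\<chi> \<in> nl G.
         \<forall>\<psi> \<in> Irr_over (subgroup_monoid G (centralizer G (derived_subgroup G))) (derived_subgroup G).
           \<chi> = induced_char G (centralizer G (derived_subgroup G)) \<psi> \<and>
           primitive_root_of_unity (p ^ 3) (\<psi> (x Alpha1)) \<longrightarrow>
           required_pair G \<chi> (centralizer G (derived_subgroup G)) \<psi>) \<and>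
        (\<forall>K. K = generate G {x Alpha3} \<longrightarrow>
          K = generate G {x Alpha1 [^]\<^bsub>G\<^esub> (p\<^sup>2)} \<and> K \<subset> center G \<and>
          bij_betw (lift_char G K) (nl (G Mod K))
            {\<chi> \<in> nl G. char_field G \<chi> \<noteq> rat_adjoin {zeta (p ^ 3)}} \<and>
          (\<forall>\<chi>' \<in> nl (G Mod K). \<forall>\<chi> \<in> nl G.
             char_field G \<chi> \<noteq> rat_adjoin {zeta (p ^ 3)} \<and> \<chi> = lift_char G K \<chi>' \<longrightarrow>
             (\<forall>H \<psi>'. subgroup H G \<and> K \<subseteq> H \<and>
                required_pair (G Mod K) \<chi>' (quotient_set G K H) \<psi>' \<longrightarrow>
                required_pair G \<chi> H (lift_char (subgroup_monoid G H) K \<psi>')))))"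
proof (intro conjI impI, goal_cases)
  case 1
  obtain a b c d where "phi3_order5 G a b c d p" using in_Phi3_phi3_order5[OF assms(1,2,4,5)] by blast
  then interpret phi3_order5 G a b c d p .
  show ?case unfolding centralizer_derived_eq unfolding derived_eq using required_pair_of_no_presentation 1 by simp
next
  case 2
  interpret group G by fact
  have fin: "finite (carrier G)"
    using assms(1,4) prime_gt_0_nat[of p] by (metis order_gt_0_iff_finite zero_less_power)
  \<comment> \<open>Both presentations fit the scheme with t = 0, where s is 1 for
    \<open>Phi3_221a\<close> and 0 for \<open>Phi3_2111e\<close>. It is t = 0 that gives the centre
    exponent p.\<close>
  obtain x s where x: "p_group p G" "phi3_sat G x p 1 s 0 (p\<^sup>2)" "generate G (range x) = carrier G"
    using 2 by (auto simp: p_presented_by_def p_presentation_def satisfies_rels_iff_phi3_sat)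
  note st = phi3_order5_of_sat[OF assms(1,2,4) x(1,2) coprime_1_left x(3)]
  interpret P: phi3_order5 G "x Alpha" "x Alpha1" "x Alpha2" "commutator G (x Alpha2) (x Alpha)" p by (rule st(1))
  have "x Alpha1 [^]\<^bsub>G\<^esub> p\<^sup>2 = \<one>\<^bsub>G\<^esub>" using x(2) by (simp add: phi3_sat_def)
  then have exp: "z [^]\<^bsub>G\<^esub> p = \<one>\<^bsub>G\<^esub>" if "z \<in> center G" for z using P.center_exponent_p[OF st(2) _ that] by blast
  show ?case by (rule bij_betw_lift_char_center[OF assms(3) fin assms(1) P.card_center exp])
next
  case 3
  have "finite (carrier G)"
    using assms(1,4) prime_gt_0_nat[of p] group.is_monoid[OF assms(3)]
    by (metis monoid.order_gt_0_iff_finite zero_less_power)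
  then show ?case using required_pair_lift[OF group.central_subgroup_normal[OF assms(3)]] by blast
next
  case 4
  show ?case
  proof (intro ballI allI impI, goal_cases)
    case (1 r x)
    note X = phi3_311b_of_presentation[OF assms(1,2,4) 1]
    interpret P: phi3_311b G "x Alpha" "x Alpha1" "x Alpha2" "commutator G (x Alpha2) (x Alpha)" p r by (rule X(1))
    have a: "required_pair G (induced_char G P.A \<psi>) P.A \<psi>"
      if \<psi>: "\<psi> \<in> Irr_over (subgroup_monoid G P.A) P.D" and prim: "primitive_root_of_unity (p ^ 3) (\<psi> (x Alpha1))" for \<psi>
    proof (rule P.required_pair_centralizer[OF \<psi>], rule disjI1, rule notI)
      let ?S = "subgroup_monoid G P.A"
      \<comment> \<open>psi(d) = 1 would give psi(b)^(p^2) = psi(d)^r = 1, contrary to primitivity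
        of order p^3.\<close>
      assume one: "\<psi> (commutator G (x Alpha2) (x Alpha)) = 1"
      have S: "group ?S" using P.subgroup_imp_group[OF P.A_subgroup] .
      have "\<psi> \<in> lin ?S" by (rule Irr_commutative[OF S]) (use P.A_commute \<psi> in \<open>auto simp: Irr_over_def\<close>)
      then have "linear_character ?S \<psi>" using lin_iff[OF S] by blast
      then have "\<psi> (x Alpha1) ^ p\<^sup>2 = 1" using P.char_b_values(1) one by simp
      moreover have "0 < p\<^sup>2" "p\<^sup>2 < p ^ 3" using assms(2) by (auto simp: power_strict_increasing)
      ultimately show False using prim by (auto simp: primitive_root_of_unity_def)
    qed
    let ?K = "generate G {x Alpha3}"
    \<comment> \<open>The kernel condition of \<open>bij_betw_lift_char\<close> and the field
      condition of the claim both amount to d being in the kernel of the character.\<close>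
    have K: "subgroup ?K G" "?K \<subset> center G"
      "\<And>\<chi>. \<chi> \<in> nl G \<Longrightarrow> ?K \<subseteq> ker_char G \<chi> \<longleftrightarrow> char_field G \<chi> \<noteq> rat_adjoin {zeta (p ^ 3)}"
      using P.generate_d_r P.char_field_eq_iff by (simp_all add: X(2))
    have nK: "?K \<lhd> G" using P.central_subgroup_normal[OF K(1)] K(2) by blast
    have "{\<chi> \<in> nl G. ?K \<subseteq> ker_char G \<chi>} = {\<chi> \<in> nl G. char_field G \<chi> \<noteq> rat_adjoin {zeta (p ^ 3)}}"
      using K(3) by blast
    then have bij: "bij_betw (lift_char G ?K) (nl (G Mod ?K)) {\<chi> \<in> nl G. char_field G \<chi> \<noteq> rat_adjoin {zeta (p ^ 3)}}"
      using bij_betw_lift_char[OF nK] K(2) by auto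
    show ?case
      unfolding P.centralizer_derived_eq unfolding P.derived_eq
    proof (intro conjI allI impI ballI)
      show "P.A = generate G {x Alpha1, x Alpha2}" by (rule P.A_generate)
      show "subgroup_monoid G P.A \<cong> integer_mod_group (p ^ 3) \<times>\<times> integer_mod_group p" by (rule P.A_iso)
    next
      fix \<chi> \<psi> assume "\<psi> \<in> Irr_over (subgroup_monoid G P.A) P.D"
        "\<chi> = induced_char G P.A \<psi> \<and> primitive_root_of_unity (p ^ 3) (\<psi> (x Alpha1))"
      then show "required_pair G \<chi> P.A \<psi>" using a by simp
    next
      fix K assume K': "K = generate G {x Alpha3}"
      show "K = generate G {x Alpha1 [^]\<^bsub>G\<^esub> (p\<^sup>2)}" by (simp add: K' X(3))
      show "K \<subset> center G" "bij_betw (lift_char G K) (nl (G Mod K))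
            {\<chi> \<in> nl G. char_field G \<chi> \<noteq> rat_adjoin {zeta (p ^ 3)}}"
        using K(2) bij by (simp_all add: K')
      fix \<chi>' \<chi> H \<psi>'
      assume "char_field G \<chi> \<noteq> rat_adjoin {zeta (p ^ 3)} \<and> \<chi> = lift_char G K \<chi>'"
        "subgroup H G \<and> K \<subseteq> H \<and> required_pair (G Mod K) \<chi>' (quotient_set G K H) \<psi>'"
      then show "required_pair G \<chi> H (lift_char (subgroup_monoid G H) K \<psi>')"
        using required_pair_lift[OF nK P.fin] by (simp add: K')
    qed
  qed
qed

end
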